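(* Let $N\ge 3$, $\gamma>0$, $0<a<b<N$, and let $\mu$ be a finite positive Borel measure on $(0,N)$ with $\mu((0,N)\setminus[a,b])=0$. Assume that $\mathcal P_\mu\cap(1,N)\neq\emptyset$ and let $\alpha\in\mathcal P_\mu\cap(1,N)$. Put $$q_{\mathrm{rad}}^\alpha=\frac{2\,(2q(\alpha)(N-1)+N-\alpha)}{3N+\alpha-4}.$$ If either (i) $q(\alpha)<\dfrac{N+\alpha}{N-2}$ and $q_{\mathrm{rad}}^\alpha<r\le 2^*$, or (ii) $q(\alpha)>\dfrac{N+\alpha}{N-2}$ and $2^*\le r<q_{\mathrm{rad}}^\alpha$, then $\mathcal X_{\mathrm{rad}}(\mathbb R^N)\hookrightarrow L^r(\mathbb R^N)$ continuously. Moreover, if all the inequalities are strict (that is, $q_{\mathrm{rad}}^\alpha<r<2^*$ in case (i), $2^*<r<q_{\mathrm{rad}}^\alpha$ in case (ii)), then this embedding is compact.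
   Context: For $\beta\in(0,N)$: $I_\beta(x)=A_\beta|x|^{\beta-N}$ on $\mathbb R^N\setminus\{0\}$ with $A_\beta=\Gamma(\frac{N-\beta}{2})/(\Gamma(\frac{\beta}{2})\pi^{N/2}2^\beta)$ (Riesz potential), $\star$ denotes convolution, and $q(\beta)=1+\frac{\beta+2}{2\gamma}$. $2^*=\frac{2N}{N-2}$. For measurable $u:\mathbb R^N\to\mathbb R$ (identified a.e.) put $\rho(u)=\int_{(0,N)}\int_{\mathbb R^N}\big|I_{\beta/2}\star|u|^{q(\beta)}\big|^2dx\,d\mu(\beta)\in[0,\infty]$. The superposed Coulomb space $Q_\gamma(\mathbb R^N)$ is the set of measurable $u$ with $\rho(\lambda u)<\infty$ for some $\lambda>0$, with norm $\|u\|_{Q_\gamma}=\inf\{\lambda>0:\rho(u/\lambda)\le1\}$. $\mathcal D^{1,2}(\mathbb R^N)$ is the completion of $C_c^\infty(\mathbb R^N)$ under $\|\nabla u\|_{L^2}$ (i.e. $u\in L^{2^*}$ with $\nabla u\in L^2$). The superposed Coulomb--Sobolev space is $\mathcal X(\mathbb R^N)=\mathcal D^{1,2}(\mathbb R^N)\cap Q_\gamma(\mathbb R^N)$ with norm $\|u\|=\|\nabla u\|_{L^2}+\|u\|_{Q_\gamma}$, and $\mathcal X_{\mathrm{rad}}(\mathbb R^N)$ is its subspace of radial functions. $\mathcal P_\mu$ is the set of $\alpha\in(0,N)$ such that $\mu(I)>0$ for every open interval $I\subset(0,N)$ containing $\alpha$. *)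

theory Defs
  imports "HOL-Analysis.Analysis"
begin

text \<open>
  The space \<open>R\<^sup>N\<close> is an arbitrary Euclidean space \<open>'a\<close> with \<open>N = DIM('a)\<close>. Elements of the function
  spaces below are functions, not classes modulo almost-everywhere equality; all notions used are
  invariant under changes on null sets.
\<close>

subsection \<open>Exponents\<close>

definition q_exp :: "real \<Rightarrow> real \<Rightarrow> real" where
  "q_exp \<gamma> \<beta> = 1 + (\<beta> + 2) / (2 * \<gamma>)"

definition sobolev_exp :: "nat \<Rightarrow> real" where
  "sobolev_exp N = 2 * real N / (real N - 2)"

definition q_rad :: "nat \<Rightarrow> real \<Rightarrow> real \<Rightarrow> real" where
  "q_rad N \<gamma> \<alpha> =
     2 * (2 * q_exp \<gamma> \<alpha> * (real N - 1) + real N - \<alpha>) / (3 * real N + \<alpha> - 4)"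


subsection \<open>Lebesgue spaces\<close>

definition Lp_space :: "real \<Rightarrow> ('a::euclidean_space \<Rightarrow> 'b::euclidean_space) set" where
  "Lp_space p = {u \<in> borel_measurable lebesgue. integrable lebesgue (\<lambda>x. norm (u x) powr p)}"

definition Lp_norm :: "real \<Rightarrow> ('a::euclidean_space \<Rightarrow> 'b::euclidean_space) \<Rightarrow> real" where
  "Lp_norm p u = (\<integral>x. norm (u x) powr p \<partial>lebesgue) powr (1 / p)"


subsection \<open>The homogeneous Sobolev space\<close>

definition partial_deriv :: "'a::euclidean_space \<Rightarrow> ('a \<Rightarrow> real) \<Rightarrow> 'a \<Rightarrow> real" where
  "partial_deriv i f x = frechet_derivative f (at x) i"

primrec C_k :: "nat \<Rightarrow> ('a::euclidean_space \<Rightarrow> real) \<Rightarrow> bool" where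
  "C_k 0 f \<longleftrightarrow> continuous_on UNIV f"
| "C_k (Suc k) f \<longleftrightarrow> (\<forall>x. f differentiable (at x)) \<and> (\<forall>i\<in>Basis. C_k k (partial_deriv i f))"

definition test_functions :: "('a::euclidean_space \<Rightarrow> real) set" where
  "test_functions = {\<phi>. (\<forall>k. C_k k \<phi>) \<and> compact (closure {x. \<phi> x \<noteq> 0})}"

definition locally_integrable :: "('a::euclidean_space \<Rightarrow> 'b::euclidean_space) \<Rightarrow> bool" where
  "locally_integrable u \<longleftrightarrow> (\<forall>K. compact K \<longrightarrow> set_integrable lebesgue K u)"

definition has_weak_gradient :: "('a::euclidean_space \<Rightarrow> real) \<Rightarrow> ('a \<Rightarrow> 'a) \<Rightarrow> bool" where
  "has_weak_gradient u g \<longleftrightarrow> locally_integrable u \<and> locally_integrable g \<and>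
     (\<forall>\<phi>\<in>test_functions. \<forall>i\<in>Basis.
        (\<integral>x. u x * partial_deriv i \<phi> x \<partial>lebesgue) = - (\<integral>x. (g x \<bullet> i) * \<phi> x \<partial>lebesgue))"

text \<open>Weak gradients are unique up to null sets, so the choice does not affect \<open>L\<^sup>p\<close> norms.\<close>

definition weak_gradient :: "('a::euclidean_space \<Rightarrow> real) \<Rightarrow> 'a \<Rightarrow> 'a" where
  "weak_gradient u = (SOME g. has_weak_gradient u g)"

text \<open>
  The completion of the test functions under the \<open>L\<^sup>2\<close> norm of the gradient, in its usual
  realization as a space of functions (dimension at least 3).
\<close>

definition D12 :: "('a::euclidean_space \<Rightarrow> real) set" where
  "D12 = {u \<in> Lp_space (sobolev_exp DIM('a)). \<exists>g \<in> Lp_space 2. has_weak_gradient u g}"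


subsection \<open>The superposed Coulomb space\<close>

definition riesz_const :: "nat \<Rightarrow> real \<Rightarrow> real" where
  "riesz_const N \<beta> =
     Gamma ((real N - \<beta>) / 2) / (Gamma (\<beta> / 2) * pi powr (real N / 2) * 2 powr \<beta>)"

text \<open>The value at \<open>0\<close> is immaterial (it is \<open>0\<close> by the convention for \<open>powr\<close>).\<close>

definition riesz_kernel :: "real \<Rightarrow> 'a::euclidean_space \<Rightarrow> real" where
  "riesz_kernel \<beta> x = riesz_const DIM('a) \<beta> * norm x powr (\<beta> - real DIM('a))"

text \<open>Convolution of nonnegative functions, with values in \<open>[0, \<infinity>]\<close>.\<close>

definition nn_convolution :: "('a::euclidean_space \<Rightarrow> real) \<Rightarrow> ('a \<Rightarrow> real) \<Rightarrow> 'a \<Rightarrow> ennreal" where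
  "nn_convolution k f x = (\<integral>\<^sup>+y. ennreal (k (x - y) * f y) \<partial>lebesgue)"

definition coulomb_modular ::
    "real \<Rightarrow> real measure \<Rightarrow> ('a::euclidean_space \<Rightarrow> real) \<Rightarrow> ennreal" where
  "coulomb_modular \<gamma> \<mu> u =
     (\<integral>\<^sup>+\<beta>. (\<integral>\<^sup>+x. (nn_convolution (riesz_kernel (\<beta> / 2)) (\<lambda>y. \<bar>u y\<bar> powr q_exp \<gamma> \<beta>) x)\<^sup>2
        \<partial>lebesgue) \<partial>\<mu>)"

definition coulomb_space :: "real \<Rightarrow> real measure \<Rightarrow> ('a::euclidean_space \<Rightarrow> real) set" where
  "coulomb_space \<gamma> \<mu> =
     {u \<in> borel_measurable lebesgue. \<exists>c>0. coulomb_modular \<gamma> \<mu> (\<lambda>x. c * u x) < \<infinity>}"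

definition coulomb_norm :: "real \<Rightarrow> real measure \<Rightarrow> ('a::euclidean_space \<Rightarrow> real) \<Rightarrow> real" where
  "coulomb_norm \<gamma> \<mu> u = Inf {c. c > 0 \<and> coulomb_modular \<gamma> \<mu> (\<lambda>x. u x / c) \<le> 1}"


subsection \<open>The superposed Coulomb--Sobolev space\<close>

definition X_space :: "real \<Rightarrow> real measure \<Rightarrow> ('a::euclidean_space \<Rightarrow> real) set" where
  "X_space \<gamma> \<mu> = D12 \<inter> coulomb_space \<gamma> \<mu>"

definition X_norm :: "real \<Rightarrow> real measure \<Rightarrow> ('a::euclidean_space \<Rightarrow> real) \<Rightarrow> real" where
  "X_norm \<gamma> \<mu> u = Lp_norm 2 (weak_gradient u) + coulomb_norm \<gamma> \<mu> u"

text \<open>Since functions are identified almost everywhere, radial means having a radial representative.\<close>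

definition radial :: "('a::euclidean_space \<Rightarrow> real) \<Rightarrow> bool" where
  "radial u \<longleftrightarrow> (\<exists>v :: real \<Rightarrow> real. AE x in lebesgue. u x = v (norm x))"

definition X_rad :: "real \<Rightarrow> real measure \<Rightarrow> ('a::euclidean_space \<Rightarrow> real) set" where
  "X_rad \<gamma> \<mu> = {u \<in> X_space \<gamma> \<mu>. radial u}"


subsection \<open>The set \<open>P\<^sub>\<mu>\<close>\<close>

definition P_set :: "nat \<Rightarrow> real measure \<Rightarrow> real set" where
  "P_set N \<mu> = {\<alpha> \<in> {0<..<real N}.
     \<forall>c d. {c<..<d} \<subseteq> {0<..<real N} \<longrightarrow> \<alpha> \<in> {c<..<d} \<longrightarrow> emeasure \<mu> {c<..<d} > 0}"


subsection \<open>Embeddings of normed function spaces\<close>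

definition continuously_embedded ::
    "('a \<Rightarrow> real) set \<Rightarrow> (('a \<Rightarrow> real) \<Rightarrow> real) \<Rightarrow> ('a \<Rightarrow> real) set \<Rightarrow> (('a \<Rightarrow> real) \<Rightarrow> real) \<Rightarrow> bool"
  where
  "continuously_embedded X nX Y nY \<longleftrightarrow> X \<subseteq> Y \<and> (\<exists>C. \<forall>u\<in>X. nY u \<le> C * nX u)"

definition compactly_embedded ::
    "('a \<Rightarrow> real) set \<Rightarrow> (('a \<Rightarrow> real) \<Rightarrow> real) \<Rightarrow> ('a \<Rightarrow> real) set \<Rightarrow> (('a \<Rightarrow> real) \<Rightarrow> real) \<Rightarrow> bool"
  where
  "compactly_embedded X nX Y nY \<longleftrightarrow> continuously_embedded X nX Y nY \<and>
     (\<forall>u :: nat \<Rightarrow> 'a \<Rightarrow> real. (\<forall>n. u n \<in> X) \<longrightarrow> (\<exists>C. \<forall>n. nX (u n) \<le> C) \<longrightarrow>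
        (\<exists>v\<in>Y. \<exists>s :: nat \<Rightarrow> nat. strict_mono s \<and> (\<lambda>n. nY (\<lambda>x. u (s n) x - v x)) \<longlonglongrightarrow> 0))"

end

theory Submission
  imports Defs "HOL-Complex_Analysis.Great_Picard"
begin

text \<open>
  After division by a number exceeding its norm, a radial \<open>u\<close> has \<open>\<parallel>\<nabla>u\<parallel>\<^sub>2 \<le> 1\<close> and Coulomb modular at most \<open>1\<close>.
  As \<open>\<mu>\<close> charges every neighbourhood of \<open>\<alpha>\<close>, some \<open>\<beta>\<close> close to \<open>\<alpha>\<close>, depending on \<open>u\<close>, has a Coulomb energy
  bounded by a constant independent of \<open>u\<close>. Since \<open>r\<close> satisfies the strict inequalities for all \<open>\<beta>\<close> near \<open>\<alpha>\<close>
  with a uniform margin, estimates for a single \<open>\<beta>\<close> with uniform constants suffice.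

  The weak gradient, tested with \<open>x \<psi>(\<bar>x\<bar>) / \<bar>x\<bar>\<^sup>n\<close>, yields a profile \<open>v\<close> with \<open>u(x) = v(\<bar>x\<bar>)\<close> and
  \<open>\<omega> (v(t) - v(s)) = \<integral> \<nabla>u \<bullet> x / \<bar>x\<bar>\<^sup>n\<close> over the shell \<open>s < \<bar>x\<bar> \<le> t\<close>, \<open>\<omega>\<close> being the area of the unit sphere.
  By the Cauchy--Schwarz inequality \<open>v\<close> is locally Hoelder continuous with exponent \<open>1/2\<close> and
  \<open>v(t) = O(t^(-(n-2)/2))\<close>.

  Restricting the Riesz potential to neighbouring shells, the Coulomb energy bounds the integral \<open>J(R)\<close> of
  \<open>\<bar>u\<bar>\<^sup>q\<close> over \<open>R < \<bar>x\<bar> \<le> 2R\<close> by a multiple of \<open>R^((n-\<beta>)/2)\<close>. If \<open>m = \<bar>v(R)\<bar>\<close>, Hoelder continuity keeps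
  \<open>\<bar>v\<bar> \<ge> m/2\<close> on an interval starting at \<open>R\<close> of length comparable to \<open>m\<^sup>2 R^(n-1)\<close>, so \<open>m^(q+2)\<close> is at most a
  multiple of \<open>R^(2-2n) J(R)\<close>. Hence for \<open>r \<ge> q\<close> the integral of \<open>\<bar>u\<bar>\<^sup>r\<close> over the shell is at most a multiple
  of a power of \<open>R\<close> whose exponent has the sign of \<open>q\<^sub>r\<^sub>a\<^sub>d - r\<close>, and dyadic summation gives uniformly small
  tails at infinity in case (i) and at the origin in case (ii); at the other end the decay of \<open>v\<close> suffices.
  Equicontinuity and these tails give compactness. The remaining exponent \<open>2\<^sup>*\<close> is covered by the radial
  Sobolev inequality.
\<close>

subsection \<open>Smooth functions\<close>

text \<open>The modular is an integral over \<beta> and \<mu> need not have an atom at \<alpha>, so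
  the norm controls no single energy; averaging yields only some exponent near \<alpha> that varies
  with u. This is why every constant is tracked explicitly and uniformly in the exponent.
  \<open>q_rad\<close> is a point of balance. With \<theta> = (n-\<alpha>)/2 the shell bound has the
  exponent \<theta> - (2n-2-\<theta>)(r-q)/(q+2), affine in r with zero \<open>q_rad\<close>; twice
  2n-2-\<theta> is the denominator 3n+\<alpha>-4. The decay t^(-(n-2)/2) balances at r = 2n/(n-2)
  instead. Each end of the half-line is governed by one of these two mechanisms. As q <
  (n+\<alpha>)/(n-2) is equivalent to \<open>q_rad\<close> lying below 2n/(n-2), the two cases
  exchange the roles of the origin and infinity. A second obstacle is measure theoretic:
  \<open>radial\<close> supplies an arbitrary function of the norm, without any measurability, so
  the regularity of the profile has to be extracted from the weak gradient by radial tests.\<close>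

text \<open>\<open>C_k\<close> relativized to a set, so that functions with singularities such as powers of the norm can
  be handled.\<close>

primrec Ck_on :: "nat \<Rightarrow> 'a::euclidean_space set \<Rightarrow> ('a \<Rightarrow> real) \<Rightarrow> bool" where
  "Ck_on 0 S f \<longleftrightarrow> continuous_on S f"
| "Ck_on (Suc k) S f \<longleftrightarrow> (\<forall>x\<in>S. f differentiable (at x)) \<and> (\<forall>i\<in>Basis. Ck_on k S (partial_deriv i f))"

definition smooth_on :: "'a::euclidean_space set \<Rightarrow> ('a \<Rightarrow> real) \<Rightarrow> bool" where
  "smooth_on S f \<longleftrightarrow> (\<forall>k. Ck_on k S f)"

lemma C_k_eq_Ck_on: "C_k k f = Ck_on k UNIV f"
  by (induction k arbitrary: f) auto

lemma partial_deriv_eq: "(f has_derivative f') (at x) \<Longrightarrow> partial_deriv i f x = f' i"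
  unfolding partial_deriv_def by (metis frechet_derivative_at)

lemma differentiable_at_cong:
  assumes "open S" "x \<in> S" "\<And>y. y \<in> S \<Longrightarrow> f y = g y" "f differentiable (at x)"
  shows "g differentiable (at x)"
  using assms unfolding differentiable_def
  by (metis has_derivative_transform_within_open)

lemma partial_deriv_cong:
  assumes "open S" "x \<in> S" "\<And>y. y \<in> S \<Longrightarrow> f y = g y" "f differentiable (at x)"
  shows "partial_deriv i f x = partial_deriv i g x"
  using frechet_derivative_transform_within_open[OF assms(4,1,2)] assms(3)
  unfolding partial_deriv_def by metis

lemma Ck_on_cong:
  assumes "open S" "\<And>y. y \<in> S \<Longrightarrow> f y = g y" "Ck_on k S f"
  shows "Ck_on k S g"
  using assms(2,3)
proof (induction k arbitrary: f g)
  case 0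
  then show ?case using continuous_on_cong[of S S f g] by simp
next
  case (Suc k)
  have d: "\<forall>x\<in>S. f differentiable (at x)" and p: "\<forall>i\<in>Basis. Ck_on k S (partial_deriv i f)"
    using Suc.prems by auto
  have "\<forall>x\<in>S. g differentiable (at x)"
    using differentiable_at_cong[OF \<open>open S\<close>] Suc.prems(1) d by metis
  moreover have "Ck_on k S (partial_deriv i g)" if "i \<in> Basis" for i
  proof (rule Suc.IH[of "partial_deriv i f"])
    show "partial_deriv i f y = partial_deriv i g y" if "y \<in> S" for y
      using partial_deriv_cong[OF \<open>open S\<close> that] Suc.prems(1) d that by metis
  qed (use p that in auto)
  ultimately show ?case by simp
qed

lemma Ck_on_Suc_D: "Ck_on (Suc k) S f \<Longrightarrow> Ck_on k S f"
proof (induction k arbitrary: f)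
  case 0
  then show ?case
    by (simp add: differentiable_imp_continuous_within continuous_on_eq_continuous_within)
      (meson differentiable_imp_continuous_within differentiable_at_withinI)
next
  case (Suc k)
  then show ?case by auto
qed

lemma Ck_on_Un: "open S \<Longrightarrow> open T \<Longrightarrow> Ck_on k S f \<Longrightarrow> Ck_on k T f \<Longrightarrow> Ck_on k (S \<union> T) f"
  by (induction k arbitrary: f) (auto intro: continuous_on_open_Un)

lemma Ck_on_SucI:
  assumes "open S" "\<And>x. x \<in> S \<Longrightarrow> (f has_derivative f' x) (at x)"
    "\<And>i. i \<in> Basis \<Longrightarrow> Ck_on k S (\<lambda>x. f' x i)"
  shows "Ck_on (Suc k) S f"
proof -
  have "Ck_on k S (partial_deriv i f)" if "i \<in> Basis" for i
    by (rule Ck_on_cong[OF \<open>open S\<close> _ assms(3)[OF that]]) (simp add: partial_deriv_eq[OF assms(2)])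
  then show ?thesis using assms(2) by (auto simp: differentiable_def)
qed

lemma Ck_on_SucD:
  assumes "Ck_on (Suc k) S f" "x \<in> S"
  shows "(f has_derivative frechet_derivative f (at x)) (at x)"
  using assms frechet_derivative_works by auto

lemma Ck_on_const [simp]: "open S \<Longrightarrow> Ck_on k S (\<lambda>x. c)"
proof (induction k arbitrary: c)
  case (Suc k)
  show ?case by (rule Ck_on_SucI[OF Suc.prems]) (auto intro!: derivative_eq_intros Suc)
qed auto

lemma Ck_on_inner: "open S \<Longrightarrow> Ck_on k S (\<lambda>x. x \<bullet> i)"
proof (cases k)
  case (Suc l)
  assume "open S"
  then show ?thesis unfolding Suc
    by (intro Ck_on_SucI[where f' = "\<lambda>x h. h \<bullet> i"]) (auto intro!: derivative_eq_intros)
qed (auto intro!: continuous_intros)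

lemma Ck_on_add:
  assumes "open S" shows "Ck_on k S f \<Longrightarrow> Ck_on k S g \<Longrightarrow> Ck_on k S (\<lambda>x. f x + g x)"
proof (induction k arbitrary: f g)
  case (Suc k)
  show ?case
    by (rule Ck_on_SucI[OF assms has_derivative_add[OF Ck_on_SucD[OF Suc.prems(1)] Ck_on_SucD[OF Suc.prems(2)]]])
      (use Suc in \<open>simp_all flip: partial_deriv_def\<close>)
qed (auto intro!: continuous_intros)

lemma Ck_on_mult:
  assumes "open S" shows "Ck_on k S f \<Longrightarrow> Ck_on k S g \<Longrightarrow> Ck_on k S (\<lambda>x. f x * g x)"
proof (induction k arbitrary: f g)
  case (Suc k)
  show ?case
  proof (rule Ck_on_SucI[OF assms has_derivative_mult[OF Ck_on_SucD[OF Suc.prems(1)] Ck_on_SucD[OF Suc.prems(2)]]])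
    fix i :: 'a assume i: "i \<in> Basis"
    have "Ck_on k S (\<lambda>x. f x * partial_deriv i g x)" "Ck_on k S (\<lambda>x. partial_deriv i f x * g x)"
      by (rule Suc.IH; use Suc.prems Suc.prems[THEN Ck_on_Suc_D] i in \<open>simp\<close>)+
    then show "Ck_on k S (\<lambda>x. f x * frechet_derivative g (at x) i + frechet_derivative f (at x) i * g x)"
      unfolding partial_deriv_def[symmetric] by (rule Ck_on_add[OF assms])
  qed auto
qed (auto intro!: continuous_intros)

lemma Ck_on_sum: "open S \<Longrightarrow> (\<And>i. i \<in> A \<Longrightarrow> Ck_on k S (f i)) \<Longrightarrow> Ck_on k S (\<lambda>x. \<Sum>i\<in>A. f i x)"
  by (induction A rule: infinite_finite_induct) (auto intro: Ck_on_add)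

lemma Ck_on_prod: "open S \<Longrightarrow> (\<And>i. i \<in> A \<Longrightarrow> Ck_on k S (f i)) \<Longrightarrow> Ck_on k S (\<lambda>x. \<Prod>i\<in>A. f i x)"
  by (induction A rule: infinite_finite_induct) (auto intro: Ck_on_mult)

lemma Ck_on_compose:
  fixes h :: "real \<Rightarrow> real"
  assumes "open S" "open T"
  shows "Ck_on k T h \<Longrightarrow> Ck_on k S f \<Longrightarrow> f ` S \<subseteq> T \<Longrightarrow> Ck_on k S (\<lambda>x. h (f x))"
proof (induction k arbitrary: f h)
  case 0
  then show ?case by (auto intro: continuous_on_compose2)
next
  case (Suc k)
  show ?case
  proof (rule Ck_on_SucI[OF assms(1)])
    show "((\<lambda>x. h (f x)) has_derivative (\<lambda>v. frechet_derivative h (at (f x)) (frechet_derivative f (at x) v))) (at x)"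
      if "x \<in> S" for x
      by (rule has_derivative_compose[OF Ck_on_SucD[OF Suc.prems(2) that] Ck_on_SucD[OF Suc.prems(1)]])
        (use that Suc.prems(3) in auto)
    fix i :: 'a assume i: "i \<in> Basis"
    have "Ck_on k S (\<lambda>x. partial_deriv 1 h (f x) * partial_deriv i f x)"
    proof (rule Ck_on_mult[OF assms(1)])
      show "Ck_on k S (\<lambda>x. partial_deriv 1 h (f x))"
        by (rule Suc.IH) (use Suc.prems Suc.prems(2)[THEN Ck_on_Suc_D] in auto)
    qed (use Suc.prems i in auto)
    moreover have "partial_deriv 1 h (f x) * partial_deriv i f x
        = frechet_derivative h (at (f x)) (frechet_derivative f (at x) i)" if "x \<in> S" for x
    proof -
      have "bounded_linear (frechet_derivative h (at (f x)))"
        using Ck_on_SucD[OF Suc.prems(1), of "f x"] that Suc.prems(3) has_derivative_bounded_linear by blast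
      then have "linear (frechet_derivative h (at (f x)))" by (rule bounded_linear.linear)
      from linear_scale[OF this, of "partial_deriv i f x" 1] show ?thesis
        by (simp add: partial_deriv_def mult.commute)
    qed
    ultimately show "Ck_on k S (\<lambda>x. frechet_derivative h (at (f x)) (frechet_derivative f (at x) i))"
      using Ck_on_cong[OF assms(1)] by (metis (no_types, lifting))
  qed
qed

lemma Ck_on_SucI_real:
  fixes h :: "real \<Rightarrow> real"
  assumes "open S" "\<And>x. x \<in> S \<Longrightarrow> (h has_real_derivative h' x) (at x)" "Ck_on k S h'"
  shows "Ck_on (Suc k) S h"
  by (rule Ck_on_SucI[OF assms(1), where f' = "\<lambda>x v. h' x * v"])
     (use assms in \<open>auto simp: has_field_derivative_def\<close>)

lemma Ck_on_powr: "Ck_on k {0<..} (\<lambda>s::real. s powr a)"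
proof (induction k arbitrary: a)
  case 0 then show ?case by (auto intro!: continuous_intros)
next
  case (Suc k)
  show ?case
    by (rule Ck_on_SucI_real[where h' = "\<lambda>s. a * s powr (a - 1)"])
      (auto intro!: Ck_on_mult Suc has_real_derivative_powr)
qed

lemma Ck_on_exp: "Ck_on k UNIV (exp :: real \<Rightarrow> real)"
proof (induction k)
  case (Suc k)
  then show ?case by (intro Ck_on_SucI_real[where h' = exp]) auto
qed (auto intro!: continuous_intros)

text \<open>Away from 0, \<open>x \<bullet> x\<close> is a positive polynomial in the coordinates,
  and the power of the norm is its power a/2; the norm itself is never differentiated.\<close>

lemma Ck_on_norm_powr: "Ck_on k (- {0}) (\<lambda>x::'a::euclidean_space. norm x powr a)"
proof -
  have "Ck_on k (- {0}) (\<lambda>x::'a. x \<bullet> x)"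
    unfolding euclidean_inner[of x x for x :: 'a]
    by (intro Ck_on_sum Ck_on_mult Ck_on_inner) auto
  then have "Ck_on k (- {0}) (\<lambda>x::'a. (x \<bullet> x) powr (a / 2))"
    by (rule Ck_on_compose[of _ "{0<..}", OF _ _ Ck_on_powr, rotated 2]) auto
  moreover have "(x \<bullet> x) powr (a / 2) = norm x powr a" for x :: 'a
    unfolding norm_eq_sqrt_inner by (simp add: powr_half_sqrt[symmetric] powr_powr)
  ultimately show ?thesis by simp
qed

section \<open>Flat functions, bumps and smooth cutoffs of boxes\<close>

definition flat_exp :: "real poly \<Rightarrow> real \<Rightarrow> real" where
  "flat_exp p t = (if t > 0 then poly p (1 / t) * exp (- (1 / t)) else 0)"

lemma poly_exp_tendsto_0: "((\<lambda>x::real. poly p x * exp (- x)) \<longlongrightarrow> 0) at_top"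
proof -
  have "((\<lambda>x::real. \<Sum>i\<le>degree p. coeff p i * (x ^ i / exp x)) \<longlongrightarrow> (\<Sum>i\<le>degree p. coeff p i * 0)) at_top"
    by (intro tendsto_sum tendsto_mult tendsto_const tendsto_power_div_exp_0)
  then show ?thesis
    by (simp add: poly_altdef sum_distrib_right exp_minus divide_inverse mult.assoc)
qed

text \<open>Differentiating p(1/t) exp(-1/t) only replaces p by X^2 (p - p'), so the family is
  closed under differentiation. This is why \<open>flat_exp\<close> carries an arbitrary polynomial:
  smoothness becomes one induction over all p simultaneously.\<close>

lemma flat_exp_has_derivative:
  "(flat_exp p has_real_derivative flat_exp ([:0, 0, 1:] * (p - pderiv p)) t) (at t)"
proof (cases t "0::real" rule: linorder_cases)
  case less
  have "((\<lambda>t. 0) has_real_derivative 0) (at t)" by simp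
  then have "(flat_exp p has_real_derivative 0) (at t)"
    by (rule has_field_derivative_transform_within_open[where S = "{..<0}"])
       (use less in \<open>auto simp: flat_exp_def\<close>)
  then show ?thesis using less by (simp add: flat_exp_def)
next
  case equal
  \<comment> \<open>At 0 the right difference quotient has the same form, with p multiplied by X,
    and tends to 0; the left one is identically 0.\<close>
  have "filterlim (\<lambda>y::real. 1 / y) at_top (at_right 0)"
    using filterlim_inverse_at_top_right by (simp add: divide_inverse)
  then have "((\<lambda>y::real. poly (p * [:0,1:]) (1/y) * exp (- (1 / y))) \<longlongrightarrow> 0) (at_right 0)"
    by (rule filterlim_compose[OF poly_exp_tendsto_0])
  then have R: "((\<lambda>y. flat_exp p y / y) \<longlongrightarrow> 0) (at_right 0)"
    by (rule Lim_transform_eventually)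
       (auto simp: flat_exp_def eventually_at_filter)
  have L: "((\<lambda>y. flat_exp p y / y) \<longlongrightarrow> 0) (at_left 0)"
    by (rule Lim_transform_eventually[of "\<lambda>_. 0"]) (auto simp: flat_exp_def eventually_at_filter)
  have "((\<lambda>y. flat_exp p y / y) \<longlongrightarrow> 0) (at 0)"
    using L R filterlim_split_at by blast
  then show ?thesis using equal by (simp add: has_field_derivative_iff flat_exp_def)
next
  case greater
  have "((\<lambda>t. poly p (1 / t) * exp (- (1 / t))) has_real_derivative
      (poly p (1 / t) - poly (pderiv p) (1 / t)) * (1 / t) * (1 / t) * exp (- (1 / t))) (at t)"
    by (rule derivative_eq_intros DERIV_chain2[OF poly_DERIV] refl | use greater in \<open>simp add: field_simps\<close>)+
  then have "(flat_exp p has_real_derivative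
      (poly p (1 / t) - poly (pderiv p) (1 / t)) * (1 / t) * (1 / t) * exp (- (1 / t))) (at t)"
    by (rule has_field_derivative_transform_within_open[where S = "{0<..}"])
       (use greater in \<open>auto simp: flat_exp_def\<close>)
  then show ?thesis using greater by (simp add: flat_exp_def algebra_simps)
qed

lemma Ck_on_flat_exp: "Ck_on k UNIV (flat_exp p)"
proof (induction k arbitrary: p)
  case 0
  show ?case using DERIV_isCont[OF flat_exp_has_derivative]
    by (simp add: continuous_at_imp_continuous_on)
next
  case (Suc k)
  show ?case by (rule Ck_on_SucI_real[OF _ flat_exp_has_derivative Suc]) auto
qed

definition box_bump :: "'a::euclidean_space \<Rightarrow> 'a \<Rightarrow> 'a \<Rightarrow> real" where
  "box_bump a b x = (\<Prod>i\<in>Basis. flat_exp 1 (x \<bullet> i - a \<bullet> i) * flat_exp 1 (b \<bullet> i - x \<bullet> i))"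

lemma Ck_on_box_bump: "Ck_on k UNIV (box_bump a b)"
proof -
  have "Ck_on k UNIV (\<lambda>x. x \<bullet> i + (- (a \<bullet> i)))" "Ck_on k UNIV (\<lambda>x. b \<bullet> i + (-1) * (x \<bullet> i))" for i :: 'a
    by (intro Ck_on_add Ck_on_mult Ck_on_inner; simp)+
  then show ?thesis unfolding box_bump_def
    by (intro Ck_on_prod Ck_on_mult Ck_on_compose[OF _ _ Ck_on_flat_exp]) auto
qed

lemma box_bump_nonneg: "box_bump a b x \<ge> 0"
  by (auto simp: box_bump_def flat_exp_def intro!: prod_nonneg)

lemma box_bump_pos_iff: "box_bump a b x > 0 \<longleftrightarrow> x \<in> box a b"
proof -
  have "box_bump a b x \<noteq> 0 \<longleftrightarrow> x \<in> box a b"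
    by (auto simp: box_bump_def flat_exp_def mem_box)
  then show ?thesis using box_bump_nonneg[of a b x] by auto
qed

text \<open>As \<open>box_bump\<close> is positive exactly on the open box, this is smooth, vanishes
  off the box and increases with n to its indicator. Such cutoffs replace mollification: smooth
  tests reach indicators of boxes by dominated convergence.\<close>

definition box_cutoff :: "nat \<Rightarrow> 'a::euclidean_space \<Rightarrow> 'a \<Rightarrow> 'a \<Rightarrow> real" where
  "box_cutoff n a b x = 1 - exp (- (real n * box_bump a b x))"

lemma smooth_box_cutoff: "smooth_on UNIV (box_cutoff n a b)"
proof -
  have "Ck_on k UNIV (\<lambda>x. 1 + (-1) * exp ((- real n) * box_bump a b x))" for k
    by (intro Ck_on_add Ck_on_mult Ck_on_compose[OF _ _ Ck_on_exp] Ck_on_box_bump) auto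
  then show ?thesis by (simp add: smooth_on_def box_cutoff_def[abs_def])
qed

lemma box_cutoff_bounds: "0 \<le> box_cutoff n a b x" "box_cutoff n a b x \<le> 1"
  using box_bump_nonneg[of a b x] by (auto simp: box_cutoff_def)

lemma box_cutoff_outside: "x \<notin> box a b \<Longrightarrow> box_cutoff n a b x = 0"
  using box_bump_nonneg[of a b x] box_bump_pos_iff[of a b x] by (auto simp: box_cutoff_def)

lemma box_cutoff_tendsto: "(\<lambda>n. box_cutoff n a b x) \<longlonglongrightarrow> indicator (box a b) x"
proof (cases "x \<in> box a b")
  case True
  then have c: "box_bump a b x > 0" by (simp add: box_bump_pos_iff)
  have "filterlim (\<lambda>n. real n * box_bump a b x) at_top sequentially"
    by (rule filterlim_tendsto_pos_mult_at_top[OF tendsto_const c filterlim_real_sequentially, simplified mult.commute])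
  then have "(\<lambda>n. exp (- (real n * box_bump a b x))) \<longlonglongrightarrow> 0"
    using filterlim_compose[OF exp_at_bot filterlim_compose[OF filterlim_uminus_at_bot_at_top]] by blast
  from tendsto_diff[OF tendsto_const[of 1] this] show ?thesis using True by (simp add: box_cutoff_def)
qed (simp add: box_cutoff_outside)

lemma test_functions_iff:
  "\<phi> \<in> test_functions \<longleftrightarrow> smooth_on UNIV \<phi> \<and> bounded {x. \<phi> x \<noteq> 0}"
  by (auto simp: test_functions_def C_k_eq_Ck_on smooth_on_def compact_eq_bounded_closed bounded_closure
      intro: bounded_subset[OF _ closure_subset])

lemma box_cutoff_test: "box_cutoff n a b \<in> test_functions"
  unfolding test_functions_iff using smooth_box_cutoff box_cutoff_outside
  by (auto intro!: bounded_subset[OF bounded_box[of a b]]) blast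

subsection \<open>The fundamental lemma of the calculus of variations\<close>

lemma borel_imp_lebesgue: "f \<in> borel_measurable borel \<Longrightarrow> f \<in> borel_measurable lebesgue"
  by (simp add: measurable_completion)

lemma integrable_mult_bounded_support:
  fixes u :: "'a::euclidean_space \<Rightarrow> real"
  assumes "locally_integrable u" "\<phi> \<in> borel_measurable lebesgue"
    "\<And>x. \<bar>\<phi> x\<bar> \<le> B" "\<And>x. \<phi> x \<noteq> 0 \<Longrightarrow> x \<in> K" "compact K"
  shows "integrable lebesgue (\<lambda>x. u x * \<phi> x)"
proof -
  have K: "integrable lebesgue (\<lambda>x. indicator K x * u x)"
    using assms(1,5) by (auto simp: locally_integrable_def set_integrable_def)
  have "integrable lebesgue (\<lambda>x. \<phi> x * (indicator K x * u x))"
  proof (rule Bochner_Integration.integrable_bound[where f = "\<lambda>x. B * (indicator K x * u x)"])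
    show "integrable lebesgue (\<lambda>x. B * (indicator K x * u x))" using K by simp
    show "(\<lambda>x. \<phi> x * (indicator K x * u x)) \<in> borel_measurable lebesgue"
      using borel_measurable_integrable[OF K] assms(2) by (rule borel_measurable_times[rotated])
    have B: "B \<ge> 0" using assms(3)[of undefined] by linarith
    have "\<bar>\<phi> x\<bar> * \<bar>indicator K x * u x\<bar> \<le> \<bar>B\<bar> * \<bar>indicator K x * u x\<bar>" for x
      using assms(3)[of x] B by (intro mult_right_mono) auto
    then show "AE x in lebesgue. norm (\<phi> x * (indicator K x * u x)) \<le> norm (B * (indicator K x * u x))"
      by (simp add: abs_mult)
  qed
  moreover have "\<phi> x * (indicator K x * u x) = u x * \<phi> x" for x
    using assms(4)[of x] by (cases "\<phi> x = 0") auto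
  ultimately show ?thesis by simp
qed

lemma locally_integrable_inner:
  assumes "locally_integrable g" shows "locally_integrable (\<lambda>x. g x \<bullet> i)"
  unfolding locally_integrable_def set_integrable_def
proof safe
  fix K :: "'a set" assume "compact K"
  then have "integrable lebesgue (\<lambda>x. indicat_real K x *\<^sub>R g x)"
    using assms by (auto simp: locally_integrable_def set_integrable_def)
  then have "integrable lebesgue (\<lambda>x. (indicat_real K x *\<^sub>R g x) \<bullet> i)" by (rule integrable_inner_left) 
  then show "integrable lebesgue (\<lambda>x. indicat_real K x *\<^sub>R (g x \<bullet> i))" by simp
qed

lemma locally_integrable_imp_measurable:
  fixes f :: "'a::euclidean_space \<Rightarrow> 'b::euclidean_space"
  assumes "locally_integrable f" shows "f \<in> borel_measurable lebesgue"
proof -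
  have "(\<lambda>x. indicat_real (cball 0 (real n)) x *\<^sub>R f x) \<in> borel_measurable lebesgue" for n
    using assms compact_cball unfolding locally_integrable_def set_integrable_def
    by (blast dest: borel_measurable_integrable)
  then show ?thesis
  proof (rule borel_measurable_LIMSEQ_metric)
    fix x :: 'a
    obtain n0 where "norm x \<le> real n0" using real_arch_simple by blast
    then have "\<forall>n\<ge>n0. indicat_real (cball 0 (real n)) x *\<^sub>R f x = f x" by auto
    then show "(\<lambda>n. indicat_real (cball 0 (real n)) x *\<^sub>R f x) \<longlonglongrightarrow> f x"
      by (intro tendsto_eventually) (auto simp: eventually_sequentially)
  qed
qed

lemma integrable_indicator_box:
  fixes f :: "'a::euclidean_space \<Rightarrow> real"
  assumes "locally_integrable f" shows "integrable lebesgue (\<lambda>x. f x * indicator (box a b) x)"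
proof (rule integrable_mult_bounded_support[OF assms, of _ 1 "cbox a b"])
  show "indicat_real (box a b) \<in> borel_measurable lebesgue" by (intro borel_measurable_indicator) auto
qed (auto simp: box_subset_cbox[THEN subsetD] indicator_eq_0_iff split: split_indicator)

text \<open>The positive and negative parts of f, taken as densities, define measures that agree on
  boxes. Boxes are intersection stable and generate the Borel sets, so the measures and hence the
  densities agree; a Borel representative f' stands in for f.\<close>

lemma ae_zero_if_box_integrals_zero:
  fixes f :: "'a::euclidean_space \<Rightarrow> real"
  assumes f: "locally_integrable f" and 0: "\<And>a b. (\<integral>x. f x * indicator (box a b) x \<partial>lebesgue) = 0"
  shows "AE x in lebesgue. f x = 0"
proof -
  from completion_ex_borel_measurable_real[OF locally_integrable_imp_measurable[OF f]]
  obtain f' where f'[measurable]: "f' \<in> borel_measurable lborel" and ae: "AE x in lborel. f x = f' x" by auto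
  have ae': "AE x in lebesgue. f x = f' x" using ae by (rule AE_completion)
  let ?I = "\<lambda>a b x. indicat_real (box a b) x"
  have int: "integrable lborel (\<lambda>x. f' x * ?I a b x)" "(\<integral>x. f' x * ?I a b x \<partial>lborel) = 0" for a b
  proof -
    have i: "integrable lebesgue (\<lambda>x. f x * ?I a b x)"
      by (rule integrable_indicator_box[OF f])
    have e: "AE x in lebesgue. f x * ?I a b x = f' x * ?I a b x" using ae' by eventually_elim simp
    have m: "(\<lambda>x. f' x * ?I a b x) \<in> borel_measurable lborel" by measurable
    have "integrable lebesgue (\<lambda>x. f' x * ?I a b x)"
      by (rule integrable_cong_AE_imp[OF i borel_imp_lebesgue e]) (use m in simp)
    then show "integrable lborel (\<lambda>x. f' x * ?I a b x)" using integrable_completion[OF m] by simp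
    have "(\<integral>x. f' x * ?I a b x \<partial>lebesgue) = (\<integral>x. f x * ?I a b x \<partial>lebesgue)"
    proof (rule integral_cong_AE[OF borel_imp_lebesgue borel_measurable_integrable[OF i]])
      show "AE x in lebesgue. f' x * ?I a b x = f x * ?I a b x" using e by (simp only: eq_commute)
    qed (use m in simp)
    then show "(\<integral>x. f' x * ?I a b x \<partial>lborel) = 0" using integral_completion[OF m] 0 by simp
  qed
  let ?P = "density lborel (\<lambda>x. ennreal (f' x))" and ?M = "density lborel (\<lambda>x. ennreal (- f' x))"
  have fin: "emeasure ?P (box a b) = (\<integral>\<^sup>+x. ennreal (f' x * ?I a b x) \<partial>lborel)"
     "emeasure ?M (box a b) = (\<integral>\<^sup>+x. ennreal (- (f' x * ?I a b x)) \<partial>lborel)" for a b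
    by (auto simp: emeasure_density indicator_def intro!: nn_integral_cong)
  have fin2: "(\<integral>\<^sup>+x. ennreal (f' x * ?I a b x) \<partial>lborel) < \<infinity>"
    "(\<integral>\<^sup>+x. ennreal (- (f' x * ?I a b x)) \<partial>lborel) < \<infinity>" for a b
    using int(1)[of a b] by (auto simp: real_integrable_def top.not_eq_extremum)
  have "?P = ?M"
  proof (rule measure_eqI_generator_eq[where E = "range (\<lambda>(a, b). box a b)" and \<Omega> = UNIV and
        A = "\<lambda>n::nat. box (- (real n *\<^sub>R One)) (real n *\<^sub>R One)"])
    show "Int_stable (range (\<lambda>(a, b). box a b :: 'a set))"
      by (auto simp: Int_stable_def box_Int_box)
    show "sets ?P = sigma_sets UNIV (range (\<lambda>(a, b). box a b))" "sets ?M = sigma_sets UNIV (range (\<lambda>(a, b). box a b))"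
      by (auto simp: borel_eq_box)
    show "emeasure ?P X = emeasure ?M X" if X: "X \<in> range (\<lambda>(a, b). box a b)" for X
    proof -
      from X obtain a b where X: "X = box a b" by auto
      have "enn2real (\<integral>\<^sup>+x. ennreal (f' x * ?I a b x) \<partial>lborel) = enn2real (\<integral>\<^sup>+x. ennreal (- (f' x * ?I a b x)) \<partial>lborel)"
        using int(2)[of a b] real_lebesgue_integral_def[OF int(1)[of a b]] by simp
      then show ?thesis unfolding X fin using fin2[of a b] by (metis ennreal_enn2real infinity_ennreal_def)
    qed
    show "emeasure ?P (box (- (real n *\<^sub>R One)) (real n *\<^sub>R One)) \<noteq> \<infinity>" for n
      unfolding fin using fin2 by (metis infinity_ennreal_def less_irrefl)
  qed (use UN_box_eq_UNIV in auto)
  then have "AE x in lborel. ennreal (f' x) = ennreal (- f' x)"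
    by (subst (asm) sigma_finite_measure.density_unique_iff[OF sigma_finite_lborel]) auto
  \<comment> \<open>\<open>ennreal\<close> truncates at 0, so one side of the equation is 0 at every
    point, and then so is the other.\<close>
  then have "AE x in lborel. f' x = 0"
    by eventually_elim (metis ennreal_eq_0_iff ennreal_neg linorder_le_cases neg_le_0_iff_le order_antisym)
  then have "AE x in lebesgue. f' x = 0" by (rule AE_completion)
  with ae' show ?thesis by eventually_elim simp
qed

lemma integral_box_cutoff_tendsto:
  fixes f :: "'a::euclidean_space \<Rightarrow> real"
  assumes f: "integrable lebesgue (\<lambda>x. f x * indicator (box a b) x)"
  shows "(\<lambda>n. \<integral>x. f x * box_cutoff n a b x \<partial>lebesgue) \<longlonglongrightarrow> (\<integral>x. f x * indicator (box a b) x \<partial>lebesgue)"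
proof -
  have c: "box_cutoff n a b \<in> borel_measurable borel" for n
    using smooth_box_cutoff[of n a b] by (auto simp: smooth_on_def dest!: spec[of _ 0] intro: borel_measurable_continuous_onI)
  have e: "f x * box_cutoff n a b x = (f x * indicator (box a b) x) * box_cutoff n a b x" for x n
    by (auto simp: indicator_def box_cutoff_outside)
  show ?thesis
  proof (rule integral_dominated_convergence[where w = "\<lambda>x. norm (f x * indicator (box a b) x)"])
    show "(\<lambda>x. f x * indicator (box a b) x) \<in> borel_measurable lebesgue" using f by auto
    show "(\<lambda>x. f x * box_cutoff n a b x) \<in> borel_measurable lebesgue" for n
      unfolding e using borel_measurable_integrable[OF f]
      by (rule borel_measurable_times) (use c[of n] in \<open>auto intro: measurable_completion\<close>)
    show "integrable lebesgue (\<lambda>x. norm (f x * indicator (box a b) x))" using f by (rule integrable_norm)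
    show "AE x in lebesgue. (\<lambda>n. f x * box_cutoff n a b x) \<longlonglongrightarrow> f x * indicator (box a b) x"
      by (auto intro!: tendsto_mult box_cutoff_tendsto)
    show "AE x in lebesgue. norm (f x * box_cutoff n a b x) \<le> norm (f x * indicator (box a b) x)" for n
      unfolding e using box_cutoff_bounds[of n a b] by (auto simp: abs_mult intro!: mult_left_le)
  qed
qed

lemma fundamental_lemma:
  fixes f :: "'a::euclidean_space \<Rightarrow> real"
  assumes f: "locally_integrable f" and 0: "\<And>\<phi>. \<phi> \<in> test_functions \<Longrightarrow> (\<integral>x. f x * \<phi> x \<partial>lebesgue) = 0"
  shows "AE x in lebesgue. f x = 0"
proof (rule ae_zero_if_box_integrals_zero[OF f])
  fix a b :: 'a
  have "integrable lebesgue (\<lambda>x. f x * indicator (box a b) x)"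
    by (rule integrable_indicator_box[OF f])
  from integral_box_cutoff_tendsto[OF this] show "(\<integral>x. f x * indicator (box a b) x \<partial>lebesgue) = 0"
    by (simp add: 0 box_cutoff_test LIMSEQ_const_iff)
qed

lemma smooth_on_imp_continuous: "smooth_on S f \<Longrightarrow> continuous_on S f"
  by (metis Ck_on.simps(1) smooth_on_def)

lemma integrable_mult_test:
  fixes u :: "'a::euclidean_space \<Rightarrow> real"
  assumes "locally_integrable u" "continuous_on UNIV \<phi>" "bounded {x. \<phi> x \<noteq> 0}"
  shows "integrable lebesgue (\<lambda>x. u x * \<phi> x)"
proof -
  let ?K = "closure {x. \<phi> x \<noteq> 0}"
  have K: "compact ?K" using assms(3) by (simp add: compact_eq_bounded_closed bounded_closure)
  then have "bounded (\<phi> ` ?K)"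
    by (intro compact_imp_bounded compact_continuous_image continuous_on_subset[OF assms(2)]) auto
  then obtain B where B: "\<And>x. x \<in> ?K \<Longrightarrow> \<bar>\<phi> x\<bar> \<le> B" "B > 0" by (auto simp: bounded_pos)
  have z: "\<phi> x \<noteq> 0 \<Longrightarrow> x \<in> ?K" for x using subsetD[OF closure_subset, of x "{x. \<phi> x \<noteq> 0}"] by simp
  have "\<bar>\<phi> x\<bar> \<le> B" for x using B z[of x] by (cases "\<phi> x = 0") auto
  then show ?thesis
    by (intro integrable_mult_bounded_support[OF assms(1) _ _ z K])
      (use assms(2) in \<open>auto intro: borel_measurable_continuous_onI borel_imp_lebesgue\<close>)
qed

lemma weak_gradient_unique:
  assumes "has_weak_gradient u g" "has_weak_gradient u h"
  shows "AE x in lebesgue. g x = h x"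
proof -
  have "AE x in lebesgue. g x \<bullet> i - h x \<bullet> i = 0" if i: "i \<in> Basis" for i
  proof (rule fundamental_lemma)
    have l: "locally_integrable (\<lambda>x. g x \<bullet> i)" "locally_integrable (\<lambda>x. h x \<bullet> i)"
      using assms by (auto simp: has_weak_gradient_def intro: locally_integrable_inner)
    then show "locally_integrable (\<lambda>x. g x \<bullet> i - h x \<bullet> i)"
      unfolding locally_integrable_def using set_integral_diff(1) by blast
    fix \<phi> :: "'a \<Rightarrow> real" assume p: "\<phi> \<in> test_functions"
    then have q: "continuous_on UNIV \<phi>" "bounded {x. \<phi> x \<noteq> 0}"
      by (auto simp: test_functions_iff smooth_on_imp_continuous)
    have "(\<integral>x. (g x \<bullet> i) * \<phi> x \<partial>lebesgue) = (\<integral>x. (h x \<bullet> i) * \<phi> x \<partial>lebesgue)"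
      using assms p i by (auto simp: has_weak_gradient_def)
    then show "(\<integral>x. (g x \<bullet> i - h x \<bullet> i) * \<phi> x \<partial>lebesgue) = 0"
      using integrable_mult_test[OF l(1) q] integrable_mult_test[OF l(2) q]
      by (simp add: left_diff_distrib)
  qed
  then have "AE x in lebesgue. \<forall>i\<in>Basis. g x \<bullet> i - h x \<bullet> i = 0"
    by (simp add: AE_finite_all)
  then show ?thesis by eventually_elim (auto intro: euclidean_eqI)
qed

text \<open>\<open>weak_gradient\<close> is chosen among all weak gradients, not only the square
  integrable ones; uniqueness almost everywhere transfers square integrability to the chosen
  one.\<close>

lemma D12_weak_gradient:
  assumes "u \<in> D12"
  shows "has_weak_gradient u (weak_gradient u)" "weak_gradient u \<in> Lp_space 2"
proof -
  from assms obtain g where g: "g \<in> Lp_space 2" "has_weak_gradient u g" by (auto simp: D12_def)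
  from g(2) show w: "has_weak_gradient u (weak_gradient u)" unfolding weak_gradient_def by (rule someI[where P = "has_weak_gradient u"])
  have ae: "AE x in lebesgue. g x = weak_gradient u x" by (rule weak_gradient_unique[OF g(2) w])
  have m: "weak_gradient u \<in> borel_measurable lebesgue"
    using w locally_integrable_imp_measurable by (auto simp: has_weak_gradient_def)
  have "integrable lebesgue (\<lambda>x. norm (weak_gradient u x) powr 2)"
    by (rule integrable_cong_AE_imp[of _ "\<lambda>x. norm (g x) powr 2"]) (use ae g(1) m in \<open>auto simp: Lp_space_def\<close>)
  with m show "weak_gradient u \<in> Lp_space 2" by (simp add: Lp_space_def)
qed

subsection \<open>Integration of radial functions\<close>

definition sphere_area :: "nat \<Rightarrow> real" where
  "sphere_area n = real n * unit_ball_vol (real n)"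

lemma sphere_area_pos: "n > 0 \<Longrightarrow> sphere_area n > 0"
  by (simp add: sphere_area_def)

text \<open>Polar coordinates for functions of the norm. Both measures give {..a} the volume of the
  ball of radius a, because the density is the derivative of that volume in the radius.\<close>

lemma distr_norm_lborel:
  "distr (lborel :: 'a::euclidean_space measure) borel norm =
     density lborel (\<lambda>t. ennreal (sphere_area DIM('a) * t ^ (DIM('a) - 1) * indicator {0..} t))"
  (is "?M = ?P")
proof (rule measure_eqI_generator_eq[where E = "range atMost" and \<Omega> = UNIV and A = "\<lambda>n::nat. {..real n}"])
  have e: "emeasure ?M {..a} = emeasure ?P {..a} \<and> emeasure ?M {..a} < \<infinity>" for a :: real
  proof (cases "a \<ge> 0")
    case True
    let ?n = "DIM('a)"
    have "norm -` {..a} \<inter> space lborel = cball (0::'a) a" by auto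
    then have M: "emeasure ?M {..a} = ennreal (unit_ball_vol (real ?n) * a ^ ?n)"
      using True by (simp add: emeasure_distr emeasure_cball)
    have "emeasure ?P {..a} = (\<integral>\<^sup>+t. ennreal (sphere_area ?n * t ^ (?n - 1)) * indicator {0..a} t \<partial>lborel)"
      by (auto simp: emeasure_density intro!: nn_integral_cong split: split_indicator)
    also have "\<dots> = ennreal (unit_ball_vol (real ?n) * a ^ ?n - unit_ball_vol (real ?n) * 0 ^ ?n)"
    proof (rule nn_integral_FTC_Icc[where F = "\<lambda>t. unit_ball_vol (real ?n) * t ^ ?n"])
      show "((\<lambda>t. unit_ball_vol (real ?n) * t ^ ?n) has_real_derivative sphere_area ?n * x ^ (?n - 1)) (at x)" for x
        unfolding sphere_area_def by (auto intro!: derivative_eq_intros)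
    qed (use True in \<open>auto simp: sphere_area_def\<close>)
    also have "\<dots> = ennreal (unit_ball_vol (real ?n) * a ^ ?n)" by (simp add: power_0_left)
    finally show ?thesis using M by simp
  next
    case False
    have "norm -` {..a} \<inter> space lborel = ({} :: 'a set)" using False by (auto dest: order_trans[OF norm_ge_zero])
    moreover have "emeasure ?P {..a} = 0"
    proof -
      have "emeasure ?P {..a} = (\<integral>\<^sup>+t. ennreal (sphere_area DIM('a) * t ^ (DIM('a) - 1) * indicator {0..} t) * indicator {..a} t \<partial>lborel)"
        by (rule emeasure_density) auto
      also have "\<dots> = (\<integral>\<^sup>+t. 0 \<partial>(lborel::real measure))"
        by (rule nn_integral_cong) (use False in \<open>auto split: split_indicator\<close>)
      finally show ?thesis by simp
    qed
    ultimately show ?thesis by (simp add: emeasure_distr)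
  qed
  show "Int_stable (range atMost :: real set set)" by (auto simp: Int_stable_def)
  show "sets ?M = sigma_sets UNIV (range atMost)" "sets ?P = sigma_sets UNIV (range atMost)"
    by (auto simp: borel_eq_atMost)
  show "emeasure ?M X = emeasure ?P X" if "X \<in> range atMost" for X using that e by auto
  show "emeasure ?M {..real i} \<noteq> \<infinity>" for i using e[of "real i"] by auto
  show "(\<Union>i::nat. {..real i}) = UNIV" using real_arch_simple by auto
qed auto

text \<open>The factor |x|^(1-n) cancels the Jacobian; the condition on the support of h avoids
  division by zero at the origin.\<close>

lemma integral_radial:
  assumes h[measurable]: "h \<in> borel_measurable borel" and supp: "\<And>t. h t \<noteq> 0 \<Longrightarrow> t > 0"
  shows "(\<integral>x. h (norm x) / norm x ^ (DIM('a) - 1) \<partial>(lborel :: 'a::euclidean_space measure))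
    = sphere_area DIM('a) * (\<integral>t. h t \<partial>lborel)"
proof -
  let ?n = "DIM('a)"
  have "(\<integral>x. h (norm x) / norm x ^ (?n - 1) \<partial>(lborel :: 'a measure))
     = (\<integral>t. h t / t ^ (?n - 1) \<partial>distr (lborel :: 'a measure) borel norm)"
    by (subst integral_distr) auto
  also have "\<dots> = (\<integral>t. (sphere_area ?n * t ^ (?n - 1) * indicator {0..} t) *\<^sub>R (h t / t ^ (?n - 1)) \<partial>lborel)"
    unfolding distr_norm_lborel
    by (rule integral_density) (auto simp: sphere_area_def split: split_indicator)
  also have "\<dots> = (\<integral>t. sphere_area ?n * h t \<partial>lborel)"
    by (rule Bochner_Integration.integral_cong) (use supp in \<open>force split: split_indicator\<close>)+
  finally show ?thesis by simp
qed

lemma sphere_null: "{x::'a::euclidean_space. norm x = t} \<in> null_sets lebesgue"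
proof -
  have "{x::'a. norm x = t} = sphere 0 t" by auto
  then show ?thesis using negligible_sphere[of "0::'a" t] by (simp add: negligible_iff_null_sets)
qed

lemma AE_norm_neq: "AE x in lebesgue. norm (x::'a::euclidean_space) \<noteq> t"
  using AE_not_in[OF sphere_null[of t]] by eventually_elim simp

subsection \<open>Radial test functions\<close>

lemma test_functions_partial_deriv:
  assumes "\<phi> \<in> test_functions" "i \<in> Basis"
  shows "partial_deriv i \<phi> \<in> test_functions"
proof -
  have "Ck_on k UNIV (partial_deriv i \<phi>)" for k
    using assms by (auto simp: test_functions_iff smooth_on_def dest!: spec[of _ "Suc k"])
  moreover have "{x. partial_deriv i \<phi> x \<noteq> 0} \<subseteq> closure {x. \<phi> x \<noteq> 0}"
  proof safe
    fix x assume x: "partial_deriv i \<phi> x \<noteq> 0" 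
    show "x \<in> closure {x. \<phi> x \<noteq> 0}"
    proof (rule ccontr)
      assume n: "x \<notin> closure {x. \<phi> x \<noteq> 0}"
      have "partial_deriv i (\<lambda>x. 0) x = partial_deriv i \<phi> x"
        by (rule partial_deriv_cong[where S = "- closure {x. \<phi> x \<noteq> 0}"])
          (use n subsetD[OF closure_subset, of _ "{x. \<phi> x \<noteq> 0}"] in auto)
      moreover have "partial_deriv i (\<lambda>x. 0) x = 0"
        by (simp add: partial_deriv_def)
      ultimately show False using x by simp
    qed
  qed
  moreover have "bounded (closure {x. \<phi> x \<noteq> 0})"
    using assms by (auto simp: test_functions_iff)
  ultimately show ?thesis by (auto simp: test_functions_iff smooth_on_def intro: bounded_subset)
qed

lemma derivative_zero_outside:
  assumes "\<And>t. (\<psi> has_real_derivative \<psi>' t) (at t)" "\<And>t. \<psi> t \<noteq> 0 \<Longrightarrow> c < t \<and> t < d"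
    and "t < c \<or> d < t"
  shows "\<psi>' t = 0"
proof (rule DERIV_unique[OF assms(1)])
  have "((\<lambda>t. 0) has_real_derivative 0) (at t)" by simp
  then show "(\<psi> has_real_derivative 0) (at t)"
    by (rule has_field_derivative_transform_within_open[where S = "{..<c} \<union> {d<..}"]) (use assms in \<open>force+\<close>)
qed

lemma integrable_mult_test_function:
  "locally_integrable (u :: 'a::euclidean_space \<Rightarrow> real) \<Longrightarrow> \<phi> \<in> test_functions \<Longrightarrow> integrable lebesgue (\<lambda>x. u x * \<phi> x)"
  by (rule integrable_mult_test) (auto simp: test_functions_iff smooth_on_imp_continuous)

text \<open>The radial part of the weak gradient, from the test field
  \<open>x \<psi>(\<bar>x\<bar>) / \<bar>x\<bar>\<^sup>n\<close>, whose divergence is \<open>\<psi>'(\<bar>x\<bar>) / \<bar>x\<bar>^(n-1)\<close>.\<close>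

lemma radial_test_field:
  fixes u :: "'a::euclidean_space \<Rightarrow> real"
  assumes wg: "has_weak_gradient u g"
    and sm: "smooth_on UNIV \<psi>" and d\<psi>: "\<And>t. (\<psi> has_real_derivative \<psi>' t) (at t)"
    and c: "0 < c" and supp: "\<And>t. \<psi> t \<noteq> 0 \<Longrightarrow> c < t \<and> t < d"
  shows "(\<integral>x. u x * (\<psi>' (norm x) / norm x ^ (DIM('a) - 1)) \<partial>lebesgue)
       = - (\<integral>x. (g x \<bullet> x) / norm x ^ DIM('a) * \<psi> (norm x) \<partial>lebesgue)"
proof -
  let ?n = "DIM('a)"
  define H where "H s = s powr (- real ?n) * \<psi> s" for s
  define \<phi> where "\<phi> i x = (x \<bullet> i) * H (norm x)" for i x :: 'a
  have n1: "?n \<ge> 1" by (simp add: Suc_leI)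
  have z: "H (norm x) = 0" if "x \<in> ball 0 c" for x :: 'a
    using supp[of "norm x"] that by (auto simp: H_def)
  have test: "\<phi> i \<in> test_functions" if "i \<in> Basis" for i
  proof -
    have A: "Ck_on k (- {0}) (\<phi> i)" for k
      unfolding \<phi>_def H_def
    proof (intro Ck_on_mult Ck_on_inner Ck_on_norm_powr)
      have "Ck_on k (- {0}) (\<lambda>x::'a. norm x powr 1)" by (rule Ck_on_norm_powr)
      then have "Ck_on k (- {0}) (\<lambda>x::'a. \<psi> (norm x powr 1))"
        by (rule Ck_on_compose[of _ UNIV, rotated 3]) (use sm in \<open>auto simp: smooth_on_def\<close>)
      then show "Ck_on k (- {0}) (\<lambda>x::'a. \<psi> (norm x))" by simp
    qed auto
    \<comment> \<open>Powers of the norm are singular only at 0, and near 0 the factor \<psi>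
      vanishes identically; smoothness on the two open sets is glued.\<close>
    have B: "Ck_on k (ball 0 c) (\<phi> i)" for k
      by (rule Ck_on_cong[of _ "\<lambda>x. 0"]) (simp_all add: \<phi>_def z)
    have "Ck_on k (- {0} \<union> ball 0 c) (\<phi> i)" for k
      by (rule Ck_on_Un[OF _ _ A B]) auto
    moreover have "- {0} \<union> ball 0 c = (UNIV :: 'a set)" using c by auto
    ultimately have "smooth_on UNIV (\<phi> i)" by (simp add: smooth_on_def)
    moreover have "bounded {x. \<phi> i x \<noteq> 0}"
      by (rule bounded_subset[OF bounded_cball[of 0 d]])
        (use supp in \<open>force simp: \<phi>_def H_def\<close>)
    ultimately show ?thesis by (simp add: test_functions_iff)
  qed
  note dz = derivative_zero_outside[OF d\<psi> supp]
  have pd: "partial_deriv i (\<phi> i) x = H (norm x) + (x \<bullet> i)\<^sup>2 *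
      ((- real ?n * norm x powr (- real ?n - 1) * \<psi> (norm x) + norm x powr (- real ?n) * \<psi>' (norm x)) / norm x)"
    if i: "i \<in> Basis" and x: "x \<noteq> 0" for i x
  proof -
    have H': "(H has_real_derivative (- real ?n * s powr (- real ?n - 1) * \<psi> s + s powr (- real ?n) * \<psi>' s)) (at s)" if "s > 0" for s
      unfolding H_def by (rule derivative_eq_intros has_real_derivative_powr d\<psi> that refl)+ (simp add: algebra_simps)
    have "(\<phi> i has_derivative (\<lambda>h. (x \<bullet> i) * ((- real ?n * norm x powr (- real ?n - 1) * \<psi> (norm x) + norm x powr (- real ?n) * \<psi>' (norm x)) * (h \<bullet> sgn x)) + (h \<bullet> i) * H (norm x))) (at x)"
      unfolding \<phi>_def
      by (rule has_derivative_mult[OF has_derivative_inner_left[OF has_derivative_ident]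
         has_derivative_compose[OF has_derivative_norm[OF x] H'[of "norm x", unfolded has_field_derivative_def]]]) (use x in auto)
    from partial_deriv_eq[OF this, of i] show ?thesis using i x
      by (simp add: power2_eq_square sgn_div_norm inner_commute divide_simps)
  qed
  have sum1: "(\<Sum>i\<in>Basis. partial_deriv i (\<phi> i) x) = \<psi>' (norm x) / norm x ^ (?n - 1)" for x
  proof (cases "x = 0")
    case True
    have "partial_deriv i (\<phi> i) x = partial_deriv i (\<lambda>x. 0) x" for i
      by (rule partial_deriv_cong[symmetric, where S = "ball 0 c"]) (use True c z in \<open>auto simp: \<phi>_def\<close>)
    then show ?thesis using True dz[of 0] c by (simp add: partial_deriv_def)
  next
    case False
    have 1: "(\<Sum>i\<in>Basis. (x \<bullet> i)\<^sup>2) = (norm x)\<^sup>2"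
      unfolding power2_norm_eq_inner euclidean_inner[of x x] by (simp add: power2_eq_square)
    \<comment> \<open>The divergence of x H(|x|) is n H + |x| H'. For H(s) = s^(-n) \<psi>(s) the
      terms without \<psi>' cancel, which explains the power -n in the field.\<close>
    have "(\<Sum>i\<in>Basis. partial_deriv i (\<phi> i) x) = real ?n * H (norm x) + (norm x)\<^sup>2 *
      ((- real ?n * norm x powr (- real ?n - 1) * \<psi> (norm x) + norm x powr (- real ?n) * \<psi>' (norm x)) / norm x)"
      using False by (simp add: pd sum.distrib 1[symmetric] sum_distrib_right sum_divide_distrib)
    also have "norm x powr (- real ?n - 1) = norm x powr (- real ?n) / norm x"
      using False by (simp add: powr_diff)
    also have "real ?n * H (norm x) + (norm x)\<^sup>2 * ((- real ?n * (norm x powr (- real ?n) / norm x) * \<psi> (norm x) + norm x powr (- real ?n) * \<psi>' (norm x)) / norm x)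
       = norm x * norm x powr (- real ?n) * \<psi>' (norm x)"
      using False by (simp add: H_def field_simps power2_eq_square)
    also have "norm x powr (- real ?n) = 1 / norm x ^ ?n"
      using False by (simp add: powr_minus powr_realpow divide_inverse)
    also have "norm x ^ ?n = norm x * norm x ^ (?n - 1)"
      using n1 by (metis Suc_diff_1 less_eq_Suc_le One_nat_def power_Suc)
    finally show ?thesis using False by simp
  qed
  have sum2: "(\<Sum>i\<in>Basis. (g x \<bullet> i) * \<phi> i x) = (g x \<bullet> x) / norm x ^ ?n * \<psi> (norm x)" for x
  proof -
    have "(\<Sum>i\<in>Basis. (g x \<bullet> i) * \<phi> i x) = (\<Sum>i\<in>Basis. (g x \<bullet> i) * (x \<bullet> i)) * H (norm x)"
      by (simp add: \<phi>_def sum_distrib_right mult.assoc)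
    also have "(\<Sum>i\<in>Basis. (g x \<bullet> i) * (x \<bullet> i)) = g x \<bullet> x" by (rule euclidean_inner[symmetric])
    finally show ?thesis
      by (cases "x = 0") (simp_all add: H_def powr_minus powr_realpow divide_inverse)
  qed
  have li: "locally_integrable u" "\<And>i. locally_integrable (\<lambda>x. g x \<bullet> i)"
    using wg locally_integrable_inner by (auto simp: has_weak_gradient_def)
  have "(\<integral>x. u x * (\<psi>' (norm x) / norm x ^ (?n - 1)) \<partial>lebesgue) = (\<integral>x. (\<Sum>i\<in>Basis. u x * partial_deriv i (\<phi> i) x) \<partial>lebesgue)"
    by (simp only: sum1[symmetric] sum_distrib_left)
  also have "\<dots> = (\<Sum>i\<in>Basis. \<integral>x. u x * partial_deriv i (\<phi> i) x \<partial>lebesgue)"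
    by (rule Bochner_Integration.integral_sum) (intro integrable_mult_test_function li test_functions_partial_deriv test; assumption)
  also have "\<dots> = (\<Sum>i\<in>Basis. - (\<integral>x. (g x \<bullet> i) * \<phi> i x \<partial>lebesgue))"
    using wg test by (auto simp: has_weak_gradient_def)
  also have "\<dots> = - (\<integral>x. (\<Sum>i\<in>Basis. (g x \<bullet> i) * \<phi> i x) \<partial>lebesgue)"
    unfolding sum_negf
    by (subst Bochner_Integration.integral_sum) (auto intro!: integrable_mult_test_function li test)
  finally show ?thesis by (simp only: sum2)
qed

subsection \<open>Radial functions in the Sobolev space\<close>

abbreviation shell :: "real \<Rightarrow> real \<Rightarrow> 'a::euclidean_space set" where
  "shell s t \<equiv> {x. s < norm x \<and> norm x \<le> t}"

lemma shell_borel [measurable]: "shell s t \<in> sets borel" by measurable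

lemma shell_lebesgue: "shell s t \<in> sets lebesgue" using shell_borel by (metis sets_completionI_sets sets_lborel)

text \<open>Anchored at radius 1, because G will be integrable only on shells away from the origin;
  below 1 the sign is reversed so that differences are shell integrals throughout.\<close>

definition radial_primitive :: "('a::euclidean_space \<Rightarrow> real) \<Rightarrow> real \<Rightarrow> real" where
  "radial_primitive G t = (if t \<ge> 1 then \<integral>x. G x * indicator (shell 1 t) x \<partial>lebesgue
     else - (\<integral>x. G x * indicator (shell t 1) x \<partial>lebesgue)) / sphere_area DIM('a)"

lemma shell_integral_split:
  fixes G :: "'a::euclidean_space \<Rightarrow> real"
  assumes G: "\<And>p q. 0 < p \<Longrightarrow> integrable lebesgue (\<lambda>x. G x * indicator (shell p q) x)"
    and "0 < a" "a \<le> b" "b \<le> c"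
  shows "(\<integral>x. G x * indicator (shell a c) x \<partial>lebesgue) =
     (\<integral>x. G x * indicator (shell a b) x \<partial>lebesgue) + (\<integral>x. G x * indicator (shell b c) x \<partial>lebesgue)"
proof -
  have "G x * indicator (shell a c) x = G x * indicator (shell a b) x + G x * indicator (shell b c) x" for x
    using assms(3,4) by (auto split: split_indicator)
  then show ?thesis using assms(2,3) G by simp
qed

lemma radial_primitive_diff:
  fixes G :: "'a::euclidean_space \<Rightarrow> real"
  assumes G: "\<And>p q. 0 < p \<Longrightarrow> integrable lebesgue (\<lambda>x. G x * indicator (shell p q) x)"
    and st: "0 < s" "s \<le> t"
  shows "sphere_area DIM('a) * (radial_primitive G t - radial_primitive G s) = (\<integral>x. G x * indicator (shell s t) x \<partial>lebesgue)"
proof -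
  have p: "sphere_area DIM('a) > 0" by (simp add: sphere_area_pos)
  let ?I = "\<lambda>a b. \<integral>x. G x * indicator (shell a b) x \<partial>lebesgue"
  consider "1 \<le> s" | "s < 1" "1 \<le> t" | "t < 1" by linarith
  then show ?thesis
  proof cases
    case 1
    then show ?thesis using shell_integral_split[OF G, of 1 s t] st p
      by (simp add: radial_primitive_def diff_divide_distrib[symmetric])
  next
    case 2
    then show ?thesis using shell_integral_split[OF G, of s 1 t] st p
      by (simp add: radial_primitive_def add_divide_distrib[symmetric] field_simps)
  next
    case 3
    then show ?thesis using shell_integral_split[OF G, of s t 1] st p
      by (simp add: radial_primitive_def field_simps)
  qed
qed

lemma integrable_radial_gradient:
  fixes g :: "'a::euclidean_space \<Rightarrow> 'a"
  assumes g: "locally_integrable g" and p: "0 < p"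
  shows "integrable lebesgue (\<lambda>x. (g x \<bullet> x) / norm x ^ DIM('a) * indicator (shell p q) x)"
proof -
  let ?n = "DIM('a)"
  have "integrable lebesgue (\<lambda>x. \<Sum>i\<in>Basis. (g x \<bullet> i) * ((x \<bullet> i) / norm x ^ ?n * indicator (shell p q) x))"
  proof (intro Bochner_Integration.integrable_sum integrable_mult_bounded_support[OF locally_integrable_inner[OF g]])
    fix i :: 'a assume i: "i \<in> Basis"
    show "(\<lambda>x. (x \<bullet> i) / norm x ^ ?n * indicator (shell p q) x) \<in> borel_measurable lebesgue"
      by (rule borel_imp_lebesgue) measurable
    show "\<bar>(x \<bullet> i) / norm x ^ ?n * indicator (shell p q) x\<bar> \<le> \<bar>q\<bar> / p ^ ?n" for x
    proof (cases "x \<in> shell p q")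
      case True
      have "\<bar>x \<bullet> i\<bar> \<le> \<bar>q\<bar>" using Basis_le_norm[OF i, of x] True by auto
      moreover have "p ^ ?n \<le> norm x ^ ?n" using True p by (intro power_mono) auto
      ultimately show ?thesis using True p by (auto simp: abs_divide intro!: frac_le)
    qed (use p in auto)
    show "x \<in> cball 0 q" if "(x \<bullet> i) / norm x ^ ?n * indicator (shell p q) x \<noteq> 0" for x
      using that by (auto split: split_indicator_asm)
  qed auto
  moreover have "(\<Sum>i\<in>Basis. (g x \<bullet> i) * ((x \<bullet> i) / norm x ^ ?n * indicator (shell p q) x))
      = (g x \<bullet> x) / norm x ^ ?n * indicator (shell p q) x" for x
    unfolding euclidean_inner[of "g x" x] by (simp add: sum_distrib_right sum_divide_distrib mult.assoc)
  ultimately show ?thesis by simp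
qed

text \<open>Fubini for h(x) G(y) on the region |y| \<le> |x|, up to the factor
  \<open>sphere_area\<close>: integrating over y first produces the primitive, integrating over x
  first produces -\<psi>(|y|) by polar coordinates. So the primitive satisfies the identity that
  \<open>radial_test_field\<close> gives for u.\<close>

lemma radial_primitive_by_parts:
  fixes G :: "'a::euclidean_space \<Rightarrow> real"
  assumes G: "\<And>p q. 0 < p \<Longrightarrow> integrable lebesgue (\<lambda>x. G x * indicator (shell p q) x)"
    and d\<psi>: "\<And>t. (\<psi> has_real_derivative \<psi>' t) (at t)" and cont: "continuous_on UNIV \<psi>'"
    and c: "0 < c" and supp: "\<And>t. \<psi> t \<noteq> 0 \<Longrightarrow> c < t \<and> t < d"
  shows "integrable lebesgue (\<lambda>x::'a. radial_primitive G (norm x) * (\<psi>' (norm x) / norm x ^ (DIM('a) - 1)))" (is ?int)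
    and "(\<integral>x. radial_primitive G (norm (x :: 'a)) * (\<psi>' (norm x) / norm x ^ (DIM('a) - 1)) \<partial>lebesgue)
       = - (\<integral>x. G x * \<psi> (norm x) \<partial>lebesgue)" (is ?eq)
proof -
  let ?n = "DIM('a)" and ?w = "sphere_area DIM('a)"
  have w: "?w > 0" by (simp add: sphere_area_pos)
  have [measurable]: "\<psi>' \<in> borel_measurable borel" using cont by (rule borel_measurable_continuous_onI)
  have [measurable]: "\<psi> \<in> borel_measurable borel"
    using d\<psi> by (auto intro!: borel_measurable_continuous_onI continuous_at_imp_continuous_on DERIV_isCont)
  note dz = derivative_zero_outside[OF d\<psi> supp]
  define h where "h x = \<psi>' (norm x) / norm x ^ (?n - 1)" for x :: 'a
  have hz: "h x = 0" if "norm x < c \<or> d < norm x" for x using dz that by (simp add: h_def)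
  have [measurable]: "h \<in> borel_measurable borel" unfolding h_def by measurable
  have FTC: "(\<integral>t. \<psi>' t * indicator {s..} t \<partial>lborel) = - \<psi> s" for s
  proof -
    have m: "\<psi>' t * indicator {s..} t = indicator {s..max s (d + 1)} t *\<^sub>R \<psi>' t" for t
      using dz[of t] by (auto simp: not_le less_max_iff_disj split: split_indicator)
    have "(\<integral>t. indicator {s..max s (d + 1)} t *\<^sub>R \<psi>' t \<partial>lborel) = \<psi> (max s (d + 1)) - \<psi> s"
    proof (rule integral_FTC_atLeastAtMost)
      show "(\<psi> has_vector_derivative \<psi>' x) (at x within {s..max s (d + 1)})" for x
        using d\<psi> by (auto simp: has_real_derivative_iff_has_vector_derivative intro: has_vector_derivative_at_within)
      show "continuous_on {s..max s (d + 1)} \<psi>'" using cont by (rule continuous_on_subset) simp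
    qed simp
    moreover have "\<psi> (max s (d + 1)) = 0" using supp[of "max s (d + 1)"] by auto
    ultimately show ?thesis unfolding m by simp
  qed
  have H: "(\<integral>x. h x * indicator {s..} (norm x) \<partial>lborel) = - ?w * \<psi> s" if "s > 0" for s
  proof -
    have "(\<integral>x. h x * indicator {s..} (norm x) \<partial>lborel) = (\<integral>x. (\<psi>' (norm x) * indicator {s..} (norm x)) / norm x ^ (?n - 1) \<partial>(lborel :: 'a measure))"
      by (simp add: h_def)
    also have "\<dots> = ?w * (\<integral>t. \<psi>' t * indicator {s..} t \<partial>lborel)"
      by (rule integral_radial[of "\<lambda>t. \<psi>' t * indicator {s..} t"]) (use that in \<open>auto split: split_indicator_asm\<close>)
    finally show ?thesis by (simp add: FTC)
  qed
  have "bounded (h ` {x. c \<le> norm x \<and> norm x \<le> d})"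
  proof (intro compact_imp_bounded compact_continuous_image)
    have "{x::'a. c \<le> norm x \<and> norm x \<le> d} = cball 0 d - ball 0 c" by auto
    then show "compact {x::'a. c \<le> norm x \<and> norm x \<le> d}" by (simp add: compact_diff)
    show "continuous_on {x. c \<le> norm x \<and> norm x \<le> d} h"
      unfolding h_def using c by (auto intro!: continuous_intros continuous_on_compose2[OF cont])
  qed
  then obtain B where B: "B > 0" "\<And>x. \<bar>h x\<bar> \<le> B"
    unfolding bounded_pos using hz by (metis (mono_tags, lifting) abs_zero image_eqI less_eq_real_def mem_Collect_eq not_le real_norm_def)
  have hint: "integrable lborel (\<lambda>x. h x)"
  proof -
    have "integrable lborel (\<lambda>x. indicator (cball (0::'a) d) x * B)"
      by (intro integrable_mult_left integrable_real_indicator) (use emeasure_lborel_cball_finite in auto)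
    then show ?thesis
      by (rule Bochner_Integration.integrable_bound) (use B hz in \<open>auto split: split_indicator\<close>)
  qed
  \<comment> \<open>Measurability on the product space calls for a Borel function: G is cut to the
    shell that carries \<psi> and replaced by a Borel representative.\<close>
  define G1 where "G1 x = G x * indicator (shell c d) x" for x
  have G1: "integrable lebesgue G1" using G[OF c] by (simp add: G1_def[abs_def])
  from completion_ex_borel_measurable_real[OF borel_measurable_integrable[OF G1]]
  obtain G' where [measurable]: "G' \<in> borel_measurable lborel" and ae: "AE x in lborel. G1 x = G' x" by auto
  have ae': "AE x in lebesgue. G1 x = G' x" using ae by (rule AE_completion)
  have G'L: "integrable lebesgue G'"
    by (rule integrable_cong_AE_imp[OF G1 borel_imp_lebesgue ae']) simp
  then have G'i: "integrable lborel G'" using integrable_completion[of G' lborel] by simp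
  have [measurable]: "G' \<in> borel_measurable borel" by simp
  define K where "K x y = h x * (G' y * indicator {(x, y). norm y \<le> norm x} (x, y))" for x y
  have set_m: "{(x::'a, y::'a). norm y \<le> norm x} \<in> sets (lborel \<Otimes>\<^sub>M lborel)"
  proof -
    have "{p \<in> space (lborel \<Otimes>\<^sub>M lborel). norm (snd p :: 'a) \<le> norm (fst p :: 'a)} \<in> sets (lborel \<Otimes>\<^sub>M lborel)"
      by measurable
    moreover have "{p \<in> space (lborel \<Otimes>\<^sub>M lborel). norm (snd p :: 'a) \<le> norm (fst p :: 'a)} = {(x, y). norm y \<le> norm x}"
      by (auto simp: space_pair_measure)
    ultimately show ?thesis by simp
  qed
  have Ki: "integrable (lborel \<Otimes>\<^sub>M lborel) (\<lambda>(x, y). K x y)"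
  proof (rule Bochner_Integration.integrable_bound)
    show "integrable (lborel \<Otimes>\<^sub>M lborel) (\<lambda>(x, y). h x * G' y)"
      by (intro lborel_pair.Fubini_integrable)
         (use hint G'i in \<open>auto simp: abs_mult\<close>)
    show "(\<lambda>(x, y). K x y) \<in> borel_measurable (lborel \<Otimes>\<^sub>M lborel)"
      unfolding K_def using set_m by measurable
  qed (auto simp: K_def abs_mult split: split_indicator)
  have inner1: "(\<integral>y. K x y \<partial>lborel) = ?w * (h x * (radial_primitive G (norm x) - radial_primitive G c))" for x
  proof (cases "norm x < c \<or> d < norm x")
    case True then show ?thesis by (simp add: K_def hz)
  next
    case False
    have "(\<integral>y. G' y * indicator {(x, y). norm y \<le> norm x} (x, y) \<partial>lborel) = (\<integral>y. G' y * indicator {y. norm y \<le> norm x} y \<partial>lborel)"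
      by (simp add: indicator_def)
    also have "\<dots> = (\<integral>y. G' y * indicator {y. norm y \<le> norm x} y \<partial>lebesgue)"
      by (rule integral_completion[symmetric]) measurable
    also have "\<dots> = (\<integral>y. G1 y * indicator {y. norm y \<le> norm x} y \<partial>lebesgue)"
    proof (rule integral_cong_AE)
      have m: "indicat_real {y. norm y \<le> norm x} \<in> borel_measurable lebesgue" by (rule borel_imp_lebesgue) measurable
      show "(\<lambda>y. G' y * indicat_real {y. norm y \<le> norm x} y) \<in> borel_measurable lebesgue"
        by (rule borel_imp_lebesgue) measurable
      show "(\<lambda>y. G1 y * indicat_real {y. norm y \<le> norm x} y) \<in> borel_measurable lebesgue"
        using borel_measurable_integrable[OF G1] m by (rule borel_measurable_times)
    qed (use ae' in \<open>eventually_elim, simp\<close>)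
    also have "\<dots> = (\<integral>y. G y * indicator (shell c (norm x)) y \<partial>lebesgue)"
      by (rule Bochner_Integration.integral_cong) (use False in \<open>auto simp: G1_def split: split_indicator\<close>)
    also have "\<dots> = ?w * (radial_primitive G (norm x) - radial_primitive G c)"
      using radial_primitive_diff[OF G c, of "norm x"] False by simp
    finally show ?thesis by (simp add: K_def)
  qed
  have inner2: "(\<integral>x. K x y \<partial>lborel) = - ?w * (G' y * \<psi> (norm y))" if y: "y \<noteq> 0" for y
  proof -
    have "(\<integral>x. K x y \<partial>lborel) = (\<integral>x. G' y * (h x * indicator {norm y..} (norm x)) \<partial>lborel)"
      by (rule Bochner_Integration.integral_cong) (auto simp: K_def split: split_indicator)
    then show ?thesis using H[of "norm y"] y by simp
  qed
  have int1: "integrable lborel (\<lambda>x. h x * (radial_primitive G (norm x) - radial_primitive G c))"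
    using lborel_pair.integrable_fst'[OF Ki] w by (simp add: inner1)
  have int2: "integrable lborel (\<lambda>x. h x * radial_primitive G (norm x))"
    using Bochner_Integration.integrable_add[OF int1 integrable_mult_left[OF hint, of "radial_primitive G c"]]
    by (simp add: algebra_simps)
  have meas: "(\<lambda>x. h x * radial_primitive G (norm x)) \<in> borel_measurable lborel" using int2 by simp
  show ?int using int2 integrable_completion[OF meas] by (simp add: h_def mult.commute)
  \<comment> \<open>The inner integral starts at radius c and yields the primitive minus its value
    there. That constant drops out because h has integral 0, \<psi> being 0 at c.\<close>
  have "(\<integral>x. h x \<partial>lborel) = (\<integral>x. h x * indicator {c..} (norm x) \<partial>lborel)"
    by (rule Bochner_Integration.integral_cong) (use hz in \<open>auto split: split_indicator\<close>)
  also have "\<dots> = 0" using H[OF c] supp[of c] by auto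
  finally have h0: "(\<integral>x. h x \<partial>lborel) = 0" .
  have "(\<integral>x. h x * radial_primitive G (norm x) \<partial>lborel) = (\<integral>x. h x * (radial_primitive G (norm x) - radial_primitive G c) + h x * radial_primitive G c \<partial>lborel)"
    by (simp add: algebra_simps)
  also have "\<dots> = (\<integral>x. h x * (radial_primitive G (norm x) - radial_primitive G c) \<partial>lborel)"
    using int1 hint h0 by simp
  finally have "?w * (\<integral>x. h x * radial_primitive G (norm x) \<partial>lborel) = (\<integral>x. (\<integral>y. K x y \<partial>lborel) \<partial>lborel)"
    by (simp add: inner1)
  also have "\<dots> = (\<integral>y. (\<integral>x. K x y \<partial>lborel) \<partial>lborel)"
    using lborel_pair.Fubini_integral[OF Ki] by simp
  also have "\<dots> = (\<integral>y. - ?w * (G' y * \<psi> (norm y)) \<partial>lborel)"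
  proof (rule integral_cong_AE)
    show "AE y in lborel. (\<integral>x. K x y \<partial>lborel) = - ?w * (G' y * \<psi> (norm y))"
      using AE_lborel_singleton[of 0] by eventually_elim (rule inner2)
    show "(\<lambda>y. \<integral>x. K x y \<partial>lborel) \<in> borel_measurable lborel"
      using borel_measurable_integrable[OF lborel_pair.integrable_snd[OF Ki]] by simp
  qed simp
  also have "\<dots> = - ?w * (\<integral>y. G' y * \<psi> (norm y) \<partial>lborel)" by simp
  finally have "(\<integral>x. h x * radial_primitive G (norm x) \<partial>lborel) = - (\<integral>y. G' y * \<psi> (norm y) \<partial>lborel)"
    using w by (metis (no_types, lifting) less_irrefl minus_mult_commute mult_left_cancel)
  also have "(\<integral>y. G' y * \<psi> (norm y) \<partial>lborel) = (\<integral>y. G' y * \<psi> (norm y) \<partial>lebesgue)"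
    by (rule integral_completion[symmetric]) measurable
  also have "\<dots> = (\<integral>y. G1 y * \<psi> (norm y) \<partial>lebesgue)"
  proof (rule integral_cong_AE)
    have m: "(\<lambda>y::'a. \<psi> (norm y)) \<in> borel_measurable lebesgue" by (rule borel_imp_lebesgue) measurable
    show "(\<lambda>y. G' y * \<psi> (norm y)) \<in> borel_measurable lebesgue" by (rule borel_imp_lebesgue) measurable
    show "(\<lambda>y. G1 y * \<psi> (norm y)) \<in> borel_measurable lebesgue"
      using borel_measurable_integrable[OF G1] m by (rule borel_measurable_times)
  qed (use ae' in \<open>eventually_elim, simp\<close>)
  also have "\<dots> = (\<integral>y. G y * \<psi> (norm y) \<partial>lebesgue)"
    by (rule Bochner_Integration.integral_cong) (use supp in \<open>force simp: G1_def split: split_indicator\<close>)+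
  also have "(\<integral>x. h x * radial_primitive G (norm x) \<partial>lborel) = (\<integral>x. h x * radial_primitive G (norm x) \<partial>lebesgue)"
    by (rule integral_completion[OF meas, symmetric])
  finally show ?eq by (simp add: h_def mult.commute)
qed

section \<open>The du Bois-Reymond lemma for radial functions with an arbitrary profile\<close>

lemma integrable_mult_bounded:
  fixes f h :: "'b \<Rightarrow> real"
  assumes f: "integrable M f" and h: "h \<in> borel_measurable M" and B: "\<And>x. \<bar>h x\<bar> \<le> B"
  shows "integrable M (\<lambda>x. f x * h x)"
proof (rule Bochner_Integration.integrable_bound)
  show "integrable M (\<lambda>x. B * f x)" using f by simp
  show "(\<lambda>x. f x * h x) \<in> borel_measurable M" using f h by (intro borel_measurable_times) auto
  have "\<bar>f x\<bar> * \<bar>h x\<bar> \<le> \<bar>B\<bar> * \<bar>f x\<bar>" for x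
    using B[of x] mult_left_mono[of "\<bar>h x\<bar>" "\<bar>B\<bar>" "\<bar>f x\<bar>"] by (simp add: mult.commute)
  then show "AE x in M. norm (f x * h x) \<le> norm (B * f x)" by (simp add: abs_mult)
qed

lemma locally_integrable_one: "locally_integrable (\<lambda>x::'a::euclidean_space. 1::real)"
proof -
  have "integrable lebesgue (indicat_real K)" if "compact K" for K :: "'a set"
    using lmeasurable_compact[OF that] by (intro integrable_real_indicator) (auto simp: fmeasurable_def)
  then show ?thesis by (simp add: locally_integrable_def set_integrable_def)
qed

lemma sets_lebesgue_cong_AE:
  assumes "S \<in> sets lebesgue" "AE x in lebesgue. x \<in> S \<longleftrightarrow> x \<in> S'"
  shows "S' \<in> sets lebesgue"
proof -
  obtain N where N: "{x \<in> space lebesgue. \<not> (x \<in> S \<longleftrightarrow> x \<in> S')} \<subseteq> N" "N \<in> null_sets lebesgue"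
    using assms(2) by (auto simp: eventually_ae_filter)
  have "S' = (S - N) \<union> (S' \<inter> N)" using N(1) by auto
  moreover have "S' \<inter> N \<in> null_sets lebesgue"
    by (rule null_sets_completion_subset[OF _ N(2)]) auto
  ultimately show ?thesis using assms(1) N(2) by (metis null_setsD2 sets.Diff sets.Un)
qed

lemma enn2real_diff_eq_0_iff:
  "p < \<infinity> \<Longrightarrow> m < \<infinity> \<Longrightarrow> enn2real p - enn2real m = 0 \<longleftrightarrow> p = m"
  by (cases p; cases m) auto

text \<open>The primitive that vanishes to the left of c vanishes again beyond d because the total
  integral is 0. This turns every \<eta> of mean zero into the derivative of an admissible radial
  test.\<close>

lemma smooth_primitive:
  fixes \<eta> :: "real \<Rightarrow> real"
  assumes sm: "smooth_on UNIV \<eta>" and c: "0 < c" and supp: "\<And>t. \<eta> t \<noteq> 0 \<Longrightarrow> c < t \<and> t < d"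
    and int0: "(\<integral>t. \<eta> t \<partial>lborel) = 0"
  obtains \<psi> where "smooth_on UNIV \<psi>" "\<And>t. (\<psi> has_real_derivative \<eta> t) (at t)"
    "\<And>t. \<psi> t \<noteq> 0 \<Longrightarrow> c < t \<and> t < d"
proof
  define \<psi> where "\<psi> t = integral {0..t} \<eta>" for t
  have cont: "continuous_on S \<eta>" for S using sm smooth_on_imp_continuous continuous_on_subset by blast
  have z: "\<psi> t = 0" if "t \<le> c" for t
  proof -
    have "integral {0..t} \<eta> = integral {0..t} (\<lambda>_. 0)"
      by (rule Henstock_Kurzweil_Integration.integral_cong) (use supp that in force)
    then show ?thesis by (simp add: \<psi>_def)
  qed
  have z': "\<psi> t = 0" if t: "t \<ge> d" for t
  proof -
    have "integral {0..t} \<eta> = (LINT s:{0..t}|lborel. \<eta> s)"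
      by (rule set_borel_integral_eq_integral(2)[symmetric]) (rule borel_integrable_atLeastAtMost'[OF cont])
    also have "\<dots> = (\<integral>s. \<eta> s \<partial>lborel)"
      unfolding set_lebesgue_integral_def
      by (rule Bochner_Integration.integral_cong) (use supp c t in \<open>force split: split_indicator\<close>)+
    finally show ?thesis by (simp add: \<psi>_def int0)
  qed
  show supp': "c < t \<and> t < d" if "\<psi> t \<noteq> 0" for t using z[of t] z'[of t] that by linarith
  show d: "(\<psi> has_real_derivative \<eta> t) (at t)" for t
  proof (cases "t < c")
    case True
    have "((\<lambda>t. 0) has_real_derivative 0) (at t)" by simp
    then have "(\<psi> has_real_derivative 0) (at t)"
      by (rule has_field_derivative_transform_within_open[where S = "{..<c}"]) (use True z in auto)
    moreover have "\<eta> t = 0" using True supp[of t] by auto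
    ultimately show ?thesis by simp
  next
    case False
    have "((\<lambda>x. integral {0..x} \<eta>) has_real_derivative \<eta> t) (at t within {0..t + 1})"
      by (rule integral_has_real_derivative[OF cont]) (use False c in auto)
    then have "((\<lambda>x. integral {0..x} \<eta>) has_real_derivative \<eta> t) (at t within {0<..<t + 1})"
      by (rule DERIV_subset) auto
    then show ?thesis using False c
      by (subst (asm) at_within_open) (auto simp: \<psi>_def[abs_def])
  qed
  show "smooth_on UNIV \<psi>"
    unfolding smooth_on_def
  proof
    fix k show "Ck_on k UNIV \<psi>"
      by (rule Ck_on_Suc_D, rule Ck_on_SucI_real[OF _ d]) (use sm in \<open>auto simp: smooth_on_def\<close>)
  qed
qed

text \<open>The profile \<open>w\<close> is an arbitrary function, so \<open>{w > 0}\<close> need not be a Borel set. However, the Lebesgue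
  measurable set \<open>{x. w (norm x) > 0}\<close> is \<open>\<sigma>\<close>-compact up to a null set, and the image of a \<open>\<sigma>\<close>-compact set
  under the norm is a Borel set.\<close>

lemma radial_nonpos_if_shell_integrals_zero:
  fixes f :: "'a::euclidean_space \<Rightarrow> real"
  assumes w: "AE x in lebesgue. f x = w (norm x)"
    and fi: "\<And>a b. 0 < a \<Longrightarrow> integrable lebesgue (\<lambda>x. f x * indicator {a<..<b} (norm x))"
    and f0: "\<And>a b. 0 < a \<Longrightarrow> a < b \<Longrightarrow> (\<integral>x. f x * indicator {a<..<b} (norm x) \<partial>lebesgue) = 0"
    and a: "0 < a"
  shows "AE x in lebesgue. norm x \<in> {a<..<b} \<longrightarrow> f x \<le> 0"
proof -
  define F where "F x = f x * indicator {a<..<b} (norm x)" for x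
  have Fi: "integrable lebesgue F" using fi[OF a] by (simp add: F_def[abs_def])
  have Fm[measurable]: "F \<in> borel_measurable lebesgue" using Fi by simp
  have nm[measurable]: "(norm :: 'a \<Rightarrow> real) \<in> measurable lebesgue borel" by (rule borel_imp_lebesgue) measurable
  let ?P = "distr (density lebesgue (\<lambda>x. ennreal (F x))) borel norm"
  let ?M = "distr (density lebesgue (\<lambda>x. ennreal (- F x))) borel norm"
  have nm': "(norm :: 'a \<Rightarrow> real) \<in> measurable (density lebesgue h) borel" for h
    using nm by (simp add: measurable_def)
  have vm: "(norm -` E :: 'a set) \<in> sets lebesgue" if "E \<in> sets borel" for E :: "real set"
    using measurable_sets[OF nm that] by simp
  have PM: "emeasure ?P E = (\<integral>\<^sup>+x. ennreal (F x * indicator E (norm x)) \<partial>lebesgue)"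
       "emeasure ?M E = (\<integral>\<^sup>+x. ennreal (- (F x * indicator E (norm x))) \<partial>lebesgue)"
    if E: "E \<in> sets borel" for E
    using vm[OF E] E by (auto simp: emeasure_distr nm' emeasure_density intro!: nn_integral_cong split: split_indicator)
  have FE: "integrable lebesgue (\<lambda>x. F x * indicator E (norm x))" if "E \<in> sets borel" for E
    by (rule integrable_mult_bounded[OF Fi, of _ 1]) (use that nm in \<open>auto split: split_indicator\<close>)
  have fin: "(\<integral>\<^sup>+x. ennreal (F x * indicator E (norm x)) \<partial>lebesgue) < \<infinity>"
       "(\<integral>\<^sup>+x. ennreal (- (F x * indicator E (norm x))) \<partial>lebesgue) < \<infinity>"
    if E: "E \<in> sets borel" for E
    using FE[OF E] by (auto simp: real_integrable_def top.not_eq_extremum)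
  have eqv: "(\<integral>x. F x * indicator E (norm x) \<partial>lebesgue) = 0 \<longleftrightarrow> emeasure ?P E = emeasure ?M E"
    if E: "E \<in> sets borel" for E
    unfolding PM[OF E] real_lebesgue_integral_def[OF FE[OF E]]
    using fin[OF E] by (intro enn2real_diff_eq_0_iff) auto
  \<comment> \<open>The shell integrals give equality on half-lines of radii, and these determine a
    measure on the Borel sets of the line.\<close>
  have "?P = ?M"
  proof (rule measure_eqI_lessThan)
    fix s :: real
    show "emeasure ?P {s<..} < \<infinity>" using PM fin by simp
    have "(\<integral>x. F x * indicator {s<..} (norm x) \<partial>lebesgue) = (\<integral>x. f x * indicator {max a s<..<b} (norm x) \<partial>lebesgue)"
      by (rule Bochner_Integration.integral_cong) (auto simp: F_def split: split_indicator)
    also have "\<dots> = 0"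
    proof (cases "max a s < b")
      case True then show ?thesis using f0[of "max a s" b] a by simp
    next
      case False
      then have "{max a s<..<b} = {}" by auto
      then show ?thesis by (simp only: indicator_simps) simp
    qed
    finally show "emeasure ?P {s<..} = emeasure ?M {s<..}" using eqv by simp
  qed auto
  then have zero: "(\<integral>x. F x * indicator E (norm x) \<partial>lebesgue) = 0" if "E \<in> sets borel" for E
    using eqv[OF that] by simp
  have Fw: "AE x in lebesgue. F x = w (norm x) * indicator {a<..<b} (norm x)"
    using w by eventually_elim (simp add: F_def)
  define E where "E = {t \<in> {a<..<b}. w t > 0}"
  have "{x \<in> space lebesgue. F x > 0} \<in> sets lebesgue" by measurable
  moreover have "AE x in lebesgue. x \<in> {x \<in> space lebesgue. F x > 0} \<longleftrightarrow> x \<in> norm -` E"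
    using Fw by eventually_elim (auto simp: E_def split: split_indicator)
  ultimately have "(norm -` E :: 'a set) \<in> sets lebesgue"
    by (rule sets_lebesgue_cong_AE)
  then obtain C T where CT: "fsigma C" "T \<in> null_sets lebesgue" "C \<union> T = (norm -` E :: 'a set)"
    by (rule lebesgue_set_almost_fsigma)
  from CT(1) obtain K where K: "\<And>i::nat. closed (K i)" "C = (\<Union>i. K i)"
    by (cases rule: fsigma.cases) auto
  have "norm ` C = (\<Union>i. \<Union>j::nat. norm ` (K i \<inter> cball 0 (real j)))"
    unfolding K(2) using real_arch_simple by (fastforce simp: image_iff)
  moreover have "norm ` (K i \<inter> cball 0 (real j)) \<in> sets borel" for i j
  proof -
    have "compact (K i \<inter> cball 0 (real j))" by (rule closed_Int_compact[OF K(1) compact_cball])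
    then show ?thesis
      by (intro borel_closed compact_imp_closed compact_continuous_image continuous_intros)
  qed
  ultimately have E': "norm ` C \<in> sets borel" by auto
  have sub: "norm ` C \<subseteq> E" using CT(3) by auto
  \<comment> \<open>The norms of points of C form a Borel set inside E, where w > 0, so the
    integrand is nonnegative with integral 0. As C fills the preimage of E up to the null set T, f >
    0 holds only on a null set of the shell.\<close>
  have "AE x in lebesgue. F x * indicator (norm ` C) (norm x) = 0"
  proof (rule integral_nonneg_eq_0_iff_AE[THEN iffD1, OF _ _ zero[OF E']])
    show "integrable lebesgue (\<lambda>x. F x * indicator (norm ` C) (norm x))" by (rule FE[OF E'])
    show "AE x in lebesgue. 0 \<le> F x * indicator (norm ` C) (norm x)"
      using Fw by eventually_elim (use sub in \<open>auto simp: E_def split: split_indicator\<close>)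
  qed
  moreover have "AE x in lebesgue. x \<notin> T" using CT(2) by (rule AE_not_in)
  ultimately show ?thesis using Fw w
  proof eventually_elim
    case (elim x)
    show ?case
    proof (rule ccontr)
      assume n: "\<not> (norm x \<in> {a<..<b} \<longrightarrow> f x \<le> 0)"
      then have "norm x \<in> E" using elim(4) by (auto simp: E_def)
      then have "x \<in> C" using CT(3) elim(2) by blast
      then show False using elim(1) n by (auto simp: F_def)
    qed
  qed
qed

lemma radial_zero_if_shell_integrals_zero:
  fixes f :: "'a::euclidean_space \<Rightarrow> real"
  assumes w: "AE x in lebesgue. f x = w (norm x)"
    and fi: "\<And>a b. 0 < a \<Longrightarrow> integrable lebesgue (\<lambda>x. f x * indicator {a<..<b} (norm x))"
    and f0: "\<And>a b. 0 < a \<Longrightarrow> a < b \<Longrightarrow> (\<integral>x. f x * indicator {a<..<b} (norm x) \<partial>lebesgue) = 0"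
  shows "AE x in lebesgue. f x = 0"
proof -
  have 1: "AE x in lebesgue. norm x \<in> {a<..<b} \<longrightarrow> f x \<le> 0" if "0 < a" for a b
    by (rule radial_nonpos_if_shell_integrals_zero[OF w fi f0 that])
  have w': "AE x in lebesgue. - f x = - w (norm x)" using w by eventually_elim simp
  have 2: "AE x in lebesgue. norm x \<in> {a<..<b} \<longrightarrow> - f x \<le> 0" if "0 < a" for a b
    by (rule radial_nonpos_if_shell_integrals_zero[OF w' _ _ that]) (use fi f0 in auto)
  have "AE x in lebesgue. \<forall>n::nat. norm x \<in> {1 / Suc n<..<real (Suc n)} \<longrightarrow> f x = 0"
    unfolding AE_all_countable
  proof
    fix n :: nat
    show "AE x in lebesgue. norm x \<in> {1 / Suc n<..<real (Suc n)} \<longrightarrow> f x = 0"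
      using 1[of "1 / Suc n" "real (Suc n)"] 2[of "1 / Suc n" "real (Suc n)"] by auto
  qed
  then show ?thesis using AE_norm_neq[of 0]
  proof eventually_elim
    case (elim x)
    obtain n1 where n1: "1 / Suc n1 < norm x" using elim(2) nat_approx_posE[of "norm x"] by auto
    obtain n2 where n2: "norm x < real n2" using reals_Archimedean2 by blast
    define n where "n = max n1 n2"
    have "1 / Suc n \<le> 1 / Suc n1" by (simp add: n_def frac_le)
    moreover have "real n2 \<le> real (Suc n)" by (simp add: n_def)
    ultimately show ?case using elim(1)[rule_format, of n] n1 n2 by auto
  qed
qed

text \<open>The tests see only derivatives, that is, functions of integral 0. Subtracting a multiple
  of one fixed bump \<eta>0 from a cutoff gives it integral 0, so W pairs with every cutoff as a
  constant K does, and all shell integrals of (W - K) |x|^(1-n) vanish.\<close>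

lemma radial_du_Bois_Reymond:
  fixes W :: "'a::euclidean_space \<Rightarrow> real"
  assumes w: "AE x in lebesgue. W x = w (norm x)"
    and WI: "\<And>p q. 0 < p \<Longrightarrow> integrable lebesgue (\<lambda>x. W x * indicator (shell p q) x)"
    and W0: "\<And>\<psi> \<psi>' c d. 0 < c \<Longrightarrow> smooth_on UNIV \<psi> \<Longrightarrow> continuous_on UNIV \<psi>' \<Longrightarrow>
       (\<And>t. (\<psi> has_real_derivative \<psi>' t) (at t)) \<Longrightarrow> (\<And>t. \<psi> t \<noteq> 0 \<Longrightarrow> c < t \<and> t < d) \<Longrightarrow>
       (\<integral>x. W x * (\<psi>' (norm x) / norm x ^ (DIM('a) - 1)) \<partial>lebesgue) = 0"
  obtains K where "AE x in lebesgue. W x = K"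
proof -
  let ?n = "DIM('a)" and ?w = "sphere_area DIM('a)"
  have w0: "?w > 0" by (simp add: sphere_area_pos)
  let ?c = "\<lambda>n a b :: real. box_cutoff n a b"
  have cm[measurable]: "box_cutoff n a b \<in> borel_measurable borel" for n and a b :: real
    using smooth_box_cutoff smooth_on_imp_continuous borel_measurable_continuous_onI by blast
  have ci: "integrable lborel (box_cutoff n a b)" for n and a b :: real
  proof (rule Bochner_Integration.integrable_bound)
    show "integrable lborel (indicat_real {a..b})"
      by (rule integrable_real_indicator) (auto simp: emeasure_lborel_Icc_eq)
    show "AE x in lborel. norm (box_cutoff n a b x) \<le> norm (indicat_real {a..b} x)"
      using box_cutoff_bounds[of n a b] box_cutoff_outside[of _ a b n] by (auto simp: box_real split: split_indicator)
  qed simp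
  define \<rho> where "\<rho> x = 1 / norm x ^ (?n - 1)" for x :: 'a
  have \<rho>m[measurable]: "\<rho> \<in> borel_measurable borel" unfolding \<rho>_def by measurable
  have bound: "\<bar>h (norm x) * (\<rho> x * indicator (shell p q) x)\<bar> \<le> B * (1 / p ^ (?n - 1))"
    if "0 < p" "\<And>t. \<bar>h t\<bar> \<le> B" for h p q B and x :: 'a
  proof (cases "x \<in> shell p q")
    case True
    have "p ^ (?n - 1) \<le> norm x ^ (?n - 1)" using True that by (intro power_mono) auto
    then have "1 / norm x ^ (?n - 1) \<le> 1 / p ^ (?n - 1)" using that(1) by (intro frac_le) auto
    then have "\<bar>h (norm x)\<bar> * (1 / norm x ^ (?n - 1)) \<le> B * (1 / p ^ (?n - 1))"
      using that(2)[of "norm x"] by (intro mult_mono) auto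
    then show ?thesis using True by (simp add: \<rho>_def abs_mult)
  next
    case False
    have "0 \<le> B" using that(2)[of 0] by linarith
    then show ?thesis using False that(1) by auto
  qed
  have Wh: "integrable lebesgue (\<lambda>x. W x * (h (norm x) * \<rho> x))"
    if "0 < p" "h \<in> borel_measurable borel" "\<And>t. \<bar>h t\<bar> \<le> B" "\<And>t. h t \<noteq> 0 \<Longrightarrow> p < t \<and> t \<le> q" for h p q B
  proof -
    have "integrable lebesgue (\<lambda>x. (W x * indicator (shell p q) x) * (h (norm x) * (\<rho> x * indicator (shell p q) x)))"
    proof (rule integrable_mult_bounded[OF WI[OF that(1)] _ bound[OF that(1,3)]])
      show "(\<lambda>x. h (norm x) * (\<rho> x * indicat_real (shell p q) x)) \<in> borel_measurable lebesgue"
        by (rule borel_imp_lebesgue) (use that(2) in measurable)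
    qed
    moreover have "(W x * indicator (shell p q) x) * (h (norm x) * (\<rho> x * indicator (shell p q) x)) = W x * (h (norm x) * \<rho> x)" for x
      using that(4)[of "norm x"] by (auto split: split_indicator)
    ultimately show ?thesis by simp
  qed
  have cs: "a < t \<and> t \<le> b" if "?c n a b t \<noteq> 0" for n a b t
    using box_cutoff_outside[of t a b n] that by (cases "a < t \<and> t < b") (auto simp: box_real)
  have cb: "\<bar>?c n a b t\<bar> \<le> 1" for n a b t using box_cutoff_bounds[of n a b t] by auto
  have Wc: "integrable lebesgue (\<lambda>x. W x * (?c n a b (norm x) * \<rho> x))" if "0 < a" for n a b
    by (rule Wh[OF that cm cb cs])
  \<comment> \<open>The normalizing bump must have positive integral: the integrals of the cutoffs
    of (1, 2) tend to 1, so some cutoff qualifies.\<close>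
  have "(\<lambda>n. \<integral>t. 1 * box_cutoff n 1 (2::real) t \<partial>lebesgue) \<longlonglongrightarrow> (\<integral>t. 1 * indicator (box 1 (2::real)) t \<partial>lebesgue)"
  proof (rule integral_box_cutoff_tendsto)
    have "integrable lebesgue (indicat_real {1::real<..<2})" by simp
    then show "integrable lebesgue (\<lambda>x::real. 1 * indicat_real (box 1 2) x)" by (simp add: box_real)
  qed
  moreover have "(\<integral>t. 1 * indicator (box 1 (2::real)) t \<partial>lebesgue) = (1::real)" by (simp add: box_real)
  ultimately have "\<forall>\<^sub>F n in sequentially. (\<integral>t. 1 * box_cutoff n 1 (2::real) t \<partial>lebesgue) > 0"
    by (intro order_tendstoD(1)) auto
  then obtain n0 where "(\<integral>t. box_cutoff n0 1 (2::real) t \<partial>lebesgue) > 0"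
    by (auto simp: eventually_sequentially)
  then have k0: "(\<integral>t. box_cutoff n0 1 (2::real) t \<partial>lborel) > 0" by (subst (asm) integral_completion) simp
  define \<eta>0 where "\<eta>0 = box_cutoff n0 1 (2::real)"
  define k0 where "k0 = (\<integral>t. \<eta>0 t \<partial>lborel)"
  have k0: "k0 > 0" using k0 by (simp add: k0_def \<eta>0_def)
  \<comment> \<open>The only possible value: a constant K pairs with \<eta>0(|x|) |x|^(1-n) to K
    times the sphere area times k0.\<close>
  define K where "K = (\<integral>x. W x * (\<eta>0 (norm x) * \<rho> x) \<partial>lebesgue) / (?w * k0)"
  have key: "(\<integral>x. W x * (?c n a b (norm x) * \<rho> x) \<partial>lebesgue) = K * ?w * (\<integral>t. ?c n a b t \<partial>lborel)"
    if a: "0 < a" "a < b" for n a b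
  proof -
    define k where "k = (\<integral>t. ?c n a b t \<partial>lborel)"
    define \<eta> where "\<eta> t = ?c n a b t + (- (k / k0)) * \<eta>0 t" for t
    have sm: "smooth_on UNIV \<eta>"
      unfolding smooth_on_def
    proof
      fix l
      have "Ck_on l UNIV (?c n a b)" "Ck_on l UNIV \<eta>0"
        using smooth_box_cutoff unfolding \<eta>0_def smooth_on_def by blast+
      then show "Ck_on l UNIV \<eta>"
        unfolding \<eta>_def by (intro Ck_on_add Ck_on_mult Ck_on_const) auto
    qed
    have supp: "min a 1 < t \<and> t < max b 2" if "\<eta> t \<noteq> 0" for t
      using that box_cutoff_outside[of t a b n] box_cutoff_outside[of t 1 2 n0]
      by (cases "t \<in> box a b"; cases "t \<in> box 1 2") (auto simp: \<eta>_def \<eta>0_def box_real)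
    have "(\<integral>t. \<eta> t \<partial>lborel) = k + (- (k / k0)) * k0"
      unfolding \<eta>_def using ci by (subst Bochner_Integration.integral_add) (auto simp: k_def k0_def \<eta>0_def)
    then have "(\<integral>t. \<eta> t \<partial>lborel) = 0" using k0 by simp
    then obtain \<psi> where \<psi>: "smooth_on UNIV \<psi>" "\<And>t. (\<psi> has_real_derivative \<eta> t) (at t)"
        "\<And>t. \<psi> t \<noteq> 0 \<Longrightarrow> min a 1 < t \<and> t < max b 2"
      using smooth_primitive[OF sm _ supp] a by (metis min_less_iff_conj zero_less_one)
    have "(\<integral>x. W x * (\<eta> (norm x) / norm x ^ (?n - 1)) \<partial>lebesgue) = 0"
      by (rule W0[OF _ \<psi>(1) smooth_on_imp_continuous[OF sm] \<psi>(2,3)]) (use a in auto)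
    then have "(\<integral>x. W x * (?c n a b (norm x) * \<rho> x) + (- (k / k0)) * (W x * (\<eta>0 (norm x) * \<rho> x)) \<partial>lebesgue) = 0"
      by (simp add: \<eta>_def \<rho>_def add_divide_distrib diff_divide_distrib algebra_simps)
    then have "(\<integral>x. W x * (?c n a b (norm x) * \<rho> x) \<partial>lebesgue) + (- (k / k0)) * (\<integral>x. W x * (\<eta>0 (norm x) * \<rho> x) \<partial>lebesgue) = 0"
      using Wc[OF a(1), of n b] Wc[OF zero_less_one, of n0 2]
      by (subst (asm) Bochner_Integration.integral_add) (auto simp: \<eta>0_def)
    then show ?thesis using k0 w0 by (simp add: K_def k_def field_simps)
  qed
  define f where "f x = (W x - K) * \<rho> x" for x
  have \<rho>I: "integrable lebesgue (\<lambda>x. h (norm x) * \<rho> x)"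
    if "0 < p" "h \<in> borel_measurable borel" "\<And>t. \<bar>h t\<bar> \<le> B" "\<And>t. h t \<noteq> 0 \<Longrightarrow> p < t \<and> t \<le> q" for h p q B
  proof -
    have "integrable lebesgue (\<lambda>x. 1 * (h (norm x) * (\<rho> x * indicator (shell p q) x)))"
    proof (rule integrable_mult_bounded_support[where K = "cball 0 q", OF locally_integrable_one _ bound[OF that(1,3)]])
      show "(\<lambda>x. h (norm x) * (\<rho> x * indicat_real (shell p q) x)) \<in> borel_measurable lebesgue"
        by (rule borel_imp_lebesgue) (use that(2) in measurable)
    qed (auto split: split_indicator_asm)
    moreover have "1 * (h (norm x) * (\<rho> x * indicator (shell p q) x)) = h (norm x) * \<rho> x" for x
      using that(4)[of "norm x"] by (auto split: split_indicator)
    ultimately show ?thesis by (simp only:)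
  qed
  have fI: "integrable lebesgue (\<lambda>x. f x * h (norm x))"
    if "0 < p" "h \<in> borel_measurable borel" "\<And>t. \<bar>h t\<bar> \<le> B" "\<And>t. h t \<noteq> 0 \<Longrightarrow> p < t \<and> t \<le> q" for h p q B
    using Bochner_Integration.integrable_diff[OF Wh[OF that] integrable_mult_right[OF \<rho>I[OF that], of K]]
    by (simp add: f_def algebra_simps)
  have ind: "indicat_real {a<..<b} \<in> borel_measurable borel" "\<And>t. \<bar>indicat_real {a<..<b} t\<bar> \<le> 1"
      "\<And>t. indicat_real {a<..<b} t \<noteq> 0 \<Longrightarrow> a < t \<and> t \<le> b" for a b :: real
    by (rule borel_measurable_indicator) (auto split: split_indicator_asm)
  have "AE x in lebesgue. f x = 0"
  proof (rule radial_zero_if_shell_integrals_zero)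
    show "AE x in lebesgue. f x = (w (norm x) - K) * (1 / norm x ^ (?n - 1))"
      using w by eventually_elim (simp add: f_def \<rho>_def)
    show fi: "integrable lebesgue (\<lambda>x. f x * indicator {a<..<b} (norm x))" if "0 < a" for a b
      by (rule fI[OF that ind])
    fix a b :: real assume a: "0 < a" "a < b"
    have 0: "(\<integral>x. f x * ?c n a b (norm x) \<partial>lebesgue) = 0" for n
    proof -
      have "(\<integral>x. f x * ?c n a b (norm x) \<partial>lebesgue) = (\<integral>x. W x * (?c n a b (norm x) * \<rho> x) - K * (?c n a b (norm x) * \<rho> x) \<partial>lebesgue)"
        by (simp add: f_def algebra_simps)
      also have "\<dots> = K * ?w * (\<integral>t. ?c n a b t \<partial>lborel) - K * (\<integral>x. ?c n a b (norm x) * \<rho> x \<partial>lebesgue)"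
        using Wc[OF a(1), of n b] \<rho>I[OF a(1) cm cb cs] key[OF a]
        by (subst Bochner_Integration.integral_diff) auto
      also have "(\<integral>x. ?c n a b (norm x) * \<rho> x \<partial>lebesgue) = (\<integral>x. ?c n a b (norm x) * \<rho> x \<partial>lborel)"
        by (rule integral_completion) measurable
      also have "\<dots> = ?w * (\<integral>t. ?c n a b t \<partial>lborel)"
        using integral_radial[where 'a = 'a, OF cm, of n a b] cs[of n a b] a(1) by (force simp: \<rho>_def)
      finally show ?thesis by simp
    qed
    have "(\<lambda>n. \<integral>x. f x * ?c n a b (norm x) \<partial>lebesgue) \<longlonglongrightarrow> (\<integral>x. f x * indicator {a<..<b} (norm x) \<partial>lebesgue)"
    proof (rule integral_dominated_convergence[where w = "\<lambda>x. norm (f x * indicator {a<..<b} (norm x))"])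
      show "(\<lambda>x. f x * indicator {a<..<b} (norm x)) \<in> borel_measurable lebesgue" using fi[OF a(1)] by simp
      show "(\<lambda>x. f x * ?c n a b (norm x)) \<in> borel_measurable lebesgue" for n
        by (rule borel_measurable_integrable[OF fI[OF a(1) cm cb cs]])
      show "integrable lebesgue (\<lambda>x. norm (f x * indicator {a<..<b} (norm x)))" using fi[OF a(1)] by (rule integrable_norm)
      show "AE x in lebesgue. (\<lambda>n. f x * ?c n a b (norm x)) \<longlonglongrightarrow> f x * indicator {a<..<b} (norm x)"
        using box_cutoff_tendsto[of a b] by (auto intro!: tendsto_mult simp: box_real)
      have "\<bar>f x\<bar> * \<bar>?c n a b t\<bar> \<le> \<bar>f x\<bar> * indicator {a<..<b} t" for n x t
        using cb[of n a b t] box_cutoff_outside[of t a b n] by (auto intro!: mult_left_le simp: box_real split: split_indicator)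
      then show "AE x in lebesgue. norm (f x * ?c n a b (norm x)) \<le> norm (f x * indicator {a<..<b} (norm x))" for n
        by (simp add: abs_mult)
    qed
    then show "(\<integral>x. f x * indicator {a<..<b} (norm x) \<partial>lebesgue) = 0"
      by (simp add: 0 LIMSEQ_const_iff)
  qed
  then have "AE x in lebesgue. W x = K" using AE_norm_neq[of 0]
    by eventually_elim (auto simp: f_def \<rho>_def)
  then show thesis by (rule that)
qed

text \<open>u and the primitive of its radial derivative pair equally with all radial tests, so they
  differ by a constant; v is the primitive plus this constant.\<close>

theorem radial_representative:
  fixes u :: "'a::euclidean_space \<Rightarrow> real"
  assumes wg: "has_weak_gradient u g" and rad: "radial u"
  obtains v where "AE x in lebesgue. u x = v (norm x)"
    "\<And>s t. 0 < s \<Longrightarrow> s \<le> t \<Longrightarrow>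
      sphere_area DIM('a) * (v t - v s) = (\<integral>x. (g x \<bullet> x) / norm x ^ DIM('a) * indicator (shell s t) x \<partial>lebesgue)"
proof -
  let ?n = "DIM('a)"
  have lu: "locally_integrable u" and lg: "locally_integrable g" using wg by (auto simp: has_weak_gradient_def)
  from rad obtain v0 where v0: "AE x in lebesgue. u x = v0 (norm x)" by (auto simp: radial_def)
  define G where "G x = (g x \<bullet> x) / norm x ^ ?n" for x
  have GI: "integrable lebesgue (\<lambda>x. G x * indicator (shell p q) x)" if "0 < p" for p q
    using integrable_radial_gradient[OF lg that] by (simp add: G_def)
  let ?F = "radial_primitive G"
  define W where "W x = u x - ?F (norm x)" for x
  have FI: "integrable lebesgue (\<lambda>x::'a. ?F (norm x) * indicator (shell p q) x)" if p: "0 < p" for p q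
  proof (cases "q \<le> p")
    case True
    have "(\<lambda>x::'a. ?F (norm x) * indicator (shell p q) x) = (\<lambda>x::'a. 0)" using True by (auto split: split_indicator)
    then show ?thesis by simp
  next
    case False
    let ?w = "sphere_area ?n"
    have w: "?w > 0" by (simp add: sphere_area_pos)
    \<comment> \<open>The primitive is a difference of integrals of the positive and negative parts
      of G, each monotone in t; this gives Borel measurability and local bounds before any
      continuity is known.\<close>
    define M where "M \<sigma> t = (\<integral>x. max (\<sigma> * G x) 0 * indicator (shell p t) x \<partial>lebesgue)" for \<sigma> t :: real
    have MI: "integrable lebesgue (\<lambda>x. max (\<sigma> * G x) 0 * indicator (shell p t) x)" for \<sigma> t :: real
    proof -
      have "integrable lebesgue (\<lambda>x. max (\<sigma> * (G x * indicator (shell p t) x)) 0)"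
        by (intro integrable_max integrable_mult_right GI p) simp
      moreover have "max (\<sigma> * (G x * indicator (shell p t) x)) 0 = max (\<sigma> * G x) 0 * indicator (shell p t) x" for x
        by (auto split: split_indicator)
      ultimately show ?thesis by simp
    qed
    have Mmono: "M \<sigma> s \<le> M \<sigma> t" if "s \<le> t" for \<sigma> s t
      unfolding M_def by (rule integral_mono[OF MI MI]) (use that in \<open>auto split: split_indicator\<close>)
    then have [measurable]: "M \<sigma> \<in> borel_measurable borel" for \<sigma>
      by (intro borel_measurable_mono) (auto simp: mono_def)
    have FM: "?F t = ?F p + (M 1 t - M (-1) t) / ?w" if "t \<ge> p" for t
    proof -
      have "(\<integral>x. G x * indicator (shell p t) x \<partial>lebesgue) = (\<integral>x. max (1 * G x) 0 * indicator (shell p t) x - max (- 1 * G x) 0 * indicator (shell p t) x \<partial>lebesgue)"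
        by (rule Bochner_Integration.integral_cong) (auto split: split_indicator)
      also have "\<dots> = M 1 t - M (-1) t" unfolding M_def by (rule Bochner_Integration.integral_diff[OF MI MI])
      finally show ?thesis using radial_primitive_diff[OF GI p that] w by (simp add: field_simps)
    qed
    let ?B = "\<bar>?F p\<bar> + (\<bar>M 1 p\<bar> + \<bar>M 1 q\<bar> + (\<bar>M (-1) p\<bar> + \<bar>M (-1) q\<bar>)) / ?w"
    have bd: "\<bar>(?F p + (M 1 t - M (-1) t) / ?w) * indicator {p<..q} t\<bar> \<le> ?B" for t
    proof (cases "t \<in> {p<..q}")
      case True
      then have "\<bar>M \<sigma> t\<bar> \<le> \<bar>M \<sigma> p\<bar> + \<bar>M \<sigma> q\<bar>" for \<sigma> using Mmono[of p t \<sigma>] Mmono[of t q \<sigma>] by auto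
      then have "\<bar>M 1 t - M (-1) t\<bar> / ?w \<le> (\<bar>M 1 p\<bar> + \<bar>M 1 q\<bar> + (\<bar>M (-1) p\<bar> + \<bar>M (-1) q\<bar>)) / ?w"
        using w abs_triangle_ineq4[of "M 1 t" "M (-1) t"]
        by (intro divide_right_mono) (smt (verit), simp)
      moreover have "\<bar>?F p + (M 1 t - M (-1) t) / ?w\<bar> \<le> \<bar>?F p\<bar> + \<bar>M 1 t - M (-1) t\<bar> / ?w"
        using abs_triangle_ineq[of "?F p" "(M 1 t - M (-1) t) / ?w"] w by (simp add: abs_divide)
      ultimately show ?thesis using True by simp
    qed (use w in auto)
    have "integrable lebesgue (\<lambda>x::'a. 1 * ((?F p + (M 1 (norm x) - M (-1) (norm x)) / ?w) * indicator {p<..q} (norm x)))"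
    proof (rule integrable_mult_bounded_support[OF locally_integrable_one _ bd, of _ "cball 0 q"])
      show "(\<lambda>x::'a. (?F p + (M 1 (norm x) - M (-1) (norm x)) / ?w) * indicat_real {p<..q} (norm x)) \<in> borel_measurable lebesgue"
        by (rule borel_imp_lebesgue) measurable
    qed (auto split: split_indicator_asm)
    moreover have "1 * ((?F p + (M 1 (norm x) - M (-1) (norm x)) / ?w) * indicator {p<..q} (norm x)) = ?F (norm x) * indicator (shell p q) x" for x :: 'a
      using FM[of "norm x"] by (auto split: split_indicator)
    ultimately show ?thesis by simp
  qed
  have uI: "integrable lebesgue (\<lambda>x. u x * indicator (shell p q) x)" for p q
    by (rule integrable_mult_bounded_support[OF lu borel_imp_lebesgue, of _ 1 "cball 0 q"]) (auto split: split_indicator split_indicator_asm)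
  obtain K where K: "AE x in lebesgue. W x = K"
  proof (rule radial_du_Bois_Reymond)
    show "AE x in lebesgue. W x = v0 (norm x) - ?F (norm x)" using v0 by eventually_elim (simp add: W_def)
    show "integrable lebesgue (\<lambda>x. W x * indicator (shell p q) x)" if "0 < p" for p q
      using uI[of p q] FI[OF that, of q] by (simp add: W_def left_diff_distrib)
    fix \<psi> \<psi>' :: "real \<Rightarrow> real" and c d :: real
    assume c: "0 < c" and \<psi>: "smooth_on UNIV \<psi>" and cont: "continuous_on UNIV \<psi>'"
      and d: "\<And>t. (\<psi> has_real_derivative \<psi>' t) (at t)" and supp: "\<And>t. \<psi> t \<noteq> 0 \<Longrightarrow> c < t \<and> t < d"
    let ?h = "\<lambda>x::'a. \<psi>' (norm x) / norm x ^ (?n - 1)"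
    note dz = derivative_zero_outside[OF d supp]
    have ui: "integrable lebesgue (\<lambda>x. u x * ?h x)"
    proof (rule integrable_mult_test[OF lu])
      have "continuous_on ({x. norm x < c} \<union> {x. norm x > 0}) ?h"
      proof (rule continuous_on_open_Un)
        show "continuous_on {x::'a. norm x < c} ?h"
          by (rule continuous_on_cong[THEN iffD1, of _ _ "\<lambda>x. 0"]) (auto simp: dz)
        show "continuous_on {x::'a. norm x > 0} ?h"
          by (auto intro!: continuous_intros continuous_on_compose2[OF cont])
      qed (auto intro!: open_Collect_less open_Collect_neq continuous_intros)
      moreover have "{x. norm x < c} \<union> {x. norm x > 0} = (UNIV :: 'a set)" using c by auto
      ultimately show "continuous_on UNIV ?h" by simp
      show "bounded {x::'a. ?h x \<noteq> 0}"
        by (rule bounded_subset[OF bounded_cball[of 0 d]]) (use dz in \<open>force simp: not_less[symmetric]\<close>)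
    qed
    have "(\<integral>x. W x * ?h x \<partial>lebesgue) = (\<integral>x. u x * ?h x - ?F (norm x) * ?h x \<partial>lebesgue)"
      by (simp only: W_def left_diff_distrib)
    also have "\<dots> = (\<integral>x. u x * ?h x \<partial>lebesgue) - (\<integral>x. ?F (norm x) * ?h x \<partial>lebesgue)"
      by (rule Bochner_Integration.integral_diff[OF ui radial_primitive_by_parts(1)[OF GI d cont c supp]])
    also have "\<dots> = 0"
      using radial_test_field[OF wg \<psi> d c supp, folded G_def] radial_primitive_by_parts(2)[OF GI d cont c supp]
      by simp
    finally show "(\<integral>x. W x * ?h x \<partial>lebesgue) = 0" .
  qed
  show thesis
  proof (rule that)
    show "AE x in lebesgue. u x = K + ?F (norm x)" using K by eventually_elim (simp add: W_def)
    show "sphere_area ?n * (K + ?F t - (K + ?F s)) = (\<integral>x. (g x \<bullet> x) / norm x ^ ?n * indicator (shell s t) x \<partial>lebesgue)"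
      if "0 < s" "s \<le> t" for s t
      using radial_primitive_diff[OF GI that] by (simp add: G_def[symmetric] times_divide_eq_left[symmetric] del: times_divide_eq_left)
  qed
qed

subsection \<open>Dyadic decomposition\<close>

lemma nn_integral_dyadic_sum:
  fixes f :: "'b \<Rightarrow> ennreal"
  assumes [measurable]: "f \<in> borel_measurable M" "\<And>k. A k \<in> sets M"
    and sub: "B \<subseteq> (\<Union>k::nat. A k)"
    and le: "\<And>k. (\<integral>\<^sup>+x. f x * indicator (A k) x \<partial>M) \<le> ennreal (a * \<theta> ^ k)"
    and a: "0 \<le> a" "0 \<le> \<theta>" "\<theta> < 1"
  shows "(\<integral>\<^sup>+x. f x * indicator B x \<partial>M) \<le> ennreal (a / (1 - \<theta>))"
proof -
  have "(\<integral>\<^sup>+x. f x * indicator B x \<partial>M) \<le> (\<integral>\<^sup>+x. (\<Sum>k. f x * indicator (A k) x) \<partial>M)"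
  proof (rule nn_integral_mono)
    fix x
    show "f x * indicator B x \<le> (\<Sum>k. f x * indicator (A k) x)"
    proof (cases "x \<in> B")
      case True
      then obtain k where "x \<in> A k" using sub by auto
      then show ?thesis using True sum_le_suminf[of "\<lambda>k. f x * indicator (A k) x" "{k}"] by (simp add: summableI)
    qed simp
  qed
  also have "\<dots> = (\<Sum>k. \<integral>\<^sup>+x. f x * indicator (A k) x \<partial>M)" by (rule nn_integral_suminf) measurable
  also have "\<dots> \<le> (\<Sum>k. ennreal (a * \<theta> ^ k))" by (intro suminf_le le summableI)
  also have "\<dots> = ennreal (a * (1 / (1 - \<theta>)))"
  proof (rule suminf_ennreal_eq)
    show "(\<lambda>k. a * \<theta> ^ k) sums (a * (1 / (1 - \<theta>)))"
      by (intro sums_mult geometric_sums) (use a in simp)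
  qed (use a in simp)
  finally show ?thesis by simp
qed

lemma two_powr_neg_less_1: "(\<tau>::real) > 0 \<Longrightarrow> 2 powr (- \<tau>) < 1"
  using powr_less_mono[of "- \<tau>" 0 2] by simp

lemma dyadic_between:
  fixes t R :: real
  assumes "0 < R" "R < t"
  obtains k :: nat where "2 ^ k * R < t" "t \<le> 2 * (2 ^ k * R)"
proof -
  obtain j0 :: nat where "t / R < 2 ^ j0" using real_arch_pow[of 2 "t / R"] by auto
  then have ex: "t \<le> 2 ^ j0 * R" using assms by (simp add: field_simps)
  define j where "j = (LEAST j. t \<le> 2 ^ j * R)"
  have j: "t \<le> 2 ^ j * R" unfolding j_def by (rule LeastI[of _ j0]) (rule ex)
  then have "j \<noteq> 0" using assms by (intro notI) simp
  then obtain k where k: "j = Suc k" by (cases j) auto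
  then have "\<not> t \<le> 2 ^ k * R" using not_less_Least[of k "\<lambda>j. t \<le> 2 ^ j * R"] j_def by simp
  then show thesis using that[of k] j k by (simp add: mult.assoc)
qed

lemma nn_integral_outer_dyadic:
  fixes f :: "'a::euclidean_space \<Rightarrow> ennreal"
  assumes f: "f \<in> borel_measurable borel" and R: "0 < R" "0 \<le> C" "0 < \<tau>"
    and le: "\<And>S. R \<le> S \<Longrightarrow> (\<integral>\<^sup>+x. f x * indicator (shell S (2 * S)) x \<partial>lborel) \<le> ennreal (C * S powr (- \<tau>))"
  shows "(\<integral>\<^sup>+x. f x * indicator {x. R < norm x} x \<partial>lborel) \<le> ennreal (C * R powr (- \<tau>) / (1 - 2 powr (- \<tau>)))"
proof (rule nn_integral_dyadic_sum[where A = "\<lambda>k. shell (2 ^ k * R) (2 * (2 ^ k * R))"])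
  show "{x. R < norm x} \<subseteq> (\<Union>k. shell (2 ^ k * R) (2 * (2 ^ k * R)) :: 'a set)"
    using dyadic_between[OF R(1)] by blast
  fix k :: nat
  have "R \<le> 2 ^ k * R" using R(1) by simp
  moreover have "(2 ^ k * R) powr (- \<tau>) = R powr (- \<tau>) * (2 powr (- \<tau>)) ^ k"
    using R(1) by (simp add: powr_mult powr_realpow[symmetric] powr_powr mult.commute)
  ultimately show "(\<integral>\<^sup>+x. f x * indicator (shell (2 ^ k * R) (2 * (2 ^ k * R))) x \<partial>lborel)
      \<le> ennreal (C * R powr (- \<tau>) * (2 powr (- \<tau>)) ^ k)"
    using le[of "2 ^ k * R"] by (simp add: mult.assoc)
qed (use f R two_powr_neg_less_1[OF R(3)] in auto)

lemma nn_integral_inner_dyadic: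
  fixes f :: "'a::euclidean_space \<Rightarrow> ennreal"
  assumes f: "f \<in> borel_measurable borel" and R: "0 < R" "0 \<le> C" "0 < \<tau>"
    and le: "\<And>S. 0 < S \<Longrightarrow> S \<le> R \<Longrightarrow> (\<integral>\<^sup>+x. f x * indicator (shell S (2 * S)) x \<partial>lborel) \<le> ennreal (C * S powr \<tau>)"
  shows "(\<integral>\<^sup>+x. f x * indicator (shell 0 (2 * R)) x \<partial>lborel) \<le> ennreal (C * R powr \<tau> / (1 - 2 powr (- \<tau>)))"
proof (rule nn_integral_dyadic_sum[where A = "\<lambda>k. shell (R / 2 ^ k) (2 * (R / 2 ^ k))"])
  show "shell 0 (2 * R) \<subseteq> (\<Union>k. shell (R / 2 ^ k) (2 * (R / 2 ^ k)) :: 'a set)"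
  proof
    fix x :: 'a assume x: "x \<in> shell 0 (2 * R)"
    show "x \<in> (\<Union>k. shell (R / 2 ^ k) (2 * (R / 2 ^ k)))"
    proof (cases "norm x = 2 * R")
      case True
      then show ?thesis using R(1) by (intro UN_I[of 0]) auto
    next
      case False
      then have "norm x < 2 * R" using x by auto
      then obtain k where k: "2 ^ k * norm x < 2 * R" "2 * R \<le> 2 * (2 ^ k * norm x)"
        using dyadic_between[of "norm x" "2 * R"] x by auto
      show ?thesis
      \<comment> \<open>The shells are open at the inner radius, so a point exactly on it belongs to
        the next shell inward.\<close>
      proof (cases "R = 2 ^ k * norm x")
        case True
        then show ?thesis using x R(1)
          by (intro UN_I[of "Suc k"]) (auto simp: field_simps)
      next
        case False
        then show ?thesis using k by (intro UN_I[of k]) (auto simp: field_simps)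
      qed
    qed
  qed
  fix k :: nat
  have "R / 2 ^ k \<le> R" "0 < R / 2 ^ k" using R(1) by (auto simp: field_simps)
  moreover have "(R / 2 ^ k) powr \<tau> = R powr \<tau> * (2 powr (- \<tau>)) ^ k"
  proof -
    have "R / 2 ^ k = R * 2 powr (- real k)" by (simp add: powr_minus powr_realpow divide_inverse)
    moreover have "(2 powr (- \<tau>)) ^ k = 2 powr (- \<tau> * real k)" by (simp add: powr_realpow[symmetric] powr_powr)
    ultimately show ?thesis using R(1) by (simp add: powr_mult powr_powr mult.commute)
  qed
  ultimately show "(\<integral>\<^sup>+x. f x * indicator (shell (R / 2 ^ k) (2 * (R / 2 ^ k))) x \<partial>lborel)
      \<le> ennreal (C * R powr \<tau> * (2 powr (- \<tau>)) ^ k)"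
    using le[of "R / 2 ^ k"] by (simp add: mult.assoc)
qed (use f R two_powr_neg_less_1[OF R(3)] in auto)

section \<open>Integrals of powers of the norm over shells, balls and exteriors\<close>

lemma emeasure_shell:
  assumes "0 \<le> s" "s \<le> t"
  shows "emeasure lborel (shell s t :: 'a::euclidean_space set)
    = ennreal (unit_ball_vol (real DIM('a)) * (t ^ DIM('a) - s ^ DIM('a)))"
proof -
  have "(shell s t :: 'a set) = cball 0 t - cball 0 s" by auto
  moreover have "emeasure lborel (cball 0 t - cball 0 s :: 'a set) = emeasure lborel (cball 0 t :: 'a set) - emeasure lborel (cball 0 s :: 'a set)"
    using assms emeasure_lborel_cball_finite[of "0::'a" s] by (intro emeasure_Diff) auto
  ultimately show ?thesis
    using assms by (simp add: emeasure_cball right_diff_distrib ennreal_minus)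
qed

lemma emeasure_outside_ball: "emeasure lborel {x::'a::euclidean_space. R < norm x} = \<infinity>"
proof -
  have "{x::'a. R < norm x} = UNIV - cball 0 R" by auto
  moreover have "emeasure lborel (UNIV - cball 0 R :: 'a set) = emeasure lborel (UNIV :: 'a set) - emeasure lborel (cball 0 R :: 'a set)"
    using emeasure_lborel_cball_finite[of "0::'a" R] by (intro emeasure_Diff) auto
  ultimately show ?thesis using emeasure_lborel_cball_finite[of "0::'a" R] by (auto simp: ennreal_top_minus)
qed

text \<open>On the shell from R to 2R, |x|^(-p) is at most 2^|p| R^(-p) for either sign of p, and
  the shell lies in a ball with 2^n R^n times the volume of the unit ball.\<close>

definition power_const :: "nat \<Rightarrow> real \<Rightarrow> real" where
  "power_const n p = 2 powr (\<bar>p\<bar> + real n) * unit_ball_vol (real n)"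

lemma power_const_pos: "power_const n p > 0"
  by (simp add: power_const_def)

lemma nn_integral_power_shell:
  assumes R: "0 < R"
  shows "(\<integral>\<^sup>+x. ennreal (norm x powr (- p)) * indicator (shell R (2 * R)) x \<partial>(lborel :: 'a::euclidean_space measure))
    \<le> ennreal (power_const DIM('a) p * R powr (real DIM('a) - p))"
proof -
  let ?n = "DIM('a)"
  have b: "norm x powr (- p) \<le> 2 powr \<bar>p\<bar> * R powr (- p)" if "x \<in> shell R (2 * R)" for x :: 'a
  proof (cases "p \<ge> 0")
    case True
    have "norm x powr (- p) \<le> R powr (- p)" using that R True by (intro powr_mono2') auto
    also have "\<dots> \<le> 2 powr \<bar>p\<bar> * R powr (- p)" using ge_one_powr_ge_zero[of 2 "\<bar>p\<bar>"] mult_right_mono[of 1 "2 powr \<bar>p\<bar>" "R powr (- p)"] by simp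
    finally show ?thesis .
  next
    case False
    have "norm x powr (- p) \<le> (2 * R) powr (- p)" using that R False by (intro powr_mono2) auto
    then show ?thesis using False R by (simp add: powr_mult)
  qed
  have "(\<integral>\<^sup>+x. ennreal (norm x powr (- p)) * indicator (shell R (2 * R)) x \<partial>(lborel :: 'a measure))
     \<le> (\<integral>\<^sup>+x. ennreal (2 powr \<bar>p\<bar> * R powr (- p)) * indicator (cball 0 (2 * R)) x \<partial>(lborel :: 'a measure))"
    by (rule nn_integral_mono) (use b in \<open>auto split: split_indicator\<close>)
  also have "\<dots> = ennreal (2 powr \<bar>p\<bar> * R powr (- p)) * ennreal (unit_ball_vol (real ?n) * (2 * R) ^ ?n)"
    using R by (simp add: nn_integral_cmult_indicator emeasure_cball)
  also have "\<dots> = ennreal ((2 powr \<bar>p\<bar> * R powr (- p)) * (unit_ball_vol (real ?n) * (2 * R) ^ ?n))"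
    using R by (intro ennreal_mult[symmetric]) auto
  also have "(2 powr \<bar>p\<bar> * R powr (- p)) * (unit_ball_vol (real ?n) * (2 * R) ^ ?n) = power_const ?n p * R powr (real ?n - p)"
    using R by (simp add: power_const_def powr_add powr_diff powr_minus powr_realpow power_mult_distrib field_simps)
  finally show ?thesis .
qed

lemma nn_integral_power_outer:
  assumes R: "0 < R" and p: "p > real DIM('a)"
  shows "(\<integral>\<^sup>+x. ennreal (norm x powr (- p)) * indicator {x. R < norm x} x \<partial>(lborel :: 'a::euclidean_space measure))
    \<le> ennreal (power_const DIM('a) p * R powr (real DIM('a) - p) / (1 - 2 powr (real DIM('a) - p)))"
  using nn_integral_outer_dyadic[of "\<lambda>x::'a. ennreal (norm x powr (- p))" R "power_const DIM('a) p" "p - real DIM('a)"]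
    nn_integral_power_shell[where 'a = 'a and p = p] power_const_pos[of "DIM('a)" p] R p
  by (simp add: less_imp_le)

lemma nn_integral_power_inner:
  assumes R: "0 < R" and p: "p < real DIM('a)"
  shows "(\<integral>\<^sup>+x. ennreal (norm x powr (- p)) * indicator (shell 0 (2 * R)) x \<partial>(lborel :: 'a::euclidean_space measure))
    \<le> ennreal (power_const DIM('a) p * R powr (real DIM('a) - p) / (1 - 2 powr (p - real DIM('a))))"
  using nn_integral_inner_dyadic[of "\<lambda>x::'a. ennreal (norm x powr (- p))" R "power_const DIM('a) p" "real DIM('a) - p"]
    nn_integral_power_shell[where 'a = 'a and p = p] power_const_pos[of "DIM('a)" p] R p
  by (simp add: less_imp_le)

subsection \<open>Pointwise and integral estimates for radial functions\<close>

text \<open>Mean value estimates for a power, used to compare the volume of a shell with its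
  thickness from both sides.\<close>

lemma power_diff_bounds:
  fixes s t :: real
  assumes "0 \<le> s" "s \<le> t"
  shows "t ^ Suc m - s ^ Suc m \<le> real (Suc m) * t ^ m * (t - s)"
    and "real (Suc m) * s ^ m * (t - s) \<le> t ^ Suc m - s ^ Suc m"
proof (induction m)
  case (Suc m)
  have e: "t ^ Suc (Suc m) - s ^ Suc (Suc m) = t * (t ^ Suc m - s ^ Suc m) + s ^ Suc m * (t - s)"
    "t ^ Suc (Suc m) - s ^ Suc (Suc m) = s * (t ^ Suc m - s ^ Suc m) + t ^ Suc m * (t - s)"
    by (simp_all add: algebra_simps)
  {
    case 1
    have "t * (t ^ Suc m - s ^ Suc m) \<le> t * (real (Suc m) * t ^ m * (t - s))"
      using Suc(1) assms by (intro mult_left_mono) auto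
    moreover have "s ^ Suc m * (t - s) \<le> t ^ Suc m * (t - s)"
      using assms by (intro mult_right_mono power_mono) auto
    ultimately show ?case unfolding e(1) by (simp add: algebra_simps)
  next
    case 2
    have "s * (real (Suc m) * s ^ m * (t - s)) \<le> s * (t ^ Suc m - s ^ Suc m)"
      using Suc(2) assms by (intro mult_left_mono) auto
    moreover have "s ^ Suc m * (t - s) \<le> t ^ Suc m * (t - s)"
      using assms by (intro mult_right_mono power_mono) auto
    ultimately show ?case unfolding e(2) by (simp add: algebra_simps)
  }
qed simp_all

text \<open>The argument \<open>ty\<close> only fixes the space \<open>'a\<close> over which is integrated.\<close>

abbreviation radial_mass :: "'a::euclidean_space itself \<Rightarrow> (real \<Rightarrow> real) \<Rightarrow> real \<Rightarrow> 'a set \<Rightarrow> ennreal" where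
  "radial_mass ty v p A \<equiv> \<integral>\<^sup>+x. ennreal (\<bar>v (norm x)\<bar> powr p) * indicator A x \<partial>lborel"

text \<open>The square root comes from the Cauchy--Schwarz inequality: under it stands the bound of
  \<open>nn_integral_power_outer\<close> for p = 2n-2 and radius 1.\<close>

definition decay_const :: "nat \<Rightarrow> real" where
  "decay_const n = sqrt (power_const n (2 * real n - 2) / (1 - 2 powr (2 - real n))) / sphere_area n"

text \<open>If \<open>m = \<bar>v R\<bar>\<close>, then \<open>\<bar>v\<bar> \<ge> m / 2\<close> on \<open>[R, R + \<delta>] \<subseteq> [R, 2 R]\<close> for \<open>\<delta> = length_const n * m\<^sup>2 * R^(n-1)\<close>.\<close>

definition length_const :: "nat \<Rightarrow> real" where
  "length_const n = min (1 / (decay_const n)\<^sup>2) (sphere_area n / 2 ^ (n + 1))"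

lemma two_powr_less_1: "n \<ge> 3 \<Longrightarrow> 2 powr (2 - real n) < 1"
  using two_powr_neg_less_1[of "real n - 2"] by simp

lemma decay_const_pos: "n \<ge> 3 \<Longrightarrow> decay_const n > 0"
  using two_powr_less_1[of n] power_const_pos[of n] sphere_area_pos[of n] by (simp add: decay_const_def)

lemma length_const_pos: "n \<ge> 3 \<Longrightarrow> length_const n > 0"
  using decay_const_pos[of n] sphere_area_pos[of n] by (simp add: length_const_def)

text \<open>The profile after normalization, with g in the place of the length of the gradient,
  which acts only through \<open>g_L2\<close> and \<open>osc\<close>. \<open>finite_Lp\<close> is
  qualitative and forces v to vanish at infinity; \<open>v_nonpos\<close> fixes the values at radii
  without a sphere, so that v is Borel on the whole line.\<close>

locale radial_profile =
  fixes v :: "real \<Rightarrow> real" and g :: "'a::euclidean_space \<Rightarrow> real"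
  assumes dim: "DIM('a) \<ge> 3"
    and v_nonpos: "\<And>t. t \<le> 0 \<Longrightarrow> v t = 0"
    and g_meas [measurable]: "g \<in> borel_measurable borel"
    and g_nonneg: "\<And>x. 0 \<le> g x"
    and g_L2: "(\<integral>\<^sup>+x. ennreal ((g x)\<^sup>2) \<partial>lborel) \<le> 1"
    and osc: "\<And>s t. 0 < s \<Longrightarrow> s \<le> t \<Longrightarrow> ennreal (sphere_area DIM('a) * \<bar>v t - v s\<bar>)
      \<le> (\<integral>\<^sup>+x. ennreal (g x * norm x powr (1 - real DIM('a))) * indicator (shell s t) x \<partial>lborel)"
    and finite_Lp: "(\<integral>\<^sup>+x. ennreal (\<bar>v (norm x)\<bar> powr sobolev_exp DIM('a)) \<partial>(lebesgue :: 'a measure)) < \<infinity>"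
begin

lemma area_pos: "sphere_area DIM('a) > 0" by (simp add: sphere_area_pos)

lemma n3: "real DIM('a) \<ge> 3" using dim by simp

text \<open>g |x|^(1-n) is split as g |x|^(-\<kappa>/2) times |x|^(\<kappa>/2+1-n). The value
  \<kappa> = 0 gives the oscillation bounds, \<kappa> = (n-2)/2 the radial Sobolev
  inequality.\<close>

lemma weighted_Cauchy_Schwarz:
  assumes [measurable]: "A \<in> sets borel"
  shows "(\<integral>\<^sup>+x. ennreal (g x * norm x powr (1 - real DIM('a))) * indicator A x \<partial>lborel)\<^sup>2
    \<le> (\<integral>\<^sup>+x. ennreal ((g x)\<^sup>2 * norm x powr (- \<kappa>)) * indicator A x \<partial>lborel)
      * (\<integral>\<^sup>+x. ennreal (norm x powr (- (2 * real DIM('a) - 2 - \<kappa>))) * indicator A x \<partial>(lborel :: 'a measure))"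
proof -
  let ?f = "\<lambda>x. ennreal (g x * norm x powr (- \<kappa> / 2)) * indicator A x"
  let ?h = "\<lambda>x::'a. ennreal (norm x powr (\<kappa> / 2 + 1 - real DIM('a))) * indicator A x"
  have fh: "?f x * ?h x = ennreal (g x * norm x powr (1 - real DIM('a))) * indicator A x" for x
  proof (cases "x \<in> A \<and> x \<noteq> 0")
    case True
    then have "norm x powr (- \<kappa> / 2) * norm x powr (\<kappa> / 2 + 1 - real DIM('a)) = norm x powr (1 - real DIM('a))"
      by (simp add: powr_add[symmetric])
    then show ?thesis using True g_nonneg[of x]
      by (simp add: ennreal_mult[symmetric] mult.assoc)
  qed auto
  have sq: "(ennreal a * indicator A x)\<^sup>2 = ennreal (a\<^sup>2) * indicator A x" if "a \<ge> 0" for a and x :: 'a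
    using that by (auto simp: ennreal_power split: split_indicator)
  have pw: "(norm x powr c)\<^sup>2 = norm x powr (2 * c)" for x :: 'a and c
    by (simp add: power2_eq_square powr_add[symmetric])
  have "(\<integral>\<^sup>+x. ?f x * ?h x \<partial>lborel)\<^sup>2 \<le> (\<integral>\<^sup>+x. (?f x)\<^sup>2 \<partial>lborel) * (\<integral>\<^sup>+x. (?h x)\<^sup>2 \<partial>lborel)"
    by (rule Cauchy_Schwarz_nn_integral) measurable
  moreover have "(?f x)\<^sup>2 = ennreal ((g x)\<^sup>2 * norm x powr (- \<kappa>)) * indicator A x" for x
    using g_nonneg[of x] by (subst sq) (auto simp: power_mult_distrib pw)
  moreover have "(?h x)\<^sup>2 = ennreal (norm x powr (- (2 * real DIM('a) - 2 - \<kappa>))) * indicator A x" for x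
    by (subst sq) (auto simp: pw algebra_simps)
  ultimately show ?thesis by (simp only: fh)
qed

lemma osc_square:
  assumes "0 < s" "s \<le> t"
  shows "ennreal ((sphere_area DIM('a) * \<bar>v t - v s\<bar>)\<^sup>2) \<le> (\<integral>\<^sup>+x. ennreal (norm x powr (- (2 * real DIM('a) - 2))) * indicator (shell s t) x \<partial>(lborel :: 'a measure))"
proof -
  have "ennreal ((sphere_area DIM('a) * \<bar>v t - v s\<bar>)\<^sup>2) = (ennreal (sphere_area DIM('a) * \<bar>v t - v s\<bar>))\<^sup>2"
    using area_pos by (simp add: ennreal_power)
  also have "\<dots> \<le> (\<integral>\<^sup>+x. ennreal (g x * norm x powr (1 - real DIM('a))) * indicator (shell s t) x \<partial>lborel)\<^sup>2"
    by (intro power_mono osc assms) simp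
  also have "\<dots> \<le> (\<integral>\<^sup>+x. ennreal ((g x)\<^sup>2 * norm x powr (- 0)) * indicator (shell s t) x \<partial>lborel)
      * (\<integral>\<^sup>+x. ennreal (norm x powr (- (2 * real DIM('a) - 2 - 0))) * indicator (shell s t) x \<partial>(lborel :: 'a measure))"
    by (rule weighted_Cauchy_Schwarz) simp
  also have "\<dots> \<le> 1 * (\<integral>\<^sup>+x. ennreal (norm x powr (- (2 * real DIM('a) - 2 - 0))) * indicator (shell s t) x \<partial>(lborel :: 'a measure))"
  proof (rule mult_right_mono)
    have "(\<integral>\<^sup>+x. ennreal ((g x)\<^sup>2 * norm x powr (- 0)) * indicator (shell s t) x \<partial>lborel) \<le> (\<integral>\<^sup>+x. ennreal ((g x)\<^sup>2) \<partial>lborel)"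
      by (rule nn_integral_mono) (auto split: split_indicator)
    then show "(\<integral>\<^sup>+x. ennreal ((g x)\<^sup>2 * norm x powr (- 0)) * indicator (shell s t) x \<partial>lborel) \<le> 1"
      using g_L2 by (rule order_trans)
  qed simp
  finally show ?thesis by simp
qed

lemma osc_Hoelder:
  assumes "0 < s" "s \<le> t" "t \<le> 2 * s"
  shows "(sphere_area DIM('a) * \<bar>v t - v s\<bar>)\<^sup>2 \<le> sphere_area DIM('a) * 2 ^ (DIM('a) - 1) * s powr (1 - real DIM('a)) * (t - s)"
proof -
  let ?n = "DIM('a)" and ?u = "unit_ball_vol (real DIM('a))"
  obtain m where m: "?n = Suc m" using dim by (cases ?n) auto
  have "ennreal ((sphere_area DIM('a) * \<bar>v t - v s\<bar>)\<^sup>2) \<le> (\<integral>\<^sup>+x. ennreal (norm x powr (- (2 * real ?n - 2))) * indicator (shell s t) x \<partial>(lborel :: 'a measure))"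
    by (rule osc_square) (use assms in auto)
  also have "\<dots> \<le> (\<integral>\<^sup>+x. ennreal (s powr (- (2 * real ?n - 2))) * indicator (shell s t) x \<partial>(lborel :: 'a measure))"
    using n3 assms by (intro nn_integral_mono) (auto split: split_indicator intro!: powr_mono2' ennreal_leI)
  also have "\<dots> = ennreal (s powr (- (2 * real ?n - 2)) * (?u * (t ^ ?n - s ^ ?n)))"
    using assms by (simp add: nn_integral_cmult_indicator emeasure_shell ennreal_mult power_mono)
  finally have "(sphere_area DIM('a) * \<bar>v t - v s\<bar>)\<^sup>2 \<le> s powr (- (2 * real ?n - 2)) * (?u * (t ^ ?n - s ^ ?n))"
    using assms by (subst (asm) ennreal_le_iff) (auto intro!: mult_nonneg_nonneg power_mono)
  also have "\<dots> \<le> s powr (- (2 * real ?n - 2)) * (?u * (real ?n * (2 * s) ^ m * (t - s)))"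
  proof (intro mult_left_mono)
    have "t ^ ?n - s ^ ?n \<le> real ?n * t ^ m * (t - s)" unfolding m using assms by (intro power_diff_bounds(1)) auto
    also have "\<dots> \<le> real ?n * (2 * s) ^ m * (t - s)"
      using assms by (intro mult_right_mono mult_left_mono power_mono) auto
    finally show "t ^ ?n - s ^ ?n \<le> real ?n * (2 * s) ^ m * (t - s)" .
  qed auto
  also have "\<dots> = sphere_area DIM('a) * 2 ^ m * (s powr (- (2 * real ?n - 2)) * s ^ m) * (t - s)"
    by (simp add: sphere_area_def power_mult_distrib)
  also have "s powr (- (2 * real ?n - 2)) * s ^ m = s powr (1 - real ?n)"
    using assms m by (simp add: powr_realpow[symmetric] powr_add[symmetric])
  finally show ?thesis by (simp add: m)
qed

lemma osc_decay:
  assumes "0 < s" "s \<le> t"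
  shows "\<bar>v t - v s\<bar> \<le> decay_const DIM('a) * s powr (- ((real DIM('a) - 2) / 2))"
proof -
  let ?n = "DIM('a)"
  let ?K = "power_const ?n (2 * real ?n - 2) / (1 - 2 powr (2 - real ?n))"
  have K: "?K \<ge> 0" using two_powr_less_1[OF dim] power_const_pos[of ?n "2 * real ?n - 2"] by (simp add: less_imp_le)
  have "ennreal ((sphere_area DIM('a) * \<bar>v t - v s\<bar>)\<^sup>2) \<le> (\<integral>\<^sup>+x. ennreal (norm x powr (- (2 * real ?n - 2))) * indicator (shell s t) x \<partial>(lborel :: 'a measure))"
    by (rule osc_square) (use assms in auto)
  also have "\<dots> \<le> (\<integral>\<^sup>+x. ennreal (norm x powr (- (2 * real ?n - 2))) * indicator {x. s < norm x} x \<partial>(lborel :: 'a measure))"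
    by (rule nn_integral_mono) (auto split: split_indicator)
  also have "\<dots> \<le> ennreal (power_const ?n (2 * real ?n - 2) * s powr (real ?n - (2 * real ?n - 2)) / (1 - 2 powr (real ?n - (2 * real ?n - 2))))"
    by (rule nn_integral_power_outer) (use assms n3 in auto)
  also have "\<dots> = ennreal (?K * s powr (2 - real ?n))" by (simp add: algebra_simps)
  finally have "(sphere_area DIM('a) * \<bar>v t - v s\<bar>)\<^sup>2 \<le> ?K * s powr (2 - real ?n)"
    by (rule ennreal_le_iff[THEN iffD1, rotated]) (use K in \<open>intro mult_nonneg_nonneg; simp\<close>)
  also have "\<dots> = (sphere_area DIM('a) * (decay_const ?n * s powr (- ((real ?n - 2) / 2))))\<^sup>2"
  proof -
    have "(s powr (- ((real ?n - 2) / 2)))\<^sup>2 = s powr (2 - real ?n)"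
      unfolding power2_eq_square powr_add[symmetric]
      by (rule arg_cong[where f = "\<lambda>z. s powr z"]) (simp add: field_simps)
    moreover have "(sphere_area ?n * decay_const ?n)\<^sup>2 = ?K"
      using area_pos real_sqrt_pow2[OF K] by (simp add: decay_const_def)
    ultimately show ?thesis by (metis mult.assoc power_mult_distrib)
  qed
  finally have "sphere_area DIM('a) * \<bar>v t - v s\<bar> \<le> sphere_area DIM('a) * (decay_const ?n * s powr (- ((real ?n - 2) / 2)))"
    by (rule power2_le_imp_le) (use area_pos decay_const_pos[OF dim] in \<open>simp add: less_imp_le\<close>)
  then show ?thesis using area_pos by simp
qed

text \<open>\<open>osc_decay\<close> controls differences only. If the bound failed at s, |v| would
  stay above a positive constant beyond s, a set of infinite measure, against
  \<open>finite_Lp\<close>.\<close>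

lemma decay:
  assumes s: "0 < s"
  shows "\<bar>v s\<bar> \<le> decay_const DIM('a) * s powr (- ((real DIM('a) - 2) / 2))"
proof (rule ccontr)
  let ?n = "DIM('a)" and ?D = "decay_const DIM('a) * s powr (- ((real DIM('a) - 2) / 2))"
  assume "\<not> ?thesis"
  then have m: "\<bar>v s\<bar> - ?D > 0" by simp
  define m where "m = \<bar>v s\<bar> - ?D"
  have p: "sobolev_exp ?n > 0" using n3 by (simp add: sobolev_exp_def)
  have "m \<le> \<bar>v t\<bar>" if "s \<le> t" for t using osc_decay[OF s that] unfolding m_def by linarith
  then have "(\<integral>\<^sup>+x. ennreal (m powr sobolev_exp ?n) * indicator {x. s < norm x} x \<partial>(lebesgue :: 'a measure))
      \<le> (\<integral>\<^sup>+x. ennreal (\<bar>v (norm x)\<bar> powr sobolev_exp ?n) \<partial>(lebesgue :: 'a measure))"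
    using m p by (intro nn_integral_mono) (auto simp: m_def[symmetric] split: split_indicator intro!: ennreal_leI powr_mono2)
  moreover have "(\<integral>\<^sup>+x. ennreal (m powr sobolev_exp ?n) * indicator {x. s < norm x} x \<partial>(lebesgue :: 'a measure)) = \<infinity>"
    by (subst nn_integral_completion) (use m in \<open>simp_all add: nn_integral_cmult_indicator emeasure_outside_ball m_def[symmetric] ennreal_mult_top\<close>)
  ultimately show False using finite_Lp by simp
qed

lemma local_mass_lower_bound:
  assumes R: "0 < R" and q: "1 \<le> q"
  shows "ennreal (sphere_area DIM('a) * length_const DIM('a) * 2 powr (- q) * \<bar>v R\<bar> powr (q + 2) * R powr (2 * real DIM('a) - 2))
    \<le> radial_mass TYPE('a) v q (shell R (2 * R))"
proof (cases "v R = 0")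
  case True
  then show ?thesis by simp
next
  case False
  let ?n = "DIM('a)" and ?u = "unit_ball_vol (real DIM('a))"
  obtain k where k: "?n = Suc k" using dim by (cases ?n) auto
  define m where "m = \<bar>v R\<bar>"
  have m: "m > 0" using False by (simp add: m_def)
  define \<epsilon> where "\<epsilon> = length_const ?n"
  \<comment> \<open>The two terms of the minimum in \<open>length_const\<close> serve two purposes:
    the first, with the decay of v, yields \<delta> \<le> R; the second keeps the Hoelder
    oscillation on [R, R + \<delta>] within m/2.\<close>
  have e: "\<epsilon> > 0" "\<epsilon> * (decay_const ?n)\<^sup>2 \<le> 1" "\<epsilon> * 2 ^ (?n + 1) \<le> sphere_area DIM('a)"
    using length_const_pos[OF dim] decay_const_pos[OF dim]
    by (auto simp: \<epsilon>_def length_const_def min_def field_simps)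
  define \<delta> where "\<delta> = \<epsilon> * m\<^sup>2 * R powr (real ?n - 1)"
  have d0: "\<delta> > 0" using e m R by (simp add: \<delta>_def)
  have "m\<^sup>2 \<le> (decay_const ?n * R powr (- ((real ?n - 2) / 2)))\<^sup>2"
    using decay[OF R] m by (intro power_mono) (auto simp: m_def)
  also have "\<dots> = (decay_const ?n)\<^sup>2 * R powr (2 - real ?n)"
    using R by (simp add: power_mult_distrib power2_eq_square[of "_ powr _"] powr_add[symmetric])
  finally have "\<delta> \<le> \<epsilon> * ((decay_const ?n)\<^sup>2 * R powr (2 - real ?n)) * R powr (real ?n - 1)"
    unfolding \<delta>_def using e(1) by (intro mult_right_mono mult_left_mono) auto
  also have "\<dots> = (\<epsilon> * (decay_const ?n)\<^sup>2) * (R powr (2 - real ?n) * R powr (real ?n - 1))" by simp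
  also have "R powr (2 - real ?n) * R powr (real ?n - 1) = R" using R by (simp add: powr_add[symmetric])
  also have "\<epsilon> * (decay_const ?n)\<^sup>2 * R \<le> R" using e(2) R by (simp add: mult_left_le_one_le less_imp_le e(1))
  finally have dR: "\<delta> \<le> R" .
  have half: "m / 2 \<le> \<bar>v t\<bar>" if t: "R \<le> t" "t \<le> R + \<delta>" for t
  proof -
    have "(sphere_area DIM('a) * \<bar>v t - v R\<bar>)\<^sup>2 \<le> sphere_area DIM('a) * 2 ^ (?n - 1) * R powr (1 - real ?n) * (t - R)"
      by (rule osc_Hoelder) (use R t dR in auto)
    also have "\<dots> \<le> sphere_area DIM('a) * 2 ^ (?n - 1) * R powr (1 - real ?n) * \<delta>"
      using area_pos t by (intro mult_left_mono) auto
    also have "\<dots> = sphere_area DIM('a) * 2 ^ (?n - 1) * \<epsilon> * m\<^sup>2 * (R powr (1 - real ?n) * R powr (real ?n - 1))"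
      by (simp add: \<delta>_def)
    also have "R powr (1 - real ?n) * R powr (real ?n - 1) = 1" using R by (simp add: powr_add[symmetric])
    also have "sphere_area DIM('a) * 2 ^ (?n - 1) * \<epsilon> * m\<^sup>2 * 1 = sphere_area DIM('a) * m\<^sup>2 * (\<epsilon> * 2 ^ (?n + 1)) / 4"
      by (simp add: k)
    also have "\<dots> \<le> sphere_area DIM('a) * m\<^sup>2 * sphere_area DIM('a) / 4"
      using area_pos e(3) by (intro divide_right_mono mult_left_mono) auto
    also have "\<dots> = (sphere_area DIM('a) * (m / 2))\<^sup>2" by (simp add: power2_eq_square)
    finally have "sphere_area DIM('a) * \<bar>v t - v R\<bar> \<le> sphere_area DIM('a) * (m / 2)"
      by (rule power2_le_imp_le) (use area_pos m in simp)
    then have "\<bar>v t - v R\<bar> \<le> m / 2" using area_pos by simp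
    then show ?thesis unfolding m_def by linarith
  qed
  have "sphere_area DIM('a) * \<epsilon> * 2 powr (- q) * m powr (q + 2) * R powr (2 * real ?n - 2) = (m / 2) powr q * (?u * (real ?n * R ^ k * \<delta>))"
  proof -
    have "R powr (2 * real ?n - 2) = R ^ k * R powr (real ?n - 1)"
      using R k by (simp add: powr_realpow[symmetric] powr_add[symmetric])
    moreover have "m powr (q + 2) = m powr q * m\<^sup>2" using m by (simp add: powr_add)
    moreover have "(m / 2) powr q = m powr q * 2 powr (- q)" using m by (simp add: powr_divide powr_minus_divide)
    ultimately show ?thesis by (simp add: \<delta>_def sphere_area_def)
  qed
  also have "\<dots> \<le> (m / 2) powr q * (?u * ((R + \<delta>) ^ ?n - R ^ ?n))"
    using power_diff_bounds(2)[of R "R + \<delta>" k] R d0 by (intro mult_left_mono) (auto simp: k)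
  finally have "ennreal (sphere_area DIM('a) * \<epsilon> * 2 powr (- q) * m powr (q + 2) * R powr (2 * real ?n - 2)) \<le> ennreal ((m / 2) powr q * (?u * ((R + \<delta>) ^ ?n - R ^ ?n)))"
    by (rule ennreal_leI)
  also have "\<dots> = (\<integral>\<^sup>+x. ennreal ((m / 2) powr q) * indicator (shell R (R + \<delta>)) x \<partial>(lborel :: 'a measure))"
    using R d0 by (simp add: nn_integral_cmult_indicator emeasure_shell ennreal_mult power_mono)
  also have "\<dots> \<le> radial_mass TYPE('a) v q (shell R (2 * R))"
    using half m q dR by (intro nn_integral_mono) (auto split: split_indicator intro!: ennreal_leI powr_mono2)
  finally show ?thesis by (simp add: m_def \<epsilon>_def)
qed

end

text \<open>The product of K2 and K3 in the proof of \<open>radial_Sobolev\<close>, written out so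
  that one number serves all profiles.\<close>

definition sobolev_const :: "nat \<Rightarrow> real" where
  "sobolev_const n = (let \<kappa> = (real n - 2) / 2; p = 2 * real n - 2 - \<kappa> in
     decay_const n powr (4 / (real n - 2)) * (power_const n p / (1 - 2 powr (real n - p))) / (sphere_area n)\<^sup>2
     * (power_const n (real n - \<kappa>) * 2 powr (- \<kappa>) / (1 - 2 powr (- \<kappa>))))"

lemma tendsto_powr_neg_at_top: "c > (0::real) \<Longrightarrow> ((\<lambda>t. t powr (- c)) \<longlongrightarrow> 0) at_top"
  by (rule tendsto_neg_powr) (auto simp: filterlim_ident)

context radial_profile
begin

text \<open>The modulus of continuity depends on the interval [a, 2a] alone and not on the profile,
  which is what the selection of a convergent subsequence requires.\<close>

lemma equicontinuity:
  assumes "0 < a" "s \<in> {a..2 * a}" "t \<in> {a..2 * a}"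
  shows "\<bar>v t - v s\<bar> \<le> sqrt (sphere_area DIM('a) * 2 ^ (DIM('a) - 1) * a powr (1 - real DIM('a)) * \<bar>t - s\<bar>) / sphere_area DIM('a)"
proof -
  let ?n = "DIM('a)" and ?w = "sphere_area DIM('a)"
  have *: "\<bar>v t - v s\<bar> \<le> sqrt (?w * 2 ^ (?n - 1) * a powr (1 - real ?n) * \<bar>t - s\<bar>) / ?w"
    if st: "s \<in> {a..2 * a}" "t \<in> {a..2 * a}" "s \<le> t" for s t
  proof -
    have "(?w * \<bar>v t - v s\<bar>)\<^sup>2 \<le> ?w * 2 ^ (?n - 1) * s powr (1 - real ?n) * (t - s)"
      by (rule osc_Hoelder) (use assms(1) st in auto)
    also have "\<dots> \<le> ?w * 2 ^ (?n - 1) * a powr (1 - real ?n) * (t - s)"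
      using st assms(1) n3 area_pos by (intro mult_right_mono mult_left_mono powr_mono2') auto
    finally have "?w * \<bar>v t - v s\<bar> \<le> sqrt (?w * 2 ^ (?n - 1) * a powr (1 - real ?n) * \<bar>t - s\<bar>)"
      using st by (intro real_le_rsqrt) simp
    then show ?thesis using area_pos by (simp add: field_simps)
  qed
  show ?thesis
  proof (cases "s \<le> t")
    case True
    then show ?thesis using * assms by blast
  next
    case False
    then show ?thesis using *[of t s] assms by (simp add: abs_minus_commute)
  qed
qed

lemma v_isCont:
  assumes "0 < t" shows "isCont v t"
proof -
  let ?w = "sphere_area DIM('a)"
  define a where "a = 2 * t / 3"
  define K where "K = ?w * 2 ^ (DIM('a) - 1) * a powr (1 - real DIM('a))"
  have a: "0 < a" "a < t" "t < 2 * a" using assms by (auto simp: a_def)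
  have "((\<lambda>s. v s - v t) \<longlongrightarrow> 0) (at t)"
  proof (rule Lim_null_comparison)
    have "\<forall>\<^sub>F s in at t. s \<in> {a<..<2 * a}"
      using a by (intro eventually_at_in_open') auto
    then show "\<forall>\<^sub>F s in at t. norm (v s - v t) \<le> sqrt (K * \<bar>s - t\<bar>) / ?w"
    proof eventually_elim
      case (elim s)
      then show ?case unfolding K_def using equicontinuity[OF a(1), of t s] a by simp
    qed
    have "((\<lambda>s. sqrt (K * \<bar>s - t\<bar>) / ?w) \<longlongrightarrow> sqrt (K * \<bar>t - t\<bar>) / ?w) (at t)"
      using area_pos by (intro tendsto_intros) auto
    then show "((\<lambda>s. sqrt (K * \<bar>s - t\<bar>) / ?w) \<longlongrightarrow> 0) (at t)" by simp
  qed
  then show ?thesis unfolding isCont_def using Lim_null by blast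
qed

lemma v_meas [measurable]: "v \<in> borel_measurable borel"
proof -
  have "(\<lambda>t. indicator {0<..} t *\<^sub>R v t) \<in> borel_measurable borel"
    using v_isCont by (intro borel_measurable_continuous_on_indicator continuous_at_imp_continuous_on) auto
  moreover have "indicator {0<..} t *\<^sub>R v t = v t" for t using v_nonpos[of t] by (auto split: split_indicator)
  ultimately show ?thesis by (simp only:)
qed

lemma decay_powr:
  assumes "0 < t" "0 \<le> p"
  shows "\<bar>v t\<bar> powr p \<le> decay_const DIM('a) powr p * t powr (- (p * (real DIM('a) - 2) / 2))"
proof -
  have "\<bar>v t\<bar> powr p \<le> (decay_const DIM('a) * t powr (- ((real DIM('a) - 2) / 2))) powr p"
    using decay[OF assms(1)] assms(2) by (intro powr_mono2) auto
  also have "\<dots> = decay_const DIM('a) powr p * t powr (- (p * (real DIM('a) - 2) / 2))"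
    using decay_const_pos[OF dim] by (simp add: powr_mult powr_powr mult.commute)
  finally show ?thesis .
qed

text \<open>The decay bounds |v|^p by a multiple of |x|^(-p(n-2)/2), and the condition on p says
  that p is below the critical exponent. This settles the origin in the subcritical case, as
  \<open>nn_integral_outer_power\<close> settles infinity in the supercritical one.\<close>

lemma nn_integral_inner_power:
  assumes R: "0 < R" and p: "0 \<le> p" "p * (real DIM('a) - 2) / 2 < real DIM('a)"
  shows "radial_mass TYPE('a) v p (shell 0 (2 * R))
    \<le> ennreal (decay_const DIM('a) powr p * (power_const DIM('a) (p * (real DIM('a) - 2) / 2) *
        R powr (real DIM('a) - p * (real DIM('a) - 2) / 2) / (1 - 2 powr (p * (real DIM('a) - 2) / 2 - real DIM('a)))))"
    (is "_ \<le> ennreal (_ * ?K)")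
proof -
  let ?n = "DIM('a)" and ?D = "decay_const DIM('a)"
  note v = decay_powr[OF _ p(1)]
  have "radial_mass TYPE('a) v p (shell 0 (2 * R))
     \<le> (\<integral>\<^sup>+x. ennreal (?D powr p) * (ennreal (norm x powr (- (p * (real ?n - 2) / 2))) * indicator (shell 0 (2 * R)) x) \<partial>(lborel :: 'a measure))"
    using v by (intro nn_integral_mono) (auto simp: ennreal_mult[symmetric] split: split_indicator intro!: ennreal_leI)
  also have "\<dots> = ennreal (?D powr p) * (\<integral>\<^sup>+x. ennreal (norm x powr (- (p * (real ?n - 2) / 2))) * indicator (shell 0 (2 * R)) x \<partial>(lborel :: 'a measure))"
    by (rule nn_integral_cmult) measurable
  also have "\<dots> \<le> ennreal (?D powr p) * ennreal ?K"
    by (intro mult_left_mono nn_integral_power_inner R p) simp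
  finally show ?thesis by (simp only: ennreal_mult'[OF powr_ge_zero])
qed

lemma nn_integral_outer_power:
  assumes R: "0 < R" and p: "0 \<le> p" "p * (real DIM('a) - 2) / 2 > real DIM('a)"
  shows "radial_mass TYPE('a) v p {x. R < norm x}
    \<le> ennreal (decay_const DIM('a) powr p * (power_const DIM('a) (p * (real DIM('a) - 2) / 2) *
        R powr (real DIM('a) - p * (real DIM('a) - 2) / 2) / (1 - 2 powr (real DIM('a) - p * (real DIM('a) - 2) / 2))))"
    (is "_ \<le> ennreal (_ * ?K)")
proof -
  let ?n = "DIM('a)" and ?D = "decay_const DIM('a)"
  note v = decay_powr[OF _ p(1)]
  have "radial_mass TYPE('a) v p {x. R < norm x}
     \<le> (\<integral>\<^sup>+x. ennreal (?D powr p) * (ennreal (norm x powr (- (p * (real ?n - 2) / 2))) * indicator {x. R < norm x} x) \<partial>(lborel :: 'a measure))"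
    using v[OF less_trans[OF R]] by (intro nn_integral_mono) (auto simp: ennreal_mult[symmetric] split: split_indicator intro!: ennreal_leI)
  also have "\<dots> = ennreal (?D powr p) * (\<integral>\<^sup>+x. ennreal (norm x powr (- (p * (real ?n - 2) / 2))) * indicator {x. R < norm x} x \<partial>(lborel :: 'a measure))"
    by (rule nn_integral_cmult) measurable
  also have "\<dots> \<le> ennreal (?D powr p) * ennreal ?K"
    by (intro mult_left_mono nn_integral_power_outer R p) simp
  finally show ?thesis by (simp only: ennreal_mult'[OF powr_ge_zero])
qed

text \<open>The radial Hardy inequality by a Schur test with weight \<open>\<bar>x\<bar>\<^sup>\<kappa>\<close>, \<open>\<kappa> = (n - 2) / 2\<close>; the remaining
  power of \<open>v\<close> is absorbed by the pointwise decay.\<close>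

lemma radial_Sobolev:
  "(\<integral>\<^sup>+x. ennreal (\<bar>v (norm x)\<bar> powr sobolev_exp DIM('a)) \<partial>(lborel :: 'a measure)) \<le> ennreal (sobolev_const DIM('a))"
proof -
  let ?n = "DIM('a)" and ?w = "sphere_area DIM('a)" and ?D = "decay_const DIM('a)"
  define \<kappa> where "\<kappa> = (real ?n - 2) / 2"
  define p where "p = 2 * real ?n - 2 - \<kappa>"
  have k: "\<kappa> > 0" "p > real ?n" "real ?n - p = \<kappa> - (real ?n - 2)" using n3 by (auto simp: \<kappa>_def p_def field_simps)
  define K1 where "K1 = power_const ?n p / (1 - 2 powr (real ?n - p))"
  have K1: "K1 > 0" using power_const_pos[of ?n p] two_powr_neg_less_1[of "p - real ?n"] k(2) by (simp add: K1_def)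
  define K3 where "K3 = power_const ?n (real ?n - \<kappa>) * 2 powr (- \<kappa>) / (1 - 2 powr (- \<kappa>))"
  have K3: "K3 > 0" using power_const_pos[of ?n "real ?n - \<kappa>"] two_powr_neg_less_1[OF k(1)] by (simp add: K3_def)
  define K2 where "K2 = ?D powr (4 / (real ?n - 2)) * K1 / ?w\<^sup>2"
  have K2: "K2 > 0" using decay_const_pos[OF dim] area_pos K1 by (simp add: K2_def)
  define \<Gamma> where "\<Gamma> s = (\<integral>\<^sup>+x. ennreal ((g x)\<^sup>2 * norm x powr (- \<kappa>)) * indicator {x. s < norm x} x \<partial>lborel)" for s
  \<comment> \<open>Since v tends to 0, letting t grow in \<open>osc\<close> bounds v(s) itself by
    an integral over the whole exterior.\<close>
  have tail: "ennreal (?w * \<bar>v s\<bar>) \<le> (\<integral>\<^sup>+x. ennreal (g x * norm x powr (1 - real ?n)) * indicator {x. s < norm x} x \<partial>lborel)"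
    if s: "0 < s" for s
  proof (rule ennreal_le_epsilon)
    fix e :: real assume e: "0 < e"
    have "((\<lambda>t. ?w * (?D * t powr (- ((real ?n - 2) / 2)))) \<longlongrightarrow> ?w * (?D * 0)) at_top"
      by (intro tendsto_mult tendsto_const tendsto_powr_neg_at_top) (use n3 in simp)
    then have "\<forall>\<^sub>F t in at_top. ?w * (?D * t powr (- ((real ?n - 2) / 2))) < e"
      using e by (intro order_tendstoD) auto
    moreover have "\<forall>\<^sub>F t in at_top. s \<le> t" by (rule eventually_ge_at_top)
    ultimately have "\<forall>\<^sub>F t in at_top. s \<le> t \<and> ?w * (?D * t powr (- ((real ?n - 2) / 2))) < e"
      by eventually_elim simp
    then obtain t where t: "s \<le> t" "?w * (?D * t powr (- ((real ?n - 2) / 2))) < e"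
      by (auto simp: eventually_at_top_linorder)
    have "?w * \<bar>v t\<bar> \<le> ?w * (?D * t powr (- ((real ?n - 2) / 2)))"
      using decay[of t] s t(1) area_pos by (intro mult_left_mono) auto
    then have vt: "?w * \<bar>v t\<bar> \<le> e" using t(2) by linarith
    have "\<bar>v s\<bar> \<le> \<bar>v t - v s\<bar> + \<bar>v t\<bar>" by linarith
    then have "?w * \<bar>v s\<bar> \<le> ?w * \<bar>v t - v s\<bar> + ?w * \<bar>v t\<bar>"
      using area_pos by (simp add: distrib_left[symmetric])
    then have "?w * \<bar>v s\<bar> \<le> ?w * \<bar>v t - v s\<bar> + e" using vt by linarith
    then have "ennreal (?w * \<bar>v s\<bar>) \<le> ennreal (?w * \<bar>v t - v s\<bar> + e)" by (rule ennreal_leI)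
    also have "\<dots> = ennreal (?w * \<bar>v t - v s\<bar>) + ennreal e" using area_pos e by (intro ennreal_plus) auto
    also have "\<dots> \<le> (\<integral>\<^sup>+x. ennreal (g x * norm x powr (1 - real ?n)) * indicator (shell s t) x \<partial>lborel) + ennreal e"
      by (intro add_right_mono osc s t)
    also have "\<dots> \<le> (\<integral>\<^sup>+x. ennreal (g x * norm x powr (1 - real ?n)) * indicator {x. s < norm x} x \<partial>lborel) + ennreal e"
      by (intro add_right_mono nn_integral_mono) (auto split: split_indicator)
    finally show "ennreal (?w * \<bar>v s\<bar>) \<le> (\<integral>\<^sup>+x. ennreal (g x * norm x powr (1 - real ?n)) * indicator {x. s < norm x} x \<partial>lborel) + ennreal e" .
  qed
  have v2: "ennreal ((?w * \<bar>v s\<bar>)\<^sup>2) \<le> \<Gamma> s * ennreal (K1 * s powr (\<kappa> - (real ?n - 2)))" if s: "0 < s" for s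
  proof -
    have "ennreal ((?w * \<bar>v s\<bar>)\<^sup>2) = (ennreal (?w * \<bar>v s\<bar>))\<^sup>2" using area_pos by (simp add: ennreal_power)
    also have "\<dots> \<le> (\<integral>\<^sup>+x. ennreal (g x * norm x powr (1 - real ?n)) * indicator {x. s < norm x} x \<partial>lborel)\<^sup>2"
      by (intro power_mono tail s) simp
    also have "\<dots> \<le> \<Gamma> s * (\<integral>\<^sup>+x. ennreal (norm x powr (- (2 * real ?n - 2 - \<kappa>))) * indicator {x. s < norm x} x \<partial>(lborel :: 'a measure))"
      unfolding \<Gamma>_def by (rule weighted_Cauchy_Schwarz) simp
    also have "\<dots> \<le> \<Gamma> s * ennreal (K1 * s powr (\<kappa> - (real ?n - 2)))"
    proof (rule mult_left_mono)
      show "(\<integral>\<^sup>+x. ennreal (norm x powr (- (2 * real ?n - 2 - \<kappa>))) * indicator {x. s < norm x} x \<partial>(lborel :: 'a measure))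
         \<le> ennreal (K1 * s powr (\<kappa> - (real ?n - 2)))"
        using nn_integral_power_outer[where 'a = 'a, OF s k(2)] unfolding p_def[symmetric] K1_def k(3)[symmetric] by simp
    qed simp
    finally show ?thesis .
  qed
  have vp: "ennreal (\<bar>v s\<bar> powr sobolev_exp ?n) \<le> ennreal (K2 * s powr (\<kappa> - real ?n)) * \<Gamma> s" if s: "0 < s" for s
  proof -
    \<comment> \<open>The exponent splits as 4/(n-2) + 2: the decay turns the first part into
      s^(-2), leaving v^2 with the Hardy weight.\<close>
    have se: "sobolev_exp ?n = 4 / (real ?n - 2) + 2" using n3 by (simp add: sobolev_exp_def field_simps)
    have "\<bar>v s\<bar> powr (4 / (real ?n - 2)) \<le> (?D * s powr (- ((real ?n - 2) / 2))) powr (4 / (real ?n - 2))"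
      using decay[OF s] n3 by (intro powr_mono2) auto
    also have "\<dots> = ?D powr (4 / (real ?n - 2)) * s powr (- ((real ?n - 2) / 2) * (4 / (real ?n - 2)))"
      using decay_const_pos[OF dim] by (simp add: powr_mult powr_powr)
    also have "- ((real ?n - 2) / 2) * (4 / (real ?n - 2)) = - 2" using n3 by (simp add: field_simps)
    finally have a: "\<bar>v s\<bar> powr (4 / (real ?n - 2)) \<le> ?D powr (4 / (real ?n - 2)) * s powr (- 2)" .
    have "\<bar>v s\<bar> powr sobolev_exp ?n = \<bar>v s\<bar> powr (4 / (real ?n - 2)) * \<bar>v s\<bar>\<^sup>2"
      unfolding se by (cases "v s = 0") (auto simp: powr_add)
    also have "\<dots> \<le> (?D powr (4 / (real ?n - 2)) * s powr (- 2)) * \<bar>v s\<bar>\<^sup>2"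
      by (intro mult_right_mono a) simp
    also have "\<dots> = (?D powr (4 / (real ?n - 2)) / ?w\<^sup>2 * s powr (- 2)) * (?w * \<bar>v s\<bar>)\<^sup>2"
      using area_pos by (simp add: power_mult_distrib)
    finally have "ennreal (\<bar>v s\<bar> powr sobolev_exp ?n) \<le> ennreal (?D powr (4 / (real ?n - 2)) / ?w\<^sup>2 * s powr (- 2)) * ennreal ((?w * \<bar>v s\<bar>)\<^sup>2)"
      by (subst ennreal_mult[symmetric]) (auto intro!: ennreal_leI)
    also have "\<dots> \<le> ennreal (?D powr (4 / (real ?n - 2)) / ?w\<^sup>2 * s powr (- 2)) * (\<Gamma> s * ennreal (K1 * s powr (\<kappa> - (real ?n - 2))))"
      by (intro mult_left_mono v2 s) simp
    also have "\<dots> = (ennreal (?D powr (4 / (real ?n - 2)) / ?w\<^sup>2 * s powr (- 2)) * ennreal (K1 * s powr (\<kappa> - (real ?n - 2)))) * \<Gamma> s"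
      by (simp add: mult_ac)
    also have "ennreal (?D powr (4 / (real ?n - 2)) / ?w\<^sup>2 * s powr (- 2)) * ennreal (K1 * s powr (\<kappa> - (real ?n - 2))) = ennreal (K2 * s powr (\<kappa> - real ?n))"
    proof -
      have "s powr (- 2) * s powr (\<kappa> - (real ?n - 2)) = s powr (\<kappa> - real ?n)" by (simp add: powr_add[symmetric])
      then show ?thesis using K1 by (subst ennreal_mult[symmetric]) (auto simp: K2_def algebra_simps)
    qed
    finally show ?thesis .
  qed
  have inner: "(\<integral>\<^sup>+y. ennreal (norm y powr (\<kappa> - real ?n)) * indicator {y. 0 < norm y \<and> norm y < norm x} y \<partial>(lborel :: 'a measure))
      \<le> ennreal (K3 * norm x powr \<kappa>)" if x: "x \<noteq> 0" for x :: 'a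
  proof -
    have "(\<integral>\<^sup>+y. ennreal (norm y powr (\<kappa> - real ?n)) * indicator {y. 0 < norm y \<and> norm y < norm x} y \<partial>(lborel :: 'a measure))
       \<le> (\<integral>\<^sup>+y. ennreal (norm y powr (- (real ?n - \<kappa>))) * indicator (shell 0 (2 * (norm x / 2))) y \<partial>(lborel :: 'a measure))"
      by (intro nn_integral_mono) (auto split: split_indicator)
    also have "\<dots> \<le> ennreal (power_const ?n (real ?n - \<kappa>) * (norm x / 2) powr (real ?n - (real ?n - \<kappa>)) / (1 - 2 powr (real ?n - \<kappa> - real ?n)))"
      by (rule nn_integral_power_inner) (use x k in auto)
    also have "\<dots> = ennreal (K3 * norm x powr \<kappa>)"
      by (simp add: K3_def powr_divide powr_minus_divide)
    finally show ?thesis .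
  qed
  let ?F = "\<lambda>x y :: 'a. ennreal K2 * (ennreal (norm y powr (\<kappa> - real ?n)) * (ennreal ((g x)\<^sup>2 * norm x powr (- \<kappa>)) * indicator {y. 0 < norm y \<and> norm y < norm x} y))"
  have "(\<integral>\<^sup>+y. ennreal (\<bar>v (norm y)\<bar> powr sobolev_exp ?n) \<partial>(lborel :: 'a measure))
     \<le> (\<integral>\<^sup>+y. (\<integral>\<^sup>+x. ?F x y \<partial>lborel) \<partial>(lborel :: 'a measure))"
  proof (rule nn_integral_mono_AE)
    show "AE y in (lborel :: 'a measure). ennreal (\<bar>v (norm y)\<bar> powr sobolev_exp ?n) \<le> (\<integral>\<^sup>+x. ?F x y \<partial>lborel)"
      using AE_lborel_singleton[of "0::'a"]
    proof eventually_elim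
      case (elim y)
      have "ennreal (\<bar>v (norm y)\<bar> powr sobolev_exp ?n) \<le> ennreal (K2 * norm y powr (\<kappa> - real ?n)) * \<Gamma> (norm y)"
        using vp[of "norm y"] elim by simp
      also have "\<dots> = (\<integral>\<^sup>+x. ennreal (K2 * norm y powr (\<kappa> - real ?n)) * (ennreal ((g x)\<^sup>2 * norm x powr (- \<kappa>)) * indicator {x. norm y < norm x} x) \<partial>lborel)"
        unfolding \<Gamma>_def by (rule nn_integral_cmult[symmetric]) measurable
      also have "\<dots> = (\<integral>\<^sup>+x. ?F x y \<partial>lborel)"
        using K2 elim by (intro nn_integral_cong) (auto simp: ennreal_mult mult.assoc split: split_indicator)
      finally show ?case .
    qed
  qed
  \<comment> \<open>After the exchange, |y|^(\<kappa>-n) is integrated over the ball |y| < |x| and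
    gives a multiple of |x|^\<kappa>, cancelling the weight that accompanies g.\<close>
  also have "\<dots> = (\<integral>\<^sup>+x. (\<integral>\<^sup>+y. ?F x y \<partial>(lborel :: 'a measure)) \<partial>lborel)"
  proof (rule lborel_pair.Fubini')
    have "{z \<in> space (lborel \<Otimes>\<^sub>M lborel). 0 < norm (snd z :: 'a) \<and> norm (snd z) < norm (fst z :: 'a)} \<in> sets (lborel \<Otimes>\<^sub>M lborel)" by measurable
    then have [measurable]: "indicator {z. 0 < norm (snd z :: 'a) \<and> norm (snd z) < norm (fst z :: 'a)} \<in> borel_measurable (lborel \<Otimes>\<^sub>M lborel)"
      by (intro borel_measurable_indicator) (simp add: space_pair_measure)
    have "(\<lambda>z. ennreal K2 * (ennreal (norm (snd z) powr (\<kappa> - real ?n)) * (ennreal ((g (fst z))\<^sup>2 * norm (fst z) powr (- \<kappa>)) *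
        indicator {z. 0 < norm (snd z :: 'a) \<and> norm (snd z) < norm (fst z :: 'a)} z))) \<in> borel_measurable (lborel \<Otimes>\<^sub>M lborel)"
      by measurable
    then show "(\<lambda>(x, y). ennreal K2 * (ennreal (norm y powr (\<kappa> - real ?n)) * (ennreal ((g x)\<^sup>2 * norm x powr (- \<kappa>)) * indicator {y. 0 < norm y \<and> norm y < norm x} (y::'a)))) \<in> borel_measurable (lborel \<Otimes>\<^sub>M lborel)"
      by (simp add: case_prod_beta indicator_def)
  qed
  also have "\<dots> \<le> (\<integral>\<^sup>+x. ennreal (K2 * K3) * ennreal ((g x)\<^sup>2) \<partial>lborel)"
  proof (rule nn_integral_mono)
    fix x :: 'a
    show "(\<integral>\<^sup>+y. ?F x y \<partial>(lborel :: 'a measure))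
       \<le> ennreal (K2 * K3) * ennreal ((g x)\<^sup>2)"
    proof (cases "x = 0")
      case False
      have "(\<integral>\<^sup>+y. ?F x y \<partial>(lborel :: 'a measure))
         = (\<integral>\<^sup>+y. (ennreal K2 * ennreal ((g x)\<^sup>2 * norm x powr (- \<kappa>))) * (ennreal (norm y powr (\<kappa> - real ?n)) * indicator {y. 0 < norm y \<and> norm y < norm x} y) \<partial>(lborel :: 'a measure))"
        by (intro nn_integral_cong) (simp add: mult_ac)
      also have "\<dots> = (ennreal K2 * ennreal ((g x)\<^sup>2 * norm x powr (- \<kappa>))) * (\<integral>\<^sup>+y. ennreal (norm y powr (\<kappa> - real ?n)) * indicator {y. 0 < norm y \<and> norm y < norm x} y \<partial>(lborel :: 'a measure))"
        by (rule nn_integral_cmult) measurable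
      also have "\<dots> \<le> (ennreal K2 * ennreal ((g x)\<^sup>2 * norm x powr (- \<kappa>))) * ennreal (K3 * norm x powr \<kappa>)"
        by (intro mult_left_mono inner False) simp
      also have "\<dots> = ennreal (K2 * ((g x)\<^sup>2 * norm x powr (- \<kappa>)) * (K3 * norm x powr \<kappa>))"
        using K2 K3 by (simp add: ennreal_mult[symmetric])
      also have "K2 * ((g x)\<^sup>2 * norm x powr (- \<kappa>)) * (K3 * norm x powr \<kappa>) = K2 * K3 * (g x)\<^sup>2 * (norm x powr (- \<kappa>) * norm x powr \<kappa>)"
        by (simp add: mult_ac)
      also have "norm x powr (- \<kappa>) * norm x powr \<kappa> = 1" using False by (simp add: powr_add[symmetric])
      finally show ?thesis using K2 K3 by (simp add: ennreal_mult[symmetric])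
    qed simp
  qed
  also have "\<dots> = ennreal (K2 * K3) * (\<integral>\<^sup>+x. ennreal ((g x)\<^sup>2) \<partial>lborel)"
    by (rule nn_integral_cmult) measurable
  also have "\<dots> \<le> ennreal (K2 * K3) * 1" by (intro mult_left_mono g_L2) simp
  finally show ?thesis by (simp add: sobolev_const_def Let_def K2_def K1_def K3_def p_def \<kappa>_def)
qed

lemma pointwise_bound:
  assumes q: "1 \<le> q" and CJ: "0 \<le> CJ" and R: "0 < R"
    and J: "radial_mass TYPE('a) v q (shell R (2 * R)) \<le> ennreal (CJ * R powr \<theta>)"
  shows "\<bar>v R\<bar> \<le> (2 powr q * CJ / (sphere_area DIM('a) * length_const DIM('a)) * R powr (- (2 * real DIM('a) - 2 - \<theta>))) powr (1 / (q + 2))"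
proof -
  define c where "c = sphere_area DIM('a) * length_const DIM('a)"
  let ?d = "2 * real DIM('a) - 2"
  have c: "c > 0" using area_pos length_const_pos[OF dim] by (simp add: c_def)
  have "ennreal (c * 2 powr (- q) * \<bar>v R\<bar> powr (q + 2) * R powr ?d) \<le> ennreal (CJ * R powr \<theta>)"
    unfolding c_def by (rule order_trans[OF local_mass_lower_bound[OF R q] J])
  then have "c * 2 powr (- q) * \<bar>v R\<bar> powr (q + 2) * R powr ?d \<le> CJ * R powr \<theta>"
    by (rule ennreal_le_iff[THEN iffD1, rotated]) (use CJ in simp)
  then have A: "(c * 2 powr (- q) * \<bar>v R\<bar> powr (q + 2) * R powr ?d) * (2 powr q / c * R powr (- ?d)) \<le> (CJ * R powr \<theta>) * (2 powr q / c * R powr (- ?d))"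
    using c by (intro mult_right_mono) auto
  have B: "(c * 2 powr (- q) * \<bar>v R\<bar> powr (q + 2) * R powr ?d) * (2 powr q / c * R powr (- ?d))
     = \<bar>v R\<bar> powr (q + 2) * (2 powr (- q) * 2 powr q) * (R powr ?d * R powr (- ?d))"
    using c by (simp add: field_simps)
  have C: "2 powr (- q) * 2 powr q = 1" "R powr ?d * R powr (- ?d) = 1"
    using R by (simp_all add: powr_add[symmetric])
  have D: "(CJ * R powr \<theta>) * (2 powr q / c * R powr (- ?d)) = 2 powr q * CJ / c * R powr (- (?d - \<theta>))"
  proof -
    have "R powr \<theta> * R powr (- ?d) = R powr (- (?d - \<theta>))" by (simp add: powr_add[symmetric] algebra_simps)
    then show ?thesis by (simp add: algebra_simps)
  qed
  have "\<bar>v R\<bar> powr (q + 2) \<le> 2 powr q * CJ / c * R powr (- (?d - \<theta>))"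
    using A unfolding B C D by (simp only: mult_1_right)
  then have "(\<bar>v R\<bar> powr (q + 2)) powr (1 / (q + 2)) \<le> (2 powr q * CJ / c * R powr (- (?d - \<theta>))) powr (1 / (q + 2))"
    using q by (intro powr_mono2) auto
  moreover have "(\<bar>v R\<bar> powr (q + 2)) powr (1 / (q + 2)) = \<bar>v R\<bar>" using q by (simp add: powr_powr)
  ultimately show ?thesis by (simp add: c_def)
qed

text \<open>In |v|^r = |v|^(r-q) |v|^q the first factor is estimated by
  \<open>pointwise_bound\<close>, the second is integrated. \<theta> \<le> 2n-2 makes the pointwise
  bound largest at the inner radius, and L \<ge> 1 absorbs the constant, whose power (r-q)/(q+2)
  lies between 0 and r, in the form L^r without q.\<close>

lemma nn_integral_shell_power:
  assumes q: "1 \<le> q" "q \<le> r" and CJ: "0 \<le> CJ" and R: "0 < R" and \<theta>: "\<theta> \<le> 2 * real DIM('a) - 2"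
    and J: "\<And>S. 0 < S \<Longrightarrow> radial_mass TYPE('a) v q (shell S (2 * S)) \<le> ennreal (CJ * S powr \<theta>)"
    and L: "1 \<le> L" "2 powr q * CJ / (sphere_area DIM('a) * length_const DIM('a)) \<le> L"
  shows "radial_mass TYPE('a) v r (shell R (2 * R))
     \<le> ennreal (L powr r * CJ * R powr (- ((2 * real DIM('a) - 2 - \<theta>) * (r - q) / (q + 2) - \<theta>)))"
proof -
  let ?\<sigma> = "2 * real DIM('a) - 2 - \<theta>"
  define e where "e = (r - q) / (q + 2)"
  have e: "0 \<le> e" "e \<le> r"
  proof -
    show "0 \<le> e" using q by (simp add: e_def)
    have "e \<le> (r - q) / 1" unfolding e_def using q by (intro divide_left_mono) auto
    then show "e \<le> r" using q by simp
  qed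
  have c: "sphere_area DIM('a) * length_const DIM('a) > 0" using area_pos length_const_pos[OF dim] by simp
  have vt: "\<bar>v t\<bar> powr r \<le> L powr r * R powr (- (?\<sigma> * e)) * \<bar>v t\<bar> powr q" if t: "R < t" for t
  proof -
    have "\<bar>v t\<bar> \<le> (2 powr q * CJ / (sphere_area DIM('a) * length_const DIM('a)) * t powr (- ?\<sigma>)) powr (1 / (q + 2))"
      by (rule pointwise_bound[OF q(1) CJ _ J]) (use R t in auto)
    also have "\<dots> \<le> (L * R powr (- ?\<sigma>)) powr (1 / (q + 2))"
      using q L CJ c t R \<theta> by (intro powr_mono2 mult_mono powr_mono2') auto
    finally have "\<bar>v t\<bar> powr (r - q) \<le> ((L * R powr (- ?\<sigma>)) powr (1 / (q + 2))) powr (r - q)"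
      using q by (intro powr_mono2) auto
    also have "\<dots> = L powr e * R powr (- (?\<sigma> * e))"
    proof -
      have "((L * R powr (- ?\<sigma>)) powr (1 / (q + 2))) powr (r - q) = (L * R powr (- ?\<sigma>)) powr e"
        by (simp add: powr_powr e_def)
      also have "\<dots> = L powr e * R powr (- ?\<sigma> * e)" using L by (simp only: powr_mult powr_powr)
      finally show ?thesis by (simp only: mult_minus_left)
    qed
    also have "\<dots> \<le> L powr r * R powr (- (?\<sigma> * e))"
      using L e by (intro mult_right_mono powr_mono) auto
    finally have "\<bar>v t\<bar> powr (r - q) * \<bar>v t\<bar> powr q \<le> L powr r * R powr (- (?\<sigma> * e)) * \<bar>v t\<bar> powr q"
      by (rule mult_right_mono) simp
    moreover have "\<bar>v t\<bar> powr (r - q) * \<bar>v t\<bar> powr q = \<bar>v t\<bar> powr r" by (simp add: powr_add[symmetric])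
    ultimately show ?thesis by simp
  qed
  have "radial_mass TYPE('a) v r (shell R (2 * R))
    \<le> (\<integral>\<^sup>+x. ennreal (L powr r * R powr (- (?\<sigma> * e))) * (ennreal (\<bar>v (norm x)\<bar> powr q) * indicator (shell R (2 * R)) x) \<partial>(lborel :: 'a measure))"
    using vt by (intro nn_integral_mono) (auto simp: ennreal_mult[symmetric] split: split_indicator intro!: ennreal_leI)
  also have "\<dots> = ennreal (L powr r * R powr (- (?\<sigma> * e))) * radial_mass TYPE('a) v q (shell R (2 * R))"
    by (rule nn_integral_cmult) measurable
  also have "\<dots> \<le> ennreal (L powr r * R powr (- (?\<sigma> * e))) * ennreal (CJ * R powr \<theta>)"
    by (intro mult_left_mono J R) simp
  also have "\<dots> = ennreal ((L powr r * R powr (- (?\<sigma> * e))) * (CJ * R powr \<theta>))"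
    using CJ by (intro ennreal_mult[symmetric]) auto
  also have "(L powr r * R powr (- (?\<sigma> * e))) * (CJ * R powr \<theta>) = L powr r * CJ * (R powr (- (?\<sigma> * e)) * R powr \<theta>)" by simp
  also have "R powr (- (?\<sigma> * e)) * R powr \<theta> = R powr (- (?\<sigma> * (r - q) / (q + 2) - \<theta>))"
    by (simp add: powr_add[symmetric] e_def)
  finally show ?thesis .
qed

end

subsection \<open>The Coulomb modular\<close>

text \<open>Measurability of the integrand is not required, so that no joint measurability of the Riesz
  potentials has to be established.\<close>

lemma nn_integral_cmult_le:
  assumes c: "0 < c"
  shows "(\<integral>\<^sup>+x. ennreal c * f x \<partial>M) \<le> ennreal c * (\<integral>\<^sup>+x. f x \<partial>M)"
  unfolding nn_integral_def[of M "\<lambda>x. ennreal c * f x"]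
proof (rule SUP_least)
  fix h assume "h \<in> {h. simple_function M h \<and> h \<le> (\<lambda>x. ennreal c * f x)}"
  then have h: "simple_function M h" "\<And>x. h x \<le> ennreal c * f x" by (auto simp: le_fun_def)
  have cc: "ennreal (1 / c) * (ennreal c * y) = y" for y
    using c by (simp add: mult.assoc[symmetric] ennreal_mult[symmetric])
  have cc': "ennreal c * (ennreal (1 / c) * y) = y" for y
    using c by (simp add: mult.assoc[symmetric] ennreal_mult[symmetric])
  have hm: "h \<in> borel_measurable M" using h(1) by (rule borel_measurable_simple_function)
  have "integral\<^sup>S M h = (\<integral>\<^sup>+x. ennreal c * (ennreal (1 / c) * h x) \<partial>M)"
    using nn_integral_eq_simple_integral[OF h(1)] by (simp add: cc')
  also have "\<dots> = ennreal c * (\<integral>\<^sup>+x. ennreal (1 / c) * h x \<partial>M)"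
    by (rule nn_integral_cmult) (use hm in measurable)
  also have "\<dots> \<le> ennreal c * (\<integral>\<^sup>+x. f x \<partial>M)"
  proof (intro mult_left_mono nn_integral_mono)
    fix x
    have "ennreal (1 / c) * h x \<le> ennreal (1 / c) * (ennreal c * f x)" by (intro mult_left_mono h) simp
    then show "ennreal (1 / c) * h x \<le> f x" by (simp only: cc)
  qed simp
  finally show "integral\<^sup>S M h \<le> ennreal c * (\<integral>\<^sup>+x. f x \<partial>M)" .
qed

lemma riesz_const_pos: "0 < \<beta> \<Longrightarrow> \<beta> < real n \<Longrightarrow> riesz_const n \<beta> > 0"
  by (auto simp: riesz_const_def intro!: divide_pos_pos mult_pos_pos Gamma_real_pos)

text \<open>Continuity and positivity on a compact interval of exponents make the bound uniform; the
  argument is \<beta>/2 because the modular uses the kernel of that order.\<close>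

lemma riesz_const_lower_bound:
  assumes "0 < c" "c \<le> d" "d < real n"
  obtains A where "A > 0" "\<And>\<beta>. \<beta> \<in> {c..d} \<Longrightarrow> A \<le> riesz_const n (\<beta> / 2)"
proof -
  have nz: "x \<notin> \<int>\<^sub>\<le>\<^sub>0" if "x > 0" for x :: real using that by (auto elim!: nonpos_Ints_cases)
  have G: "continuous_on {c..d} (\<lambda>\<beta>. Gamma (f \<beta>))"
    if "continuous_on {c..d} f" "\<And>\<beta>. \<beta> \<in> {c..d} \<Longrightarrow> f \<beta> > 0" for f :: "real \<Rightarrow> real"
    by (rule continuous_on_compose2[OF continuous_on_Gamma that(1), of "{0<..}"]) (use that(2) nz in auto)
  have "continuous_on {c..d} (\<lambda>\<beta>. riesz_const n (\<beta> / 2))"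
    unfolding riesz_const_def using assms
    by (intro continuous_on_divide continuous_on_mult G continuous_on_powr continuous_intros)
      (auto simp: Gamma_eq_zero_iff intro!: nz)
  then obtain \<beta>0 where b: "\<beta>0 \<in> {c..d}" "\<And>\<beta>. \<beta> \<in> {c..d} \<Longrightarrow> riesz_const n (\<beta>0 / 2) \<le> riesz_const n (\<beta> / 2)"
    using continuous_attains_inf[of "{c..d}" "\<lambda>\<beta>. riesz_const n (\<beta> / 2)"] assms by auto
  show thesis by (rule that[of "riesz_const n (\<beta>0 / 2)"]) (use b assms riesz_const_pos in auto)
qed

lemma riesz_kernel_nonneg: "0 < \<beta> \<Longrightarrow> \<beta> < real DIM('a) \<Longrightarrow> riesz_kernel \<beta> (x :: 'a::euclidean_space) \<ge> 0"
  using riesz_const_pos[of \<beta> "DIM('a)"] by (simp add: riesz_kernel_def)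

lemma q_exp_gt_1: "\<gamma> > 0 \<Longrightarrow> \<beta> > 0 \<Longrightarrow> q_exp \<gamma> \<beta> > 1"
  by (simp add: q_exp_def)

section \<open>The modular, its Luxemburg norm and the choice of a good exponent\<close>

locale coulomb_setting =
  fixes \<gamma> :: real and \<mu> :: "real measure" and ty :: "'a::euclidean_space itself"
  assumes gamma_pos: "\<gamma> > 0" and space_\<mu>: "space \<mu> = {0<..<real DIM('a)}"
begin

lemma coulomb_modular_mono:
  fixes u w :: "'a \<Rightarrow> real"
  assumes "\<And>x. \<bar>u x\<bar> \<le> \<bar>w x\<bar>"
  shows "coulomb_modular \<gamma> \<mu> u \<le> coulomb_modular \<gamma> \<mu> w"
  unfolding coulomb_modular_def nn_convolution_def
proof (intro nn_integral_mono power_mono ennreal_leI mult_left_mono powr_mono2 assms)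
  fix \<beta> and x y :: 'a assume "\<beta> \<in> space \<mu>"
  then have b: "0 < \<beta>" "\<beta> < real DIM('a)" using space_\<mu> by auto
  then show "0 \<le> riesz_kernel (\<beta> / 2) (x - y)" by (intro riesz_kernel_nonneg) auto
  show "0 \<le> q_exp \<gamma> \<beta>" using q_exp_gt_1[OF gamma_pos b(1)] by simp
qed auto

text \<open>For \<theta> \<le> 1 both \<theta>^q \<le> \<theta>, as q > 1, and \<theta>^2 \<le>
  \<theta>. This crude linear gain suffices to scale a finite modular below 1, so the set defining
  the norm is nonempty.\<close>

lemma coulomb_modular_scale:
  fixes u :: "'a \<Rightarrow> real"
  assumes \<theta>: "0 < \<theta>" "\<theta> \<le> 1"
  shows "coulomb_modular \<gamma> \<mu> (\<lambda>x. \<theta> * u x) \<le> ennreal \<theta> * coulomb_modular \<gamma> \<mu> u"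
proof -
  have conv: "nn_convolution (riesz_kernel (\<beta> / 2)) (\<lambda>y. \<bar>\<theta> * u y\<bar> powr q_exp \<gamma> \<beta>) x
     \<le> ennreal \<theta> * nn_convolution (riesz_kernel (\<beta> / 2)) (\<lambda>y. \<bar>u y\<bar> powr q_exp \<gamma> \<beta>) x"
    if "\<beta> \<in> space \<mu>" for \<beta> x
  proof -
    have b: "0 < \<beta>" "\<beta> < real DIM('a)" using space_\<mu> that by auto
    have q: "q_exp \<gamma> \<beta> > 1" by (rule q_exp_gt_1[OF gamma_pos b(1)])
    have "nn_convolution (riesz_kernel (\<beta> / 2)) (\<lambda>y. \<bar>\<theta> * u y\<bar> powr q_exp \<gamma> \<beta>) x
      \<le> (\<integral>\<^sup>+y. ennreal \<theta> * ennreal (riesz_kernel (\<beta> / 2) (x - y) * \<bar>u y\<bar> powr q_exp \<gamma> \<beta>) \<partial>lebesgue)"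
      unfolding nn_convolution_def
    proof (rule nn_integral_mono)
      fix y
      have "\<theta> powr q_exp \<gamma> \<beta> \<le> \<theta>" using powr_mono'[of 1 "q_exp \<gamma> \<beta>" \<theta>] \<theta> q by simp
      then have "\<bar>\<theta> * u y\<bar> powr q_exp \<gamma> \<beta> \<le> \<theta> * \<bar>u y\<bar> powr q_exp \<gamma> \<beta>"
        using \<theta> by (simp add: abs_mult powr_mult mult_right_mono)
      then have "riesz_kernel (\<beta> / 2) (x - y) * \<bar>\<theta> * u y\<bar> powr q_exp \<gamma> \<beta> \<le> riesz_kernel (\<beta> / 2) (x - y) * (\<theta> * \<bar>u y\<bar> powr q_exp \<gamma> \<beta>)"
        using b by (intro mult_left_mono riesz_kernel_nonneg) auto
      also have "\<dots> = \<theta> * (riesz_kernel (\<beta> / 2) (x - y) * \<bar>u y\<bar> powr q_exp \<gamma> \<beta>)" by simp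
      finally show "ennreal (riesz_kernel (\<beta> / 2) (x - y) * \<bar>\<theta> * u y\<bar> powr q_exp \<gamma> \<beta>) \<le> ennreal \<theta> * ennreal (riesz_kernel (\<beta> / 2) (x - y) * \<bar>u y\<bar> powr q_exp \<gamma> \<beta>)"
        using \<theta> by (simp add: ennreal_mult'[symmetric] ennreal_leI)
    qed
    also have "\<dots> \<le> ennreal \<theta> * nn_convolution (riesz_kernel (\<beta> / 2)) (\<lambda>y. \<bar>u y\<bar> powr q_exp \<gamma> \<beta>) x"
      unfolding nn_convolution_def by (rule nn_integral_cmult_le[OF \<theta>(1)])
    finally show ?thesis .
  qed
  let ?D = "\<lambda>u \<beta>. \<integral>\<^sup>+x. (nn_convolution (riesz_kernel (\<beta> / 2)) (\<lambda>y. \<bar>u y\<bar> powr q_exp \<gamma> \<beta>) (x::'a))\<^sup>2 \<partial>lebesgue"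
  have D: "?D (\<lambda>x. \<theta> * u x) \<beta> \<le> ennreal \<theta> * ?D u \<beta>" if "\<beta> \<in> space \<mu>" for \<beta>
  proof -
    have "(ennreal \<theta> * y)\<^sup>2 \<le> ennreal \<theta> * y\<^sup>2" for y :: ennreal
    proof -
      have "(ennreal \<theta>)\<^sup>2 \<le> ennreal \<theta>"
        using \<theta> by (simp add: ennreal_power power2_eq_square mult_left_le_one_le ennreal_leI ennreal_mult[symmetric])
      then show ?thesis unfolding power_mult_distrib by (rule mult_right_mono) simp
    qed
    then have "?D (\<lambda>x. \<theta> * u x) \<beta> \<le> (\<integral>\<^sup>+x. ennreal \<theta> * (nn_convolution (riesz_kernel (\<beta> / 2)) (\<lambda>y. \<bar>u y\<bar> powr q_exp \<gamma> \<beta>) (x::'a))\<^sup>2 \<partial>lebesgue)"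
      by (intro nn_integral_mono order_trans[OF power_mono[OF conv[OF that]]]) auto
    also have "\<dots> \<le> ennreal \<theta> * ?D u \<beta>" by (rule nn_integral_cmult_le[OF \<theta>(1)])
    finally show ?thesis .
  qed
  have "coulomb_modular \<gamma> \<mu> (\<lambda>x. \<theta> * u x) \<le> (\<integral>\<^sup>+\<beta>. ennreal \<theta> * ?D u \<beta> \<partial>\<mu>)"
    unfolding coulomb_modular_def by (rule nn_integral_mono) (rule D)
  also have "\<dots> \<le> ennreal \<theta> * coulomb_modular \<gamma> \<mu> u"
    unfolding coulomb_modular_def by (rule nn_integral_cmult_le[OF \<theta>(1)])
  finally show ?thesis .
qed

lemma coulomb_space_modular_le_1:
  fixes u :: "'a \<Rightarrow> real"
  assumes "u \<in> coulomb_space \<gamma> \<mu>"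
  obtains c where "c > 0" "coulomb_modular \<gamma> \<mu> (\<lambda>x. u x / c) \<le> 1"
proof -
  obtain c0 where c0: "c0 > 0" "coulomb_modular \<gamma> \<mu> (\<lambda>x. c0 * u x) < \<infinity>"
    using assms by (auto simp: coulomb_space_def)
  obtain A where A: "A \<ge> 0" "coulomb_modular \<gamma> \<mu> (\<lambda>x. c0 * u x) = ennreal A"
    using c0(2) by (cases "coulomb_modular \<gamma> \<mu> (\<lambda>x. c0 * u x)") auto
  define \<theta> where "\<theta> = 1 / (A + 1)"
  have \<theta>: "0 < \<theta>" "\<theta> \<le> 1" "\<theta> * A \<le> 1" using A(1) by (auto simp: \<theta>_def field_simps)
  have "coulomb_modular \<gamma> \<mu> (\<lambda>x. \<theta> * (c0 * u x)) \<le> ennreal \<theta> * ennreal A"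
    using coulomb_modular_scale[OF \<theta>(1,2), of "\<lambda>x. c0 * u x"] A(2) by simp
  also have "\<dots> \<le> 1" using \<theta> A(1) by (simp add: ennreal_mult[symmetric] ennreal_le_1)
  finally show thesis using that[of "1 / (\<theta> * c0)"] \<theta>(1) c0(1) by (simp add: mult_ac)
qed

lemma coulomb_norm_nonneg:
  fixes u :: "'a \<Rightarrow> real"
  assumes "u \<in> coulomb_space \<gamma> \<mu>"
  shows "coulomb_norm \<gamma> \<mu> u \<ge> 0"
  unfolding coulomb_norm_def
  by (rule cInf_greatest) (use coulomb_space_modular_le_1[OF assms] in auto)

text \<open>The strict inequality supplies an admissible c below \<Lambda>, and monotonicity of the
  modular passes from c to \<Lambda>; whether the infimum is attained never matters.\<close>

lemma coulomb_norm_less: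
  fixes u :: "'a \<Rightarrow> real"
  assumes u: "u \<in> coulomb_space \<gamma> \<mu>" and less: "coulomb_norm \<gamma> \<mu> u < \<Lambda>"
  shows "coulomb_modular \<gamma> \<mu> (\<lambda>x. u x / \<Lambda>) \<le> 1"
proof -
  have "{c. c > 0 \<and> coulomb_modular \<gamma> \<mu> (\<lambda>x. u x / c) \<le> 1} \<noteq> {}"
    using coulomb_space_modular_le_1[OF u] by auto
  from cInf_lessD[OF this] less obtain c where c: "c > 0" "coulomb_modular \<gamma> \<mu> (\<lambda>x. u x / c) \<le> 1" "c < \<Lambda>"
    by (auto simp: coulomb_norm_def)
  have "coulomb_modular \<gamma> \<mu> (\<lambda>x. u x / \<Lambda>) \<le> coulomb_modular \<gamma> \<mu> (\<lambda>x. u x / c)"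
    by (rule coulomb_modular_mono) (use c in \<open>auto intro!: divide_left_mono\<close>)
  then show ?thesis using c(2) by (rule order_trans)
qed

text \<open>Chebyshev's inequality, with 2/m instead of 1/m so that failure on all of S gives 2
  \<le> 1. The energy is compared with a multiple of an indicator by monotonicity, which holds for
  arbitrary integrands.\<close>

lemma coulomb_modular_good_exponent:
  fixes w :: "'a \<Rightarrow> real"
  assumes mod: "coulomb_modular \<gamma> \<mu> w \<le> 1" and S: "S \<in> sets \<mu>" "emeasure \<mu> S = ennreal m" "m > 0"
  obtains \<beta> where "\<beta> \<in> S"
    "(\<integral>\<^sup>+x. (nn_convolution (riesz_kernel (\<beta> / 2)) (\<lambda>y. \<bar>w y\<bar> powr q_exp \<gamma> \<beta>) x)\<^sup>2 \<partial>lebesgue) \<le> ennreal (2 / m)"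
proof (rule ccontr)
  let ?D = "\<lambda>\<beta>. \<integral>\<^sup>+x. (nn_convolution (riesz_kernel (\<beta> / 2)) (\<lambda>y. \<bar>w y\<bar> powr q_exp \<gamma> \<beta>) x)\<^sup>2 \<partial>lebesgue"
  assume "\<not> thesis"
  then have n: "\<not> ?D \<beta> \<le> ennreal (2 / m)" if "\<beta> \<in> S" for \<beta> using \<open>\<And>\<beta>. \<beta> \<in> S \<Longrightarrow> ?D \<beta> \<le> ennreal (2 / m) \<Longrightarrow> thesis\<close> that by blast
  have "ennreal (2 / m) * emeasure \<mu> S = (\<integral>\<^sup>+\<beta>. ennreal (2 / m) * indicator S \<beta> \<partial>\<mu>)"
    by (rule nn_integral_cmult_indicator[symmetric, OF S(1)])
  also have "\<dots> \<le> (\<integral>\<^sup>+\<beta>. ?D \<beta> \<partial>\<mu>)"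
    by (rule nn_integral_mono) (use n in \<open>auto simp: not_le less_imp_le split: split_indicator\<close>)
  also have "\<dots> \<le> 1" using mod by (simp add: coulomb_modular_def)
  finally have "ennreal (2 / m) * ennreal m \<le> 1" unfolding S(2) .
  moreover have "ennreal (2 / m) * ennreal m = ennreal 2"
    using S(3) by (simp add: ennreal_mult'[symmetric] del: ennreal_numeral)
  ultimately have "ennreal 2 \<le> ennreal 1" by (simp del: ennreal_numeral)
  then show False by (subst (asm) ennreal_le_iff) auto
qed

end

text \<open>For |y| between S and 2S and |x| between 3S and 4S the distance is at most 6S, so the
  potential at x is at least A (6S)^(\<beta>/2-n) times the mass. Squaring and integrating over the
  outer shell, of volume at least that of a ball of radius S, gives the exponent
  (n-\<beta>)/2.\<close>

lemma coulomb_shell_bound: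
  fixes w :: "'a::euclidean_space \<Rightarrow> real"
  assumes w[measurable]: "w \<in> borel_measurable lebesgue" and \<beta>: "0 < \<beta>" "\<beta> < real DIM('a)"
    and A: "0 < A" "A \<le> riesz_const DIM('a) (\<beta> / 2)" and M: "0 \<le> M" and S: "0 < S"
    and D: "(\<integral>\<^sup>+x. (nn_convolution (riesz_kernel (\<beta> / 2)) (\<lambda>y. \<bar>w y\<bar> powr q) x)\<^sup>2 \<partial>lebesgue) \<le> ennreal M"
  shows "(\<integral>\<^sup>+x. ennreal (\<bar>w x\<bar> powr q) * indicator (shell S (2 * S)) x \<partial>lebesgue)
     \<le> ennreal (sqrt (M / unit_ball_vol (real DIM('a))) * 6 ^ DIM('a) / A * S powr ((real DIM('a) - \<beta>) / 2))"
proof -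
  let ?n = "DIM('a)" and ?u = "unit_ball_vol (real DIM('a))"
  have u: "?u > 0" by simp
  define I where "I = (\<integral>\<^sup>+x. ennreal (\<bar>w x\<bar> powr q) * indicator (shell S (2 * S)) x \<partial>lebesgue)"
  define k where "k = A * (6 * S) powr (\<beta> / 2 - real ?n)"
  have k: "k > 0" using A S by (simp add: k_def)
  have [measurable]: "shell S (2 * S) \<in> sets (lebesgue :: 'a measure)" by (rule shell_lebesgue)
  have conv: "ennreal k * I \<le> nn_convolution (riesz_kernel (\<beta> / 2)) (\<lambda>y. \<bar>w y\<bar> powr q) x" if x: "x \<in> shell (3 * S) (4 * S)" for x
  proof -
    have "ennreal k * I = (\<integral>\<^sup>+y. ennreal k * (ennreal (\<bar>w y\<bar> powr q) * indicator (shell S (2 * S)) y) \<partial>lebesgue)"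
      unfolding I_def by (rule nn_integral_cmult[symmetric]) measurable
    also have "\<dots> \<le> (\<integral>\<^sup>+y. ennreal (riesz_kernel (\<beta> / 2) (x - y) * \<bar>w y\<bar> powr q) \<partial>lebesgue)"
    proof (rule nn_integral_mono)
      fix y
      show "ennreal k * (ennreal (\<bar>w y\<bar> powr q) * indicator (shell S (2 * S)) y) \<le> ennreal (riesz_kernel (\<beta> / 2) (x - y) * \<bar>w y\<bar> powr q)"
      proof (cases "y \<in> shell S (2 * S)")
        case True
        have 1: "norm (x - y) \<le> 6 * S" using True x norm_triangle_ineq4[of x y] by auto
        \<comment> \<open>At x = y the kernel takes the default value 0 of \<open>powr\<close>; the
          gap between the two shells excludes this.\<close>
        have 2: "norm (x - y) > 0" using True x S by auto
        have "(6 * S) powr (\<beta> / 2 - real ?n) \<le> norm (x - y) powr (\<beta> / 2 - real ?n)"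
          using 1 2 \<beta> by (intro powr_mono2') auto
        then have "k \<le> riesz_kernel (\<beta> / 2) (x - y)"
          unfolding k_def riesz_kernel_def using A by (intro mult_mono) auto
        then show ?thesis using True k by (simp add: ennreal_mult'[symmetric] ennreal_leI mult_right_mono)
      qed simp
    qed
    finally show ?thesis by (simp add: nn_convolution_def)
  qed
  have "(ennreal k * I)\<^sup>2 * ennreal (?u * S ^ ?n) \<le> (ennreal k * I)\<^sup>2 * emeasure lebesgue (shell (3 * S) (4 * S) :: 'a set)"
  proof (rule mult_left_mono)
    obtain l where l: "?n = Suc l" by (cases ?n) auto
    have "S ^ ?n \<le> real ?n * (3 * S) ^ l * (4 * S - 3 * S)"
    proof -
      have "S ^ l \<le> (3 * S) ^ l" using S by (intro power_mono) auto
      then have "1 * (S ^ l * S) \<le> real ?n * ((3 * S) ^ l * S)"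
        using S l by (intro mult_mono mult_right_mono) auto
      then show ?thesis by (simp add: l mult_ac)
    qed
    also have "\<dots> \<le> (4 * S) ^ ?n - (3 * S) ^ ?n"
      unfolding l using S by (intro power_diff_bounds(2)) auto
    finally show "ennreal (?u * S ^ ?n) \<le> emeasure lebesgue (shell (3 * S) (4 * S) :: 'a set)"
      using S by (simp add: emeasure_shell ennreal_leI mult_left_mono)
  qed simp
  also have "\<dots> = (\<integral>\<^sup>+x. (ennreal k * I)\<^sup>2 * indicator (shell (3 * S) (4 * S)) x \<partial>(lebesgue :: 'a measure))"
    by (rule nn_integral_cmult_indicator[symmetric]) (rule shell_lebesgue)
  also have "\<dots> \<le> (\<integral>\<^sup>+x. (nn_convolution (riesz_kernel (\<beta> / 2)) (\<lambda>y. \<bar>w y\<bar> powr q) x)\<^sup>2 \<partial>lebesgue)"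
    using conv by (intro nn_integral_mono) (auto split: split_indicator intro!: power_mono)
  also note D
  finally have main: "(ennreal k * I)\<^sup>2 * ennreal (?u * S ^ ?n) \<le> ennreal M" .
  show ?thesis
  proof (cases I)
    case (real i)
    have "(ennreal k * I)\<^sup>2 * ennreal (?u * S ^ ?n) = ennreal ((k * i)\<^sup>2 * (?u * S ^ ?n))"
      using real k u S by (simp add: ennreal_mult[symmetric] ennreal_power)
    then have "(k * i)\<^sup>2 * (?u * S ^ ?n) \<le> M" using main M by simp
    then have "(k * i)\<^sup>2 \<le> M / (?u * S ^ ?n)" using u S by (simp add: field_simps)
    then have "k * i \<le> sqrt (M / (?u * S ^ ?n))" by (rule real_le_rsqrt)
    also have "\<dots> = sqrt (M / ?u) * S powr (- (real ?n / 2))"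
    proof -
      have "sqrt (S ^ ?n) = S powr (real ?n / 2)"
        using S by (simp add: powr_half_sqrt[symmetric] powr_realpow[symmetric] powr_powr)
      then show ?thesis by (simp add: real_sqrt_divide real_sqrt_mult powr_minus_divide)
    qed
    finally have "i \<le> sqrt (M / ?u) * S powr (- (real ?n / 2)) / k" using k by (simp add: field_simps)
    also have "\<dots> = sqrt (M / ?u) / A * (S powr (- (real ?n / 2)) * (6 * S) powr (real ?n - \<beta> / 2))"
    proof -
      have "(6 * S) powr (real ?n - \<beta> / 2) = 1 / (6 * S) powr (\<beta> / 2 - real ?n)"
        by (simp add: powr_minus_divide[symmetric])
      then show ?thesis by (simp add: k_def)
    qed
    also have "(6 * S) powr (real ?n - \<beta> / 2) = 6 powr (real ?n - \<beta> / 2) * S powr (real ?n - \<beta> / 2)"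
      using S by (simp add: powr_mult)
    also have "S powr (- (real ?n / 2)) * (6 powr (real ?n - \<beta> / 2) * S powr (real ?n - \<beta> / 2)) = 6 powr (real ?n - \<beta> / 2) * S powr ((real ?n - \<beta>) / 2)"
    proof -
      have "S powr (- (real ?n / 2)) * S powr (real ?n - \<beta> / 2) = S powr ((real ?n - \<beta>) / 2)"
        unfolding powr_add[symmetric] by (rule arg_cong[where f = "\<lambda>z. S powr z"]) (simp add: field_simps)
      then show ?thesis by (simp add: mult_ac)
    qed
    also have "sqrt (M / ?u) / A * (6 powr (real ?n - \<beta> / 2) * S powr ((real ?n - \<beta>) / 2)) \<le> sqrt (M / ?u) / A * (6 powr real ?n * S powr ((real ?n - \<beta>) / 2))"
      using A M \<beta> by (intro mult_left_mono mult_right_mono powr_mono) auto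
    also have "\<dots> = sqrt (M / ?u) * 6 ^ ?n / A * S powr ((real ?n - \<beta>) / 2)"
      by (simp add: powr_realpow)
    finally show ?thesis using real by (simp add: I_def[symmetric] ennreal_leI)
  next
    \<comment> \<open>Infinite mass has to be ruled out separately: it would make the left side of
      \<open>main\<close> infinite, as k and the volume are positive.\<close>
    case top
    have "?u * S ^ ?n > 0" by (intro mult_pos_pos u zero_less_power S)
    then have "ennreal (?u * S ^ ?n) \<noteq> 0" by (metis ennreal_eq_0_iff not_le)
    moreover have "(ennreal k * I)\<^sup>2 = top" using top k by (simp add: ennreal_mult_top power2_eq_square)
    ultimately have "(ennreal k * I)\<^sup>2 * ennreal (?u * S ^ ?n) = top" by (simp only: ennreal_top_mult if_False)
    then show ?thesis using main by (simp add: top_unique)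
  qed
qed

subsection \<open>Profiles of radial functions\<close>

lemma nn_integral_lebesgue_eq_lborel:
  assumes "AE x in lebesgue. h x = f x"
  shows "(\<integral>\<^sup>+x. h x \<partial>lebesgue) = (\<integral>\<^sup>+x. f x \<partial>lborel)"
proof -
  have "(\<integral>\<^sup>+x. h x \<partial>lebesgue) = (\<integral>\<^sup>+x. f x \<partial>lebesgue)" by (rule nn_integral_cong_AE[OF assms])
  also have "\<dots> = (\<integral>\<^sup>+x. f x \<partial>lborel)" by (rule nn_integral_completion)
  finally show ?thesis .
qed

lemma radial_profile_exists:
  fixes u :: "'a::euclidean_space \<Rightarrow> real"
  assumes dim: "DIM('a) \<ge> 3" and u: "u \<in> D12" "radial u"
    and L: "L > 0" "Lp_norm 2 (weak_gradient u) \<le> L"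
  obtains v and g :: "'a \<Rightarrow> real" where "radial_profile v g" "AE x in lebesgue. u x / L = v (norm x)"
proof -
  let ?n = "DIM('a)" and ?w = "sphere_area DIM('a)" and ?g = "weak_gradient u"
  have w: "?w > 0" by (simp add: sphere_area_pos)
  have wg: "has_weak_gradient u ?g" and g2: "?g \<in> Lp_space 2" by (rule D12_weak_gradient[OF u(1)])+
  obtain v0 where v0: "AE x in lebesgue. u x = v0 (norm x)"
    "\<And>s t. 0 < s \<Longrightarrow> s \<le> t \<Longrightarrow> ?w * (v0 t - v0 s) = (\<integral>x. (?g x \<bullet> x) / norm x ^ ?n * indicator (shell s t) x \<partial>lebesgue)"
    using radial_representative[OF wg u(2)] by blast
  have gm: "(\<lambda>x. norm (?g x) / L) \<in> borel_measurable lebesgue"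
    using g2 by (auto simp: Lp_space_def)
  obtain g1 where g1[measurable]: "g1 \<in> borel_measurable lborel" and ae1: "AE x in lborel. norm (?g x) / L = g1 x"
    using completion_ex_borel_measurable_real[OF gm] by auto
  \<comment> \<open>The Borel representative may be negative on a null set; clipping restores
    nonnegativity everywhere.\<close>
  define g where "g x = max 0 (g1 x)" for x
  have gmeas[measurable]: "g \<in> borel_measurable borel" using g1 unfolding g_def[abs_def] by measurable
  have aeg: "AE x in lebesgue. norm (?g x) / L = g x"
    using AE_completion[OF ae1]
  proof eventually_elim
    case (elim x)
    have "0 \<le> norm (?g x) / L" using L(1) by simp
    then show ?case using elim by (simp add: g_def)
  qed
  define v where "v t = (if t > 0 then v0 t / L else 0)" for t
  have uv: "AE x in lebesgue. u x / L = v (norm x)"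
    using v0(1) AE_norm_neq[of 0] by eventually_elim (simp add: v_def)
  have "radial_profile v g"
  proof
    show "(\<integral>\<^sup>+x. ennreal ((g x)\<^sup>2) \<partial>lborel) \<le> 1"
    proof -
      have "(\<integral>\<^sup>+x. ennreal ((g x)\<^sup>2) \<partial>lborel) = (\<integral>\<^sup>+x. ennreal (norm (?g x) powr 2 / L\<^sup>2) \<partial>lebesgue)"
      proof (rule nn_integral_lebesgue_eq_lborel[symmetric])
        show "AE x in lebesgue. ennreal (norm (?g x) powr 2 / L\<^sup>2) = ennreal ((g x)\<^sup>2)"
          using aeg by eventually_elim (simp add: power_divide[symmetric] powr_numeral)
      qed
      also have "\<dots> = ennreal (\<integral>x. norm (?g x) powr 2 / L\<^sup>2 \<partial>lebesgue)"
        using g2 by (intro nn_integral_eq_integral) (auto simp: Lp_space_def)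
      also have "(\<integral>x. norm (?g x) powr 2 / L\<^sup>2 \<partial>lebesgue) = (Lp_norm 2 ?g)\<^sup>2 / L\<^sup>2"
      proof -
        have "0 \<le> (\<integral>x. norm (?g x) powr 2 \<partial>lebesgue)" by (rule integral_nonneg_AE) simp
        then show ?thesis by (simp add: Lp_norm_def powr_half_sqrt)
      qed
      also have "ennreal ((Lp_norm 2 ?g)\<^sup>2 / L\<^sup>2) \<le> ennreal 1"
        using L power_mono[OF L(2), of 2] by (intro ennreal_leI) (simp add: Lp_norm_def)
      finally show ?thesis by simp
    qed
    show "ennreal (?w * \<bar>v t - v s\<bar>) \<le> (\<integral>\<^sup>+x. ennreal (g x * norm x powr (1 - real ?n)) * indicator (shell s t) x \<partial>lborel)"
      if st: "0 < s" "s \<le> t" for s t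
    proof -
      have "?w * \<bar>v t - v s\<bar> = \<bar>?w * (v0 t - v0 s)\<bar> / L"
        using st w L(1) by (simp add: v_def abs_mult diff_divide_distrib[symmetric])
      then have "ennreal (?w * \<bar>v t - v s\<bar>) = ennreal (1 / L) * ennreal (norm (\<integral>x. (?g x \<bullet> x) / norm x ^ ?n * indicator (shell s t) x \<partial>lebesgue))"
        using v0(2)[OF st] L(1) by (simp add: ennreal_mult'[symmetric])
      also have "\<dots> \<le> ennreal (1 / L) * (\<integral>\<^sup>+x. ennreal (norm ((?g x \<bullet> x) / norm x ^ ?n * indicator (shell s t) x)) \<partial>lebesgue)"
        using wg st by (intro mult_left_mono integral_norm_bound_ennreal integrable_radial_gradient) (auto simp: has_weak_gradient_def)
      also have "\<dots> \<le> ennreal (1 / L) * (\<integral>\<^sup>+x. ennreal L * (ennreal (g x * norm x powr (1 - real ?n)) * indicator (shell s t) x) \<partial>lebesgue)"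
      proof (intro mult_left_mono nn_integral_mono_AE)
        show "AE x in lebesgue. ennreal (norm ((?g x \<bullet> x) / norm x ^ ?n * indicator (shell s t) x)) \<le> ennreal L * (ennreal (g x * norm x powr (1 - real ?n)) * indicator (shell s t) x)"
          using aeg
        proof eventually_elim
          case (elim x)
          show ?case
          proof (cases "x \<in> shell s t")
            case True
            then have x: "norm x > 0" using st by auto
            have "\<bar>?g x \<bullet> x\<bar> / norm x ^ ?n \<le> norm (?g x) * norm x / norm x ^ ?n"
              by (intro divide_right_mono Cauchy_Schwarz_ineq2) simp
            also have "\<dots> = norm (?g x) * norm x powr (1 - real ?n)"
              using x by (simp add: powr_diff powr_realpow)
            also have "norm (?g x) = L * g x" using elim L(1) by (simp add: field_simps)
            finally have "\<bar>?g x \<bullet> x\<bar> / norm x ^ ?n \<le> L * (g x * norm x powr (1 - real ?n))" by (simp add: mult.assoc)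
            then show ?thesis using True L(1) by (simp add: ennreal_mult'[symmetric] ennreal_leI abs_divide)
          qed simp
        qed
      qed simp
      also have "\<dots> = ennreal (1 / L) * (\<integral>\<^sup>+x. ennreal L * (ennreal (g x * norm x powr (1 - real ?n)) * indicator (shell s t) x) \<partial>lborel)"
        by (simp only: nn_integral_completion)
      also have "\<dots> = ennreal (1 / L) * (ennreal L * (\<integral>\<^sup>+x. ennreal (g x * norm x powr (1 - real ?n)) * indicator (shell s t) x \<partial>lborel))"
        by (subst nn_integral_cmult) (auto, measurable)
      also have "\<dots> = (\<integral>\<^sup>+x. ennreal (g x * norm x powr (1 - real ?n)) * indicator (shell s t) x \<partial>lborel)"
        using L(1) by (simp add: mult.assoc[symmetric] ennreal_mult'[symmetric])
      finally show ?thesis .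
    qed
    show "(\<integral>\<^sup>+x. ennreal (\<bar>v (norm x)\<bar> powr sobolev_exp ?n) \<partial>(lebesgue :: 'a measure)) < \<infinity>"
    proof -
      have "(\<integral>\<^sup>+x. ennreal (\<bar>v (norm x)\<bar> powr sobolev_exp ?n) \<partial>(lebesgue :: 'a measure))
         = (\<integral>\<^sup>+x. ennreal (norm (u x) powr sobolev_exp ?n / L powr sobolev_exp ?n) \<partial>lebesgue)"
      proof (rule nn_integral_cong_AE)
        show "AE x in lebesgue. ennreal (\<bar>v (norm x)\<bar> powr sobolev_exp ?n) = ennreal (norm (u x) powr sobolev_exp ?n / L powr sobolev_exp ?n)"
          using uv
        proof eventually_elim
          case (elim x)
          show ?case unfolding elim[symmetric] using L(1) by (simp add: powr_divide abs_divide)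
        qed
      qed
      also have "\<dots> = ennreal (\<integral>x. norm (u x) powr sobolev_exp ?n / L powr sobolev_exp ?n \<partial>lebesgue)"
        using u(1) by (intro nn_integral_eq_integral) (auto simp: D12_def Lp_space_def)
      finally show ?thesis by simp
    qed
  qed (use dim in \<open>auto simp: v_def g_def gmeas\<close>)
  then show thesis using uv by (rule that)
qed

section \<open>Shell masses and their dyadic sums\<close>

definition mass_bounded :: "(real \<Rightarrow> real) \<Rightarrow> 'a::euclidean_space itself \<Rightarrow> real \<Rightarrow> real \<Rightarrow> real \<Rightarrow> bool" where
  "mass_bounded v ty q \<theta> CJ \<longleftrightarrow> (\<forall>S>0. radial_mass TYPE('a) v q (shell S (2 * S)) \<le> ennreal (CJ * S powr \<theta>))"

text \<open>Minus the exponent of R in \<open>nn_integral_shell_power\<close>: positive values make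
  the shell bounds summable towards infinity, negative ones towards the origin.\<close>

definition shell_decay :: "real \<Rightarrow> real \<Rightarrow> real \<Rightarrow> real \<Rightarrow> real" where
  "shell_decay n q \<theta> r = (2 * n - 2 - \<theta>) * (r - q) / (q + 2) - \<theta>"

text \<open>Q bounds all exponents q under consideration and \<tau> is a lower bound for all their
  rates, so the resulting constant and rate do not depend on q; weakening the rate is harmless
  because R \<ge> 1.\<close>

lemma (in radial_profile) outer_tail:
  assumes mb: "mass_bounded v TYPE('a) q \<theta> CJ" and q: "1 \<le> q" "q \<le> r" "q \<le> Q" and CJ: "0 \<le> CJ"
    and \<theta>: "\<theta> \<le> 2 * real DIM('a) - 2"
    and L: "1 \<le> L" "2 powr Q * CJ / (sphere_area DIM('a) * length_const DIM('a)) \<le> L"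
    and \<tau>: "0 < \<tau>" "\<tau> \<le> shell_decay (real DIM('a)) q \<theta> r" and R: "1 \<le> R"
  shows "radial_mass TYPE('a) v r {x. R < norm x}
    \<le> ennreal (L powr r * CJ * R powr (- \<tau>) / (1 - 2 powr (- \<tau>)))"
proof (rule nn_integral_outer_dyadic)
  have c: "sphere_area DIM('a) * length_const DIM('a) > 0" using area_pos length_const_pos[OF dim] by simp
  have "2 powr q * CJ / (sphere_area DIM('a) * length_const DIM('a)) \<le> 2 powr Q * CJ / (sphere_area DIM('a) * length_const DIM('a))"
    using c CJ q by (intro divide_right_mono mult_right_mono powr_mono) auto
  then have L': "2 powr q * CJ / (sphere_area DIM('a) * length_const DIM('a)) \<le> L" using L(2) by linarith
  fix S :: real assume S: "R \<le> S"
  have "radial_mass TYPE('a) v r (shell S (2 * S))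
     \<le> ennreal (L powr r * CJ * S powr (- shell_decay (real DIM('a)) q \<theta> r))"
    unfolding shell_decay_def
    by (rule nn_integral_shell_power[OF q(1,2) CJ _ \<theta> _ L(1) L']) (use mb S R in \<open>auto simp: mass_bounded_def\<close>)
  also have "\<dots> \<le> ennreal (L powr r * CJ * S powr (- \<tau>))"
    using CJ \<tau> S R by (intro ennreal_leI mult_left_mono powr_mono) auto
  finally show "radial_mass TYPE('a) v r (shell S (2 * S)) \<le> ennreal (L powr r * CJ * S powr (- \<tau>))" .
qed (use R CJ \<tau> in auto)

lemma (in radial_profile) inner_tail:
  assumes mb: "mass_bounded v TYPE('a) q \<theta> CJ" and q: "1 \<le> q" "q \<le> r" "q \<le> Q" and CJ: "0 \<le> CJ"
    and \<theta>: "\<theta> \<le> 2 * real DIM('a) - 2"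
    and L: "1 \<le> L" "2 powr Q * CJ / (sphere_area DIM('a) * length_const DIM('a)) \<le> L"
    and \<tau>: "0 < \<tau>" "shell_decay (real DIM('a)) q \<theta> r \<le> - \<tau>" and R: "0 < R" "R \<le> 1"
  shows "radial_mass TYPE('a) v r (shell 0 (2 * R))
    \<le> ennreal (L powr r * CJ * R powr \<tau> / (1 - 2 powr (- \<tau>)))"
proof (rule nn_integral_inner_dyadic)
  have c: "sphere_area DIM('a) * length_const DIM('a) > 0" using area_pos length_const_pos[OF dim] by simp
  have "2 powr q * CJ / (sphere_area DIM('a) * length_const DIM('a)) \<le> 2 powr Q * CJ / (sphere_area DIM('a) * length_const DIM('a))"
    using c CJ q by (intro divide_right_mono mult_right_mono powr_mono) auto
  then have L': "2 powr q * CJ / (sphere_area DIM('a) * length_const DIM('a)) \<le> L" using L(2) by linarith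
  fix S :: real assume S: "0 < S" "S \<le> R"
  have "radial_mass TYPE('a) v r (shell S (2 * S))
     \<le> ennreal (L powr r * CJ * S powr (- shell_decay (real DIM('a)) q \<theta> r))"
    unfolding shell_decay_def
    by (rule nn_integral_shell_power[OF q(1,2) CJ _ \<theta> _ L(1) L']) (use mb S R in \<open>auto simp: mass_bounded_def\<close>)
  also have "\<dots> \<le> ennreal (L powr r * CJ * S powr \<tau>)"
    using CJ \<tau> S R by (intro ennreal_leI mult_left_mono powr_mono') auto
  finally show "radial_mass TYPE('a) v r (shell S (2 * S)) \<le> ennreal (L powr r * CJ * S powr \<tau>)" .
qed (use R CJ \<tau> in auto)

subsection \<open>Uniform tail estimates\<close>

lemma isCont_tendsto_nhds: "isCont f a \<Longrightarrow> (f \<longlongrightarrow> f a) (nhds a)"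
  unfolding isCont_def by (rule tendsto_at_iff_tendsto_nhds[THEN iffD1])

text \<open>Cross-multiplied, the gap is (n-\<alpha>)(q+2) > 0. It yields r > q in the subcritical
  case and room for an auxiliary exponent in the supercritical one.\<close>

lemma q_rad_greater:
  assumes "\<gamma> > 0" "0 < \<alpha>" "\<alpha> < real n" "n \<ge> 3"
  shows "q_exp \<gamma> \<alpha> < q_rad n \<gamma> \<alpha>"
proof -
  define q where "q = q_exp \<gamma> \<alpha>"
  have q: "q > 1" unfolding q_def by (rule q_exp_gt_1) (use assms in auto)
  have d: "3 * real n + \<alpha> - 4 > 0" using assms by linarith
  have "0 < (real n - \<alpha>) * (q + 2)" using assms q by (intro mult_pos_pos) auto
  then have "q * (3 * real n + \<alpha> - 4) < 2 * (2 * q * (real n - 1) + real n - \<alpha>)" by (simp add: algebra_simps)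
  then show ?thesis unfolding q_rad_def q_def[symmetric] using d by (simp add: pos_less_divide_eq)
qed

text \<open>The rate is affine in r; with \<theta> = (n-\<alpha>)/2 its slope is positive and its
  zero is \<open>q_rad\<close>, so the side of \<open>q_rad\<close> on which r lies decides which
  end has summable shells.\<close>

lemma shell_decay_eq:
  assumes "\<gamma> > 0" "0 < \<alpha>" "\<alpha> < real n" "n \<ge> 3"
  shows "shell_decay (real n) (q_exp \<gamma> \<alpha>) ((real n - \<alpha>) / 2) r
    = (3 * real n + \<alpha> - 4) / (2 * (q_exp \<gamma> \<alpha> + 2)) * (r - q_rad n \<gamma> \<alpha>)"
proof -
  define q where "q = q_exp \<gamma> \<alpha>"
  define d where "d = 3 * real n + \<alpha> - 4"
  have q: "q + 2 > 0" using q_exp_gt_1[OF assms(1,2)] by (simp add: q_def)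
  have d: "d > 0" using assms unfolding d_def by linarith
  have "d * q_rad n \<gamma> \<alpha> = 2 * (2 * q * (real n - 1) + real n - \<alpha>)"
    using d by (simp add: q_rad_def q_def[symmetric] d_def[symmetric])
  then have "d * (r - q_rad n \<gamma> \<alpha>) = d * (r - q) - (real n - \<alpha>) * (q + 2)"
    by (simp add: right_diff_distrib d_def algebra_simps)
  then have "d / (2 * (q + 2)) * (r - q_rad n \<gamma> \<alpha>) = (d * (r - q) - (real n - \<alpha>) * (q + 2)) / (2 * (q + 2))"
    by simp
  also have "\<dots> = d / 2 * (r - q) / (q + 2) - (real n - \<alpha>) / 2"
  proof -
    have "(real n - \<alpha>) * (q + 2) / (2 * (q + 2)) = (real n - \<alpha>) / 2"
      using q by (metis less_irrefl nonzero_mult_divide_mult_cancel_right)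
    then show ?thesis by (simp add: diff_divide_distrib)
  qed
  also have "d / 2 = 2 * real n - 2 - (real n - \<alpha>) / 2" by (simp add: d_def field_simps)
  finally show ?thesis by (simp add: shell_decay_def q_def d_def)
qed

lemma shell_decay_isCont:
  assumes "\<gamma> > 0" "0 < \<alpha>"
  shows "isCont (\<lambda>\<beta>. shell_decay (real n) (q_exp \<gamma> \<beta>) ((real n - \<beta>) / 2) r) \<alpha>"
proof -
  have "q_exp \<gamma> \<alpha> + 2 \<noteq> 0" using q_exp_gt_1[OF assms] by simp
  then show ?thesis unfolding shell_decay_def q_exp_def using assms by (intro continuous_intros) auto
qed

lemma q_exp_isCont: "\<gamma> > 0 \<Longrightarrow> isCont (q_exp \<gamma>) \<alpha>"
  unfolding q_exp_def[abs_def] by (intro continuous_intros) auto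

definition tails_bounded :: "(real \<Rightarrow> real) \<Rightarrow> 'a::euclidean_space itself \<Rightarrow> real \<Rightarrow> real \<Rightarrow> real \<Rightarrow> bool" where
  "tails_bounded v ty r K \<tau> \<longleftrightarrow> (\<forall>R\<ge>1.
     radial_mass TYPE('a) v r {x. R < norm x} \<le> ennreal (K * R powr (- \<tau>)) \<and>
     radial_mass TYPE('a) v r (shell 0 (1 / R)) \<le> ennreal (K * R powr (- \<tau>)))"

text \<open>The order of quantifiers avoids a circle: CJ will depend on the mass of \<mu> near
  \<alpha> and thus on \<delta>, so \<delta> is fixed before CJ, while K and \<tau> may depend on CJ
  but on no profile or exponent.\<close>

definition uniform_tails :: "'a::euclidean_space itself \<Rightarrow> real \<Rightarrow> real \<Rightarrow> real \<Rightarrow> real \<Rightarrow> bool" where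
  "uniform_tails ty \<gamma> \<alpha> r \<delta> \<longleftrightarrow> (\<forall>CJ\<ge>0. \<exists>K\<ge>0. \<exists>\<tau>>0. \<forall>v (g :: 'a \<Rightarrow> real) \<beta>. radial_profile v g \<longrightarrow>
     \<bar>\<beta> - \<alpha>\<bar> < \<delta> \<longrightarrow> mass_bounded v ty (q_exp \<gamma> \<beta>) ((real DIM('a) - \<beta>) / 2) CJ \<longrightarrow> tails_bounded v ty r K \<tau>)"

text \<open>Everything follows from continuity in \<beta>. The open set U is left free so as to
  serve positive rates at infinity and negative rates at the origin alike.\<close>

lemma exponent_neighbourhood:
  assumes \<gamma>: "\<gamma> > 0" and \<alpha>: "0 < \<alpha>" and q: "q_exp \<gamma> \<alpha> < \<rho>"
    and U: "open U" "shell_decay (real n) (q_exp \<gamma> \<alpha>) ((real n - \<alpha>) / 2) \<rho> \<in> U"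
  obtains \<delta> where "\<delta> > 0" "\<And>\<beta>. \<bar>\<beta> - \<alpha>\<bar> < \<delta> \<Longrightarrow>
    shell_decay (real n) (q_exp \<gamma> \<beta>) ((real n - \<beta>) / 2) \<rho> \<in> U \<and> q_exp \<gamma> \<beta> < \<rho> \<and> q_exp \<gamma> \<beta> < q_exp \<gamma> \<alpha> + 1 \<and> 0 < \<beta>"
proof -
  have qt: "(q_exp \<gamma> \<longlongrightarrow> q_exp \<gamma> \<alpha>) (nhds \<alpha>)"
    by (rule isCont_tendsto_nhds[OF q_exp_isCont[OF \<gamma>]])
  have "\<forall>\<^sub>F \<beta> in nhds \<alpha>. shell_decay (real n) (q_exp \<gamma> \<beta>) ((real n - \<beta>) / 2) \<rho> \<in> U"
    by (rule topological_tendstoD[OF isCont_tendsto_nhds[OF shell_decay_isCont[OF \<gamma> \<alpha>]] U])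
  moreover have "\<forall>\<^sub>F \<beta> in nhds \<alpha>. q_exp \<gamma> \<beta> < \<rho>" by (rule order_tendstoD(2)[OF qt q])
  moreover have "\<forall>\<^sub>F \<beta> in nhds \<alpha>. q_exp \<gamma> \<beta> < q_exp \<gamma> \<alpha> + 1" by (rule order_tendstoD(2)[OF qt]) simp
  moreover have "\<forall>\<^sub>F \<beta> in nhds \<alpha>. 0 < \<beta>" using \<alpha> by (rule eventually_nhds_in_open[OF open_greaterThan, simplified])
  ultimately have "\<forall>\<^sub>F \<beta> in nhds \<alpha>. shell_decay (real n) (q_exp \<gamma> \<beta>) ((real n - \<beta>) / 2) \<rho> \<in> U \<and>
      q_exp \<gamma> \<beta> < \<rho> \<and> q_exp \<gamma> \<beta> < q_exp \<gamma> \<alpha> + 1 \<and> 0 < \<beta>"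
    by (intro eventually_conj) assumption+
  then show thesis using that by (auto simp: eventually_nhds_metric dist_real_def)
qed

lemma tails_boundedI:
  assumes K: "0 \<le> K1" "0 \<le> K2"
    and 1: "\<And>R. 1 \<le> R \<Longrightarrow> (\<integral>\<^sup>+x. ennreal (\<bar>v (norm x)\<bar> powr r) * indicator {x. R < norm x} x \<partial>(lborel :: 'a::euclidean_space measure)) \<le> ennreal (K1 * R powr (- \<tau>1))"
    and 2: "\<And>R. 1 \<le> R \<Longrightarrow> radial_mass TYPE('a) v r (shell 0 (1 / R)) \<le> ennreal (K2 * R powr (- \<tau>2))"
  shows "tails_bounded v TYPE('a) r (max K1 K2) (min \<tau>1 \<tau>2)"
proof -
  have "ennreal (K1 * R powr (- \<tau>1)) \<le> ennreal (max K1 K2 * R powr (- min \<tau>1 \<tau>2))"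
    "ennreal (K2 * R powr (- \<tau>2)) \<le> ennreal (max K1 K2 * R powr (- min \<tau>1 \<tau>2))" if "1 \<le> R" for R
    using that K by (auto intro!: ennreal_leI mult_mono powr_mono)
  then show ?thesis unfolding tails_bounded_def using 1 2 order_trans by blast
qed

lemma half_power_le:
  fixes R e :: real assumes "1 \<le> R" "0 < e" shows "(1 / (2 * R)) powr e \<le> R powr (- e)"
proof -
  have "(1 / (2 * R)) powr e \<le> (1 / R) powr e" using assms by (intro powr_mono2) (auto simp: field_simps)
  also have "\<dots> = R powr (- e)" using assms by (simp add: powr_divide powr_minus_divide)
  finally show ?thesis .
qed

section \<open>Tails below and above the critical exponent\<close>

lemma uniform_tails_subcritical:
  fixes \<gamma> \<alpha> r :: real
  assumes dim: "DIM('a::euclidean_space) \<ge> 3" and \<gamma>: "\<gamma> > 0" and \<alpha>: "0 < \<alpha>" "\<alpha> < real DIM('a)"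
    and r: "q_rad DIM('a) \<gamma> \<alpha> < r" "r < sobolev_exp DIM('a)"
  shows "\<forall>\<^sub>F \<delta> in at_right 0. uniform_tails TYPE('a) \<gamma> \<alpha> r \<delta>"
proof -
  let ?n = "DIM('a)"
  let ?h = "\<lambda>\<beta>. shell_decay (real ?n) (q_exp \<gamma> \<beta>) ((real ?n - \<beta>) / 2) r"
  \<comment> \<open>Half the rate at \<alpha>, so that continuity leaves a rate above \<tau> for all
    nearby \<beta>.\<close>
  define \<tau> where "\<tau> = ?h \<alpha> / 2"
  define Q where "Q = q_exp \<gamma> \<alpha> + 1"
  have q\<alpha>: "q_exp \<gamma> \<alpha> > 1" by (rule q_exp_gt_1[OF \<gamma> \<alpha>(1)])
  have "?h \<alpha> > 0" unfolding shell_decay_eq[OF \<gamma> \<alpha> dim] using r(1) q\<alpha> \<alpha> dim by (intro mult_pos_pos divide_pos_pos) auto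
  then have \<tau>: "0 < \<tau>" "\<tau> < ?h \<alpha>" by (auto simp: \<tau>_def)
  have "q_exp \<gamma> \<alpha> < r" using r(1) q_rad_greater[OF \<gamma> \<alpha> dim] by simp
  then obtain \<delta>0 where \<delta>0: "\<delta>0 > 0" "\<And>\<beta>. \<bar>\<beta> - \<alpha>\<bar> < \<delta>0 \<Longrightarrow> ?h \<beta> \<in> {\<tau><..} \<and> q_exp \<gamma> \<beta> < r \<and> q_exp \<gamma> \<beta> < Q \<and> 0 < \<beta>"
    unfolding Q_def by (rule exponent_neighbourhood[where U = "{\<tau><..}" and n = ?n, OF \<gamma> \<alpha>(1)]) (use \<tau>(2) in auto)
  have main: "uniform_tails TYPE('a) \<gamma> \<alpha> r \<delta>" if \<delta>: "\<delta> < \<delta>0" for \<delta>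
    unfolding uniform_tails_def
  proof (intro allI impI)
    fix CJ :: real assume CJ: "0 \<le> CJ"
    define L where "L = max 1 (2 powr Q * CJ / (sphere_area ?n * length_const ?n))"
    define K1 where "K1 = L powr r * CJ / (1 - 2 powr (- \<tau>))"
    define s where "s = r * (real ?n - 2) / 2"
    have s: "s < real ?n" using r(2) dim by (simp add: s_def sobolev_exp_def field_simps)
    define K2 where "K2 = decay_const ?n powr r * (power_const ?n s / (1 - 2 powr (s - real ?n)))"
    have K1: "K1 \<ge> 0" using CJ two_powr_neg_less_1[OF \<tau>(1)] by (simp add: K1_def)
    have K2: "K2 \<ge> 0" using power_const_pos[of ?n s] two_powr_neg_less_1[of "real ?n - s"] s by (simp add: K2_def)
    have r0: "r \<ge> 0" using r(1) q_rad_greater[OF \<gamma> \<alpha> dim] q\<alpha> by linarith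
    have "tails_bounded v TYPE('a) r (max K1 K2) (min \<tau> (real ?n - s))"
      if "radial_profile v g" "\<bar>\<beta> - \<alpha>\<bar> < \<delta>" "mass_bounded v TYPE('a) (q_exp \<gamma> \<beta>) ((real ?n - \<beta>) / 2) CJ" for v and g :: "'a \<Rightarrow> real" and \<beta>
    proof (rule tails_boundedI[OF K1 K2])
      interpret radial_profile v g by fact
      have b: "\<tau> < ?h \<beta>" "q_exp \<gamma> \<beta> < r" "q_exp \<gamma> \<beta> < Q" "0 < \<beta>" using \<delta>0(2)[of \<beta>] that(2) \<delta> by auto
      fix R :: real assume R: "1 \<le> R"
      have "radial_mass TYPE('a) v r {x. R < norm x}
          \<le> ennreal (L powr r * CJ * R powr (- \<tau>) / (1 - 2 powr (- \<tau>)))"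
      proof (rule outer_tail[where Q = Q and L = L, OF that(3) _ _ _ CJ])
        show "(real ?n - \<beta>) / 2 \<le> 2 * real ?n - 2" using n3 b(4) by (simp add: field_simps)
      qed (use b q_exp_gt_1[OF \<gamma> b(4)] \<tau>(1) R in \<open>auto simp: L_def\<close>)
      then show "radial_mass TYPE('a) v r {x. R < norm x} \<le> ennreal (K1 * R powr (- \<tau>))"
        by (simp add: K1_def)
      \<comment> \<open>The inner estimate is stated for \<open>shell 0 (2 * R)\<close>, hence it is
        used with 1 / (2 * R) in the place of R.\<close>
      have "radial_mass TYPE('a) v r (shell 0 (1 / R))
          \<le> ennreal (decay_const ?n powr r * (power_const ?n s * (1 / (2 * R)) powr (real ?n - s) / (1 - 2 powr (s - real ?n))))"
        using nn_integral_inner_power[of "1 / (2 * R)" r] R r0 s by (simp add: s_def)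
      also have "\<dots> = ennreal (K2 * (1 / (2 * R)) powr (real ?n - s))" by (simp add: K2_def mult.assoc)
      also have "\<dots> \<le> ennreal (K2 * R powr (- (real ?n - s)))"
        using half_power_le[OF R, of "real ?n - s"] s K2 by (intro ennreal_leI mult_left_mono) auto
      finally show "radial_mass TYPE('a) v r (shell 0 (1 / R)) \<le> ennreal (K2 * R powr (- (real ?n - s)))" .
    qed
    moreover have "max K1 K2 \<ge> 0" "min \<tau> (real ?n - s) > 0" using K1 \<tau>(1) s by auto
    ultimately show "\<exists>K\<ge>0. \<exists>\<tau>>0. \<forall>v (g :: 'a \<Rightarrow> real) \<beta>. radial_profile v g \<longrightarrow> \<bar>\<beta> - \<alpha>\<bar> < \<delta> \<longrightarrow>
      mass_bounded v TYPE('a) (q_exp \<gamma> \<beta>) ((real ?n - \<beta>) / 2) CJ \<longrightarrow> tails_bounded v TYPE('a) r K \<tau>"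
      by blast
  qed
  show ?thesis unfolding eventually_at_right_field
    by (rule exI[of _ \<delta>0]) (use \<delta>0(1) main in blast)
qed

text \<open>Since \<open>r \<le> q\<close> is possible here, the shell estimate is applied to some \<open>\<rho>\<close> with
  \<open>max r q < \<rho> < q\<^sub>r\<^sub>a\<^sub>d\<close>, and \<open>\<bar>v\<bar>\<^sup>r \<le> 1 + \<bar>v\<bar>\<^sup>\<rho>\<close>.\<close>

lemma uniform_tails_supercritical:
  fixes \<gamma> \<alpha> r :: real
  assumes dim: "DIM('a::euclidean_space) \<ge> 3" and \<gamma>: "\<gamma> > 0" and \<alpha>: "0 < \<alpha>" "\<alpha> < real DIM('a)"
    and r: "sobolev_exp DIM('a) < r" "r < q_rad DIM('a) \<gamma> \<alpha>"
  shows "\<forall>\<^sub>F \<delta> in at_right 0. uniform_tails TYPE('a) \<gamma> \<alpha> r \<delta>"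
proof -
  let ?n = "DIM('a)"
  define \<rho> where "\<rho> = (max r (q_exp \<gamma> \<alpha>) + q_rad ?n \<gamma> \<alpha>) / 2"
  have \<rho>: "r < \<rho>" "q_exp \<gamma> \<alpha> < \<rho>" "\<rho> < q_rad ?n \<gamma> \<alpha>"
    using r(2) q_rad_greater[OF \<gamma> \<alpha> dim] by (auto simp: \<rho>_def max_def)
  let ?h = "\<lambda>\<beta>. shell_decay (real ?n) (q_exp \<gamma> \<beta>) ((real ?n - \<beta>) / 2) \<rho>"
  define \<tau> where "\<tau> = - ?h \<alpha> / 2"
  define Q where "Q = q_exp \<gamma> \<alpha> + 1"
  have q\<alpha>: "q_exp \<gamma> \<alpha> > 1" by (rule q_exp_gt_1[OF \<gamma> \<alpha>(1)])
  have "?h \<alpha> < 0" unfolding shell_decay_eq[OF \<gamma> \<alpha> dim] using \<rho>(3) q\<alpha> \<alpha> dim by (intro mult_pos_neg divide_pos_pos) auto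
  then have \<tau>: "0 < \<tau>" "?h \<alpha> < - \<tau>" by (auto simp: \<tau>_def)
  have "q_exp \<gamma> \<alpha> < \<rho>" by (rule \<rho>(2))
  then obtain \<delta>0 where \<delta>0: "\<delta>0 > 0" "\<And>\<beta>. \<bar>\<beta> - \<alpha>\<bar> < \<delta>0 \<Longrightarrow> ?h \<beta> \<in> {..<- \<tau>} \<and> q_exp \<gamma> \<beta> < \<rho> \<and> q_exp \<gamma> \<beta> < Q \<and> 0 < \<beta>"
    unfolding Q_def by (rule exponent_neighbourhood[where U = "{..<- \<tau>}" and n = ?n, OF \<gamma> \<alpha>(1)]) (use \<tau>(2) in auto)
  have main: "uniform_tails TYPE('a) \<gamma> \<alpha> r \<delta>" if \<delta>: "\<delta> < \<delta>0" for \<delta>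
    unfolding uniform_tails_def
  proof (intro allI impI)
    fix CJ :: real assume CJ: "0 \<le> CJ"
    define L where "L = max 1 (2 powr Q * CJ / (sphere_area ?n * length_const ?n))"
    define K1 where "K1 = L powr \<rho> * CJ / (1 - 2 powr (- \<tau>))"
    define s where "s = r * (real ?n - 2) / 2"
    have s: "s > real ?n" using r(1) dim by (simp add: s_def sobolev_exp_def field_simps)
    define K2 where "K2 = decay_const ?n powr r * (power_const ?n s / (1 - 2 powr (real ?n - s)))"
    have K1: "K1 \<ge> 0" using CJ two_powr_neg_less_1[OF \<tau>(1)] by (simp add: K1_def)
    have K2: "K2 \<ge> 0" using power_const_pos[of ?n s] two_powr_neg_less_1[of "s - real ?n"] s by (simp add: K2_def)
    have "sobolev_exp ?n > 0" using dim by (simp add: sobolev_exp_def)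
    then have r0: "r \<ge> 0" using r(1) by linarith
    define K3 where "K3 = unit_ball_vol (real ?n) + K1"
    have K3: "K3 \<ge> 0" using K1 by (simp add: K3_def)
    \<comment> \<open>The rate n comes from the volume of the ball of radius 1 / R, which bounds the
      summand 1; the rate \<tau> comes from the shell estimate for \<rho>.\<close>
    define \<sigma> where "\<sigma> = min (real ?n) \<tau>"
    have \<sigma>: "\<sigma> > 0" using \<tau>(1) by (simp add: \<sigma>_def)
    have "tails_bounded v TYPE('a) r (max K2 K3) (min (s - real ?n) \<sigma>)"
      if "radial_profile v g" "\<bar>\<beta> - \<alpha>\<bar> < \<delta>" "mass_bounded v TYPE('a) (q_exp \<gamma> \<beta>) ((real ?n - \<beta>) / 2) CJ" for v and g :: "'a \<Rightarrow> real" and \<beta>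
    proof (rule tails_boundedI[OF K2 K3])
      interpret radial_profile v g by fact
      have b: "?h \<beta> < - \<tau>" "q_exp \<gamma> \<beta> < \<rho>" "q_exp \<gamma> \<beta> < Q" "0 < \<beta>" using \<delta>0(2)[of \<beta>] that(2) \<delta> by auto
      fix R :: real assume R: "1 \<le> R"
      show "radial_mass TYPE('a) v r {x. R < norm x} \<le> ennreal (K2 * R powr (- (s - real ?n)))"
        using nn_integral_outer_power[of R r] R r0 s by (simp add: s_def K2_def mult.assoc)
      have "radial_mass TYPE('a) v r (shell 0 (1 / R))
          \<le> (\<integral>\<^sup>+x. indicator (shell 0 (1 / R)) x + ennreal (\<bar>v (norm x)\<bar> powr \<rho>) * indicator (shell 0 (2 * (1 / (2 * R)))) x \<partial>(lborel :: 'a measure))"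
      proof (rule nn_integral_mono)
        fix x :: 'a
        have "\<bar>v (norm x)\<bar> powr r \<le> 1 + \<bar>v (norm x)\<bar> powr \<rho>"
        proof (cases "\<bar>v (norm x)\<bar> \<le> 1")
          case True
          then have "\<bar>v (norm x)\<bar> powr r \<le> 1" using r0 by (intro powr_le1) auto
          then show ?thesis by (simp add: add_increasing2)
        next
          case False
          then have "\<bar>v (norm x)\<bar> powr r \<le> \<bar>v (norm x)\<bar> powr \<rho>" using \<rho>(1) by (intro powr_mono) auto
          then show ?thesis by simp
        qed
        then have "ennreal (\<bar>v (norm x)\<bar> powr r) \<le> ennreal (1 + \<bar>v (norm x)\<bar> powr \<rho>)" by (rule ennreal_leI)
        also have "\<dots> = 1 + ennreal (\<bar>v (norm x)\<bar> powr \<rho>)" by (subst ennreal_plus) auto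
        finally show "ennreal (\<bar>v (norm x)\<bar> powr r) * indicator (shell 0 (1 / R)) x
          \<le> indicator (shell 0 (1 / R)) x + ennreal (\<bar>v (norm x)\<bar> powr \<rho>) * indicator (shell 0 (2 * (1 / (2 * R)))) x"
          using R by (auto split: split_indicator)
      qed
      also have "\<dots> = emeasure lborel (shell 0 (1 / R) :: 'a set) + (\<integral>\<^sup>+x. ennreal (\<bar>v (norm x)\<bar> powr \<rho>) * indicator (shell 0 (2 * (1 / (2 * R)))) x \<partial>(lborel :: 'a measure))"
        by (subst nn_integral_add) auto
      also have "\<dots> \<le> ennreal (unit_ball_vol (real ?n) * R powr (- \<sigma>)) + ennreal (K1 * R powr (- \<sigma>))"
      proof (rule add_mono)
        have "(1 / R) ^ ?n = R powr (- real ?n)" using R by (simp add: powr_minus_divide powr_realpow power_one_over)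
        also have "\<dots> \<le> R powr (- \<sigma>)" using R by (intro powr_mono) (auto simp: \<sigma>_def)
        finally show "emeasure lborel (shell 0 (1 / R) :: 'a set) \<le> ennreal (unit_ball_vol (real ?n) * R powr (- \<sigma>))"
          using R by (subst emeasure_shell) (auto intro!: ennreal_leI mult_left_mono simp: power_0_left)
        have "(\<integral>\<^sup>+x. ennreal (\<bar>v (norm x)\<bar> powr \<rho>) * indicator (shell 0 (2 * (1 / (2 * R)))) x \<partial>(lborel :: 'a measure))
            \<le> ennreal (L powr \<rho> * CJ * (1 / (2 * R)) powr \<tau> / (1 - 2 powr (- \<tau>)))"
        proof (rule inner_tail[where Q = Q and L = L, OF that(3) _ _ _ CJ])
          show "(real ?n - \<beta>) / 2 \<le> 2 * real ?n - 2" using n3 b(4) by (simp add: field_simps)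
        qed (use b q_exp_gt_1[OF \<gamma> b(4)] \<tau>(1) R in \<open>auto simp: L_def\<close>)
        also have "\<dots> = ennreal (K1 * (1 / (2 * R)) powr \<tau>)" by (simp add: K1_def)
        also have "\<dots> \<le> ennreal (K1 * R powr (- \<sigma>))"
        proof (intro ennreal_leI mult_left_mono K1)
          have "(1 / (2 * R)) powr \<tau> \<le> R powr (- \<tau>)" by (rule half_power_le[OF R \<tau>(1)])
          also have "\<dots> \<le> R powr (- \<sigma>)" using R by (intro powr_mono) (auto simp: \<sigma>_def)
          finally show "(1 / (2 * R)) powr \<tau> \<le> R powr (- \<sigma>)" .
        qed
        finally show "(\<integral>\<^sup>+x. ennreal (\<bar>v (norm x)\<bar> powr \<rho>) * indicator (shell 0 (2 * (1 / (2 * R)))) x \<partial>(lborel :: 'a measure)) \<le> ennreal (K1 * R powr (- \<sigma>))" .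
      qed
      also have "\<dots> = ennreal (K3 * R powr (- \<sigma>))"
        using K1 by (subst ennreal_plus[symmetric]) (auto simp: K3_def distrib_right)
      finally show "radial_mass TYPE('a) v r (shell 0 (1 / R)) \<le> ennreal (K3 * R powr (- \<sigma>))" .
    qed
    moreover have "max K2 K3 \<ge> 0" "min (s - real ?n) \<sigma> > 0" using K2 \<sigma> s by auto
    ultimately show "\<exists>K\<ge>0. \<exists>\<tau>>0. \<forall>v (g :: 'a \<Rightarrow> real) \<beta>. radial_profile v g \<longrightarrow> \<bar>\<beta> - \<alpha>\<bar> < \<delta> \<longrightarrow>
      mass_bounded v TYPE('a) (q_exp \<gamma> \<beta>) ((real ?n - \<beta>) / 2) CJ \<longrightarrow> tails_bounded v TYPE('a) r K \<tau>"
      by blast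
  qed
  show ?thesis unfolding eventually_at_right_field
    by (rule exI[of _ \<delta>0]) (use \<delta>0(1) main in blast)
qed

lemma nn_integral_le_tails:
  fixes v :: "real \<Rightarrow> real"
  assumes [measurable]: "v \<in> borel_measurable borel" and K: "K \<ge> 0" and t: "tails_bounded v TYPE('a::euclidean_space) r K \<tau>"
  shows "(\<integral>\<^sup>+x. ennreal (\<bar>v (norm x)\<bar> powr r) \<partial>(lborel :: 'a measure)) \<le> ennreal (2 * K)"
proof -
  have "(\<integral>\<^sup>+x. ennreal (\<bar>v (norm x)\<bar> powr r) \<partial>(lborel :: 'a measure))
     \<le> (\<integral>\<^sup>+x. ennreal (\<bar>v (norm x)\<bar> powr r) * indicator {x. 1 < norm x} x + ennreal (\<bar>v (norm x)\<bar> powr r) * indicator (shell 0 (1 / 1)) x \<partial>(lborel :: 'a measure))"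
    using AE_lborel_singleton[of "0::'a"] by (intro nn_integral_mono_AE, eventually_elim) (auto split: split_indicator)
  also have "\<dots> = radial_mass TYPE('a) v r {x. 1 < norm x}
      + radial_mass TYPE('a) v r (shell 0 (1 / 1))"
    by (rule nn_integral_add) measurable
  also have "\<dots> \<le> ennreal (K * 1 powr (- \<tau>)) + ennreal (K * 1 powr (- \<tau>))"
    using t unfolding tails_bounded_def by (intro add_mono) auto
  also have "\<dots> = ennreal (2 * K)" using K by (simp add: ennreal_plus[symmetric] del: ennreal_plus)
  finally show ?thesis .
qed

subsection \<open>Compactness\<close>

text \<open>The Arzela--Ascoli scheme: a diagonal choice over the positive rationals, then
  equicontinuity at the other radii. The weight t^((n-2)/2) makes the decay a single bound for all
  rationals, as the diagonal argument demands.\<close>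

lemma radial_profiles_convergent_subsequence:
  fixes v :: "nat \<Rightarrow> real \<Rightarrow> real" and g :: "nat \<Rightarrow> 'a::euclidean_space \<Rightarrow> real"
  assumes prof: "\<And>k. radial_profile (v k) (g k)"
  obtains s :: "nat \<Rightarrow> nat" and V where "strict_mono s" "\<And>t. (\<lambda>k. v (s k) t) \<longlonglongrightarrow> V t"
proof -
  let ?n = "DIM('a)" and ?w = "sphere_area DIM('a)"
  interpret p0: radial_profile "v 0" "g 0" by (rule prof)
  have n3: "real ?n \<ge> 3" by (rule p0.n3)
  have w: "?w > 0" by (rule p0.area_pos)
  define S where "S = \<rat> \<inter> {0::real<..}"
  have bd: "\<bar>t powr ((real ?n - 2) / 2) * v k t\<bar> \<le> decay_const ?n" if "t \<in> S" for k t
  proof -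
    have t: "t > 0" using that by (simp add: S_def)
    have "\<bar>t powr ((real ?n - 2) / 2) * v k t\<bar> = t powr ((real ?n - 2) / 2) * \<bar>v k t\<bar>" by (simp add: abs_mult)
    also have "\<dots> \<le> t powr ((real ?n - 2) / 2) * (decay_const ?n * t powr (- ((real ?n - 2) / 2)))"
      by (intro mult_left_mono radial_profile.decay[OF prof t]) simp
    also have "\<dots> = decay_const ?n * (t powr ((real ?n - 2) / 2) * t powr (- ((real ?n - 2) / 2)))" by simp
    also have "t powr ((real ?n - 2) / 2) * t powr (- ((real ?n - 2) / 2)) = 1" using t by (simp only: powr_add[symmetric]) simp
    finally show ?thesis by simp
  qed
  have cnt: "countable S" unfolding S_def by (intro countable_Int1 countable_rat)
  obtain s where s: "strict_mono s" "\<And>t. t \<in> S \<Longrightarrow> \<exists>l. (\<lambda>k. t powr ((real ?n - 2) / 2) * v (s k) t) \<longlonglongrightarrow> l"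
    by (rule function_convergent_subsequence[OF cnt, of "\<lambda>k t. t powr ((real ?n - 2) / 2) * v k t" "decay_const ?n"])
      (use bd in auto)
  have rat: "Cauchy (\<lambda>k. v (s k) t)" if t: "t \<in> S" for t
  proof -
    obtain l where "(\<lambda>k. t powr ((real ?n - 2) / 2) * v (s k) t) \<longlonglongrightarrow> l" using s(2)[OF t] by blast
    then have "(\<lambda>k. (t powr ((real ?n - 2) / 2) * v (s k) t) / t powr ((real ?n - 2) / 2)) \<longlonglongrightarrow> l / t powr ((real ?n - 2) / 2)"
      using t by (intro tendsto_divide tendsto_const) (auto simp: S_def)
    moreover have "(t powr ((real ?n - 2) / 2) * v (s k) t) / t powr ((real ?n - 2) / 2) = v (s k) t" for k
      using t by (simp add: S_def)
    ultimately show ?thesis by (simp add: LIMSEQ_imp_Cauchy)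
  qed
  have conv: "convergent (\<lambda>k. v (s k) t)" for t
  proof (cases "t > 0")
    case False
    then have "v (s k) t = 0" for k using radial_profile.v_nonpos[OF prof] by simp
    then show ?thesis by (simp add: convergent_const)
  next
    case True
    define a where "a = 2 * t / 3"
    have a: "0 < a" "a < t" "t < 2 * a" using True by (auto simp: a_def)
    define C where "C = ?w * 2 ^ (?n - 1) * a powr (1 - real ?n)"
    have C: "C > 0" using w a by (simp add: C_def)
    have "Cauchy (\<lambda>k. v (s k) t)"
    proof (rule metric_CauchyI)
      fix e :: real assume e: "0 < e"
      \<comment> \<open>The first term keeps p inside [a, 2a], the second solves the Hoelder bound
        for an error of e / 3.\<close>
      define \<eta> where "\<eta> = min (2 * a - t) ((?w * (e / 3))\<^sup>2 / C)"
      have \<eta>: "\<eta> > 0" using a C w e by (simp add: \<eta>_def)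
      obtain p where p: "p \<in> \<rat>" "t < p" "p < t + \<eta>" using Rats_dense_in_real[of t "t + \<eta>"] \<eta> by auto
      have close: "\<bar>v k t - v k p\<bar> \<le> e / 3" for k
      proof -
        have "\<bar>v k t - v k p\<bar> \<le> sqrt (C * \<bar>t - p\<bar>) / ?w"
          unfolding C_def by (rule radial_profile.equicontinuity[OF prof a(1)]) (use a p in \<open>auto simp: \<eta>_def\<close>)
        also have "\<dots> \<le> (?w * (e / 3)) / ?w"
        proof (intro divide_right_mono real_le_lsqrt)
          have "\<bar>t - p\<bar> \<le> (?w * (e / 3))\<^sup>2 / C" using p by (simp add: \<eta>_def)
          then show "C * \<bar>t - p\<bar> \<le> (?w * (e / 3))\<^sup>2" using C by (simp add: field_simps)
        qed (use w e C in auto)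
        finally show ?thesis using w by simp
      qed
      have "p \<in> S" using p True by (simp add: S_def)
      from metric_CauchyD[OF rat[OF this], of "e / 3"] e obtain M where
        M: "\<And>i j. i \<ge> M \<Longrightarrow> j \<ge> M \<Longrightarrow> \<bar>v (s i) p - v (s j) p\<bar> < e / 3" by (auto simp: dist_real_def)
      have "dist (v (s i) t) (v (s j) t) < e" if "i \<ge> M" "j \<ge> M" for i j
        using M[OF that] close[of "s i"] close[of "s j"] unfolding dist_real_def by linarith
      then show "\<exists>M. \<forall>i\<ge>M. \<forall>j\<ge>M. dist (v (s i) t) (v (s j) t) < e" by blast
    qed
    then show ?thesis by (rule Cauchy_convergent)
  qed
  show thesis
    by (rule that[OF s(1), of "\<lambda>t. lim (\<lambda>k. v (s k) t)"]) (use conv in \<open>simp add: convergent_LIMSEQ_iff\<close>)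
qed

lemma nn_integral_limit_le:
  fixes f :: "nat \<Rightarrow> 'b \<Rightarrow> ennreal"
  assumes "\<And>k. f k \<in> borel_measurable M" "\<And>x. (\<lambda>k. f k x) \<longlonglongrightarrow> F x" "\<And>k. (\<integral>\<^sup>+x. f k x \<partial>M) \<le> B"
  shows "(\<integral>\<^sup>+x. F x \<partial>M) \<le> B"
proof -
  have "(\<integral>\<^sup>+x. F x \<partial>M) = (\<integral>\<^sup>+x. liminf (\<lambda>k. f k x) \<partial>M)"
    by (intro nn_integral_cong lim_imp_Liminf[symmetric] assms(2)) simp
  also have "\<dots> \<le> liminf (\<lambda>k. \<integral>\<^sup>+x. f k x \<partial>M)" by (rule nn_integral_liminf) (rule assms(1))
  also have "\<dots> \<le> liminf (\<lambda>k::nat. B)" by (intro Liminf_mono always_eventually allI assms(3))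
  also have "\<dots> = B" by (intro Liminf_const) simp
  finally show ?thesis .
qed

lemma powr_diff_le:
  fixes a b r :: real assumes "r > 0"
  shows "\<bar>a - b\<bar> powr r \<le> 2 powr r * (\<bar>a\<bar> powr r + \<bar>b\<bar> powr r)"
proof -
  have "\<bar>a - b\<bar> powr r \<le> (2 * max \<bar>a\<bar> \<bar>b\<bar>) powr r" using assms by (intro powr_mono2) auto
  also have "\<dots> = 2 powr r * max \<bar>a\<bar> \<bar>b\<bar> powr r" by (simp add: powr_mult)
  also have "\<dots> \<le> 2 powr r * (\<bar>a\<bar> powr r + \<bar>b\<bar> powr r)"
    by (intro mult_left_mono) (auto simp: max_def)
  finally show ?thesis .
qed

lemma tendsto_0_ennrealI:
  fixes f :: "nat \<Rightarrow> ennreal"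
  assumes "\<And>e::real. e > 0 \<Longrightarrow> \<forall>\<^sub>F k in sequentially. f k \<le> ennreal e"
  shows "f \<longlonglongrightarrow> 0"
proof (rule order_tendstoI)
  fix y :: ennreal assume "0 < y"
  then obtain z where z: "0 < z" "z < y" using dense by blast
  then obtain e where "z = ennreal e" "e \<ge> 0" by (cases z) auto
  with z have e: "e > 0" "ennreal e < y" by auto
  show "\<forall>\<^sub>F k in sequentially. f k < y"
    using assms[OF e(1)] by eventually_elim (use e(2) in \<open>auto elim: le_less_trans\<close>)
qed simp

text \<open>Fatou's lemma passes the tail bounds to V. Both tails are then small uniformly in k, and
  on the shell between them the decay supplies a constant dominating function.\<close>

lemma tails_compactness:
  fixes v :: "nat \<Rightarrow> real \<Rightarrow> real" and g :: "nat \<Rightarrow> 'a::euclidean_space \<Rightarrow> real"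
  assumes prof: "\<And>k. radial_profile (v k) (g k)" and lim: "\<And>t. (\<lambda>k. v k t) \<longlonglongrightarrow> V t"
    and K: "K \<ge> 0" "\<tau> > 0" "r > 0" and tails: "\<And>k. tails_bounded (v k) TYPE('a) r K \<tau>"
  shows "V \<in> borel_measurable borel" "tails_bounded V TYPE('a) r K \<tau>"
    "(\<lambda>k. \<integral>\<^sup>+x. ennreal (\<bar>v k (norm x) - V (norm x)\<bar> powr r) \<partial>(lborel :: 'a measure)) \<longlonglongrightarrow> 0"
proof -
  let ?n = "DIM('a)" and ?D = "decay_const DIM('a)"
  interpret p0: radial_profile "v 0" "g 0" by (rule prof)
  have [measurable]: "v k \<in> borel_measurable borel" for k by (rule radial_profile.v_meas[OF prof])
  show V[measurable]: "V \<in> borel_measurable borel"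
    by (rule borel_measurable_LIMSEQ_real[OF lim]) measurable
  have pw: "(\<lambda>k. \<bar>v k t\<bar> powr r) \<longlonglongrightarrow> \<bar>V t\<bar> powr r" for t
    by (intro tendsto_powr' tendsto_rabs lim tendsto_const) (use K(3) in auto)
  have fatou: "radial_mass TYPE('a) V r A \<le> B"
    if [measurable]: "A \<in> sets borel" and B: "\<And>k. radial_mass TYPE('a) (v k) r A \<le> B" for A B
  proof (rule nn_integral_limit_le[OF _ _ B])
    show "(\<lambda>k. ennreal (\<bar>v k (norm x)\<bar> powr r) * indicator A x) \<longlonglongrightarrow> ennreal (\<bar>V (norm x)\<bar> powr r) * indicator A x" for x :: 'a
      using pw[of "norm x"] by (auto split: split_indicator)
  qed measurable
  show tV: "tails_bounded V TYPE('a) r K \<tau>"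
    using tails fatou unfolding tails_bounded_def by auto
  let ?d = "\<lambda>k x. ennreal (\<bar>v k (norm x) - V (norm x)\<bar> powr r)"
  show "(\<lambda>k. \<integral>\<^sup>+x. ?d k x \<partial>(lborel :: 'a measure)) \<longlonglongrightarrow> 0"
  proof (rule tendsto_0_ennrealI)
    fix e :: real assume e: "e > 0"
    \<comment> \<open>Two tails, each bounded by 2^r (K + K) R^(-\<tau>) through
      \<open>powr_diff_le\<close>.\<close>
    define c where "c = 2 * (2 powr r * (2 * K))"
    have c: "c \<ge> 0" using K(1) by (simp add: c_def)
    have "((\<lambda>R. c * R powr (- \<tau>)) \<longlongrightarrow> c * 0) at_top"
      by (intro tendsto_mult tendsto_const tendsto_powr_neg_at_top K)
    then have "\<forall>\<^sub>F R in at_top. c * R powr (- \<tau>) < e / 2" using e by (intro order_tendstoD) auto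
    then have "\<forall>\<^sub>F R in at_top. 1 \<le> R \<and> c * R powr (- \<tau>) < e / 2"
      using eventually_ge_at_top[of "1::real"] by (rule eventually_conj[rotated])
    then obtain R where R: "1 \<le> R" "c * R powr (- \<tau>) < e / 2"
      by (auto simp: eventually_at_top_linorder)
    have tail: "(\<integral>\<^sup>+x. ?d k x * indicator A x \<partial>(lborel :: 'a measure)) \<le> ennreal (2 powr r * (2 * K) * R powr (- \<tau>))"
      if [measurable]: "A \<in> sets borel" and A: "radial_mass TYPE('a) (v k) r A \<le> ennreal (K * R powr (- \<tau>))"
        "radial_mass TYPE('a) V r A \<le> ennreal (K * R powr (- \<tau>))" for A k
    proof -
      have "(\<integral>\<^sup>+x. ?d k x * indicator A x \<partial>(lborel :: 'a measure))
        \<le> (\<integral>\<^sup>+x. ennreal (2 powr r) * (ennreal (\<bar>v k (norm x)\<bar> powr r) * indicator A x + ennreal (\<bar>V (norm x)\<bar> powr r) * indicator A x) \<partial>(lborel :: 'a measure))"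
      proof (rule nn_integral_mono)
        fix x :: 'a
        have "?d k x \<le> ennreal (2 powr r * (\<bar>v k (norm x)\<bar> powr r + \<bar>V (norm x)\<bar> powr r))"
          by (intro ennreal_leI powr_diff_le K)
        also have "\<dots> = ennreal (2 powr r) * (ennreal (\<bar>v k (norm x)\<bar> powr r) + ennreal (\<bar>V (norm x)\<bar> powr r))"
          by (subst ennreal_mult) (auto simp: ennreal_plus)
        finally show "?d k x * indicator A x \<le> ennreal (2 powr r) * (ennreal (\<bar>v k (norm x)\<bar> powr r) * indicator A x + ennreal (\<bar>V (norm x)\<bar> powr r) * indicator A x)"
          by (auto split: split_indicator)
      qed
      also have "\<dots> = ennreal (2 powr r) * (radial_mass TYPE('a) (v k) r A + radial_mass TYPE('a) V r A)"
        by (subst nn_integral_cmult, measurable, subst nn_integral_add) auto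
      also have "\<dots> \<le> ennreal (2 powr r) * (ennreal (K * R powr (- \<tau>)) + ennreal (K * R powr (- \<tau>)))"
        by (intro mult_left_mono add_mono A) simp
      also have "\<dots> = ennreal (2 powr r * (2 * K) * R powr (- \<tau>))"
        using K(1) by (simp add: ennreal_plus[symmetric] ennreal_mult[symmetric] del: ennreal_plus)
      finally show ?thesis .
    qed
    let ?M = "shell (1 / R) R :: 'a set"
    \<comment> \<open>The decay bound at radius 1 / R, where it is largest on the middle
      shell.\<close>
    define B where "B = ?D * R powr ((real ?n - 2) / 2)"
    have B: "B \<ge> 0" using decay_const_pos[OF p0.dim] by (simp add: B_def less_imp_le)
    have vB: "\<bar>v k t\<bar> \<le> B" if "1 / R < t" for k t
    proof -
      have t: "t > 0" using that R(1) by (meson less_trans zero_less_divide_1_iff less_le_trans zero_less_one)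
      have "\<bar>v k t\<bar> \<le> ?D * t powr (- ((real ?n - 2) / 2))" by (rule radial_profile.decay[OF prof t])
      also have "\<dots> \<le> ?D * (1 / R) powr (- ((real ?n - 2) / 2))"
        using that R(1) p0.n3 decay_const_pos[OF p0.dim] by (intro mult_left_mono powr_mono2') auto
      also have "\<dots> = B" using R(1) by (simp add: B_def powr_divide powr_minus_divide)
      finally show ?thesis .
    qed
    have VB: "\<bar>V t\<bar> \<le> B" if "1 / R < t" for t
      by (rule LIMSEQ_le_const2[OF tendsto_rabs[OF lim]]) (use vB[OF that] in auto)
    have "(\<lambda>k. \<integral>\<^sup>+x. ?d k x * indicator ?M x \<partial>(lborel :: 'a measure)) \<longlonglongrightarrow> (\<integral>\<^sup>+x. 0 \<partial>(lborel :: 'a measure))"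
    proof (rule nn_integral_dominated_convergence[where w = "\<lambda>x. ennreal ((2 * B) powr r) * indicator ?M x"])
      show "(\<integral>\<^sup>+x. ennreal ((2 * B) powr r) * indicator ?M x \<partial>lborel) < \<infinity>"
      proof -
        have "1 / R \<le> 1" using R(1) by simp
        then have "1 / R \<le> R" using R(1) by linarith
        then show ?thesis using R(1) by (simp add: nn_integral_cmult_indicator emeasure_shell ennreal_mult_less_top)
      qed
      show "AE x in lborel. ?d k x * indicator ?M x \<le> ennreal ((2 * B) powr r) * indicator ?M x" for k
      proof (rule AE_I2)
        fix x :: 'a
        have "?d k x \<le> ennreal ((2 * B) powr r)" if "x \<in> ?M"
        proof (intro ennreal_leI powr_mono2)
          show "\<bar>v k (norm x) - V (norm x)\<bar> \<le> 2 * B"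
            using vB[of "norm x" k] VB[of "norm x"] that by auto
        qed (use K(3) in auto)
        then show "?d k x * indicator ?M x \<le> ennreal ((2 * B) powr r) * indicator ?M x"
          by (auto split: split_indicator)
      qed
      show "AE x in lborel. (\<lambda>k. ?d k x * indicator ?M x) \<longlonglongrightarrow> 0"
      proof (rule AE_I2)
        fix x :: 'a
        have "(\<lambda>k. \<bar>v k (norm x) - V (norm x)\<bar> powr r) \<longlonglongrightarrow> \<bar>V (norm x) - V (norm x)\<bar> powr r"
          by (intro tendsto_powr' tendsto_rabs tendsto_diff lim tendsto_const) (use K(3) in auto)
        then have "(\<lambda>k. ?d k x) \<longlonglongrightarrow> ennreal 0" by (intro tendsto_ennrealI) simp
        then show "(\<lambda>k. ?d k x * indicator ?M x) \<longlonglongrightarrow> 0" by (auto split: split_indicator)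
      qed
    qed measurable
    then have "\<forall>\<^sub>F k in sequentially. (\<integral>\<^sup>+x. ?d k x * indicator ?M x \<partial>(lborel :: 'a measure)) < ennreal (e / 2)"
      using e by (intro order_tendstoD(2)[where y = 0]) auto
    then show "\<forall>\<^sub>F k in sequentially. (\<integral>\<^sup>+x. ?d k x \<partial>(lborel :: 'a measure)) \<le> ennreal e"
    proof eventually_elim
      case (elim k)
      let ?O = "{x::'a. R < norm x}" and ?I = "shell 0 (1 / R) :: 'a set"
      have "(\<integral>\<^sup>+x. ?d k x \<partial>(lborel :: 'a measure)) \<le> (\<integral>\<^sup>+x. ?d k x * indicator ?O x + (?d k x * indicator ?I x + ?d k x * indicator ?M x) \<partial>lborel)"
        using AE_lborel_singleton[of "0::'a"] by (intro nn_integral_mono_AE, eventually_elim) (auto split: split_indicator)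
      also have "\<dots> = (\<integral>\<^sup>+x. ?d k x * indicator ?O x \<partial>lborel) + ((\<integral>\<^sup>+x. ?d k x * indicator ?I x \<partial>lborel) + (\<integral>\<^sup>+x. ?d k x * indicator ?M x \<partial>lborel))"
        by (subst nn_integral_add, measurable, subst nn_integral_add) auto
      also have "\<dots> \<le> ennreal (2 powr r * (2 * K) * R powr (- \<tau>)) + (ennreal (2 powr r * (2 * K) * R powr (- \<tau>)) + ennreal (e / 2))"
      proof (intro add_mono tail)
        show "(\<integral>\<^sup>+x. ?d k x * indicator ?M x \<partial>lborel) \<le> ennreal (e / 2)" using elim by simp
      qed (use tails[of k] tV R(1) in \<open>auto simp: tails_bounded_def\<close>)
      also have "\<dots> = ennreal (c * R powr (- \<tau>) + e / 2)"
        using K(1) e by (simp add: ennreal_plus[symmetric] c_def del: ennreal_plus)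
      also have "\<dots> \<le> ennreal e" using R(2) by (intro ennreal_leI) auto
      finally show ?case .
    qed
  qed
qed

subsection \<open>The embedding theorem\<close>

lemma Lp_norm_le_scaled:
  fixes u :: "'a::euclidean_space \<Rightarrow> real"
  assumes u: "u \<in> borel_measurable lebesgue" and L: "L > 0" and r: "r > 0" and K: "K \<ge> 0"
    and le: "(\<integral>\<^sup>+x. ennreal (\<bar>u x / L\<bar> powr r) \<partial>lebesgue) \<le> ennreal K"
  shows "u \<in> Lp_space r" "Lp_norm r u \<le> L * K powr (1 / r)"
proof -
  have m: "(\<lambda>x. \<bar>u x / L\<bar> powr r) \<in> borel_measurable lebesgue"
    using u by measurable
  have "(\<integral>\<^sup>+x. ennreal (norm (\<bar>u x / L\<bar> powr r)) \<partial>lebesgue) < \<infinity>"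
    using le by (auto simp: le_less_trans[OF _ ennreal_less_top])
  then have i: "integrable lebesgue (\<lambda>x. \<bar>u x / L\<bar> powr r)"
    by (intro integrableI_bounded m)
  have e: "norm (u x) powr r = L powr r * \<bar>u x / L\<bar> powr r" for x
    using L by (simp add: powr_mult[symmetric])
  have "integrable lebesgue (\<lambda>x. norm (u x) powr r)" unfolding e by (rule integrable_mult_right[OF i])
  then show "u \<in> Lp_space r" using u by (simp add: Lp_space_def)
  have "ennreal (\<integral>x. \<bar>u x / L\<bar> powr r \<partial>lebesgue) \<le> ennreal K"
    using le nn_integral_eq_integral[OF i] by simp
  then have le': "(\<integral>x. \<bar>u x / L\<bar> powr r \<partial>lebesgue) \<le> K" using K by simp
  have nn: "0 \<le> (\<integral>x. \<bar>u x / L\<bar> powr r \<partial>lebesgue)" by (rule integral_nonneg_AE) simp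
  have "Lp_norm r u = (L powr r * (\<integral>x. \<bar>u x / L\<bar> powr r \<partial>lebesgue)) powr (1 / r)"
    unfolding Lp_norm_def e by simp
  also have "\<dots> \<le> (L powr r * K) powr (1 / r)"
    using r nn le' by (intro powr_mono2 mult_left_mono) auto
  also have "\<dots> = L * K powr (1 / r)" using L r K by (simp add: powr_mult powr_powr)
  finally show "Lp_norm r u \<le> L * K powr (1 / r)" .
qed

text \<open>Here membership in \<open>P_set\<close> takes effect: the interval around \<alpha> has
  positive mass m, so the averaged energy at some \<beta> in it is at most 2/m. CJ depends on the
  interval alone and is fixed before u and L; \<beta> comes after them.\<close>

lemma X_rad_profile:
  fixes \<gamma> \<alpha> \<delta> :: real and \<mu> :: "real measure"
  assumes dim: "DIM('a::euclidean_space) \<ge> 3" and \<gamma>: "\<gamma> > 0"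
    and \<mu>: "sets \<mu> = sets (restrict_space borel {0<..<real DIM('a)})" "finite_measure \<mu>"
    and \<alpha>: "\<alpha> \<in> P_set DIM('a) \<mu>" and \<delta>: "\<delta> > 0"
  obtains CJ where "CJ \<ge> 0"
    "\<And>(u :: 'a \<Rightarrow> real) L. u \<in> X_rad \<gamma> \<mu> \<Longrightarrow> L > 0 \<Longrightarrow> X_norm \<gamma> \<mu> u < L \<Longrightarrow> \<exists>v (g :: 'a \<Rightarrow> real) \<beta>. radial_profile v g \<and>
      (AE x in lebesgue. u x / L = v (norm x)) \<and> \<bar>\<beta> - \<alpha>\<bar> < \<delta> \<and>
      mass_bounded v TYPE('a) (q_exp \<gamma> \<beta>) ((real DIM('a) - \<beta>) / 2) CJ"
proof -
  let ?n = "DIM('a)"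
  have a: "0 < \<alpha>" "\<alpha> < real ?n" using \<alpha> by (auto simp: P_set_def)
  \<comment> \<open>The closed interval of radius d around \<alpha> must lie inside (0, n), where
    the Riesz constants have a positive minimum, and d must stay below \<delta>.\<close>
  define d where "d = min (\<delta> / 2) (min (\<alpha> / 2) ((real ?n - \<alpha>) / 2))"
  have d: "0 < d" "d < \<delta>" "d < \<alpha>" "d < real ?n - \<alpha>" using \<delta> a by (auto simp: d_def min_def)
  let ?S = "{\<alpha> - d<..<\<alpha> + d}"
  have sub: "?S \<subseteq> {0<..<real ?n}" using d by auto
  have space: "space \<mu> = {0<..<real ?n}"
    using sets_eq_imp_space_eq[OF \<mu>(1)] by (simp add: space_restrict_space)
  interpret coulomb_setting \<gamma> \<mu> "TYPE('a)" by standard (use \<gamma> space in auto)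
  have Sm: "?S \<in> sets \<mu>" unfolding \<mu>(1) by (subst sets_restrict_space_iff) (use sub in auto)
  have "emeasure \<mu> ?S > 0" using \<alpha> sub d(1) by (auto simp: P_set_def)
  moreover have "emeasure \<mu> ?S < \<infinity>" using \<mu>(2) by (simp add: finite_measure.emeasure_finite less_top[symmetric])
  ultimately obtain m where m: "emeasure \<mu> ?S = ennreal m" "m > 0"
    by (cases "emeasure \<mu> ?S") auto
  obtain A where A: "A > 0" "\<And>\<beta>. \<beta> \<in> {\<alpha> - d..\<alpha> + d} \<Longrightarrow> A \<le> riesz_const ?n (\<beta> / 2)"
    using riesz_const_lower_bound[of "\<alpha> - d" "\<alpha> + d" ?n] d by auto
  define CJ where "CJ = sqrt (2 / m / unit_ball_vol (real ?n)) * 6 ^ ?n / A"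
  have CJ: "CJ \<ge> 0" using A(1) m(2) by (simp add: CJ_def)
  show thesis
  proof (rule that[OF CJ])
    fix u :: "'a \<Rightarrow> real" and L :: real
    assume u: "u \<in> X_rad \<gamma> \<mu>" and L: "L > 0" "X_norm \<gamma> \<mu> u < L"
    have uD: "u \<in> D12" and uc: "u \<in> coulomb_space \<gamma> \<mu>" and ur: "radial u"
      using u by (auto simp: X_rad_def X_space_def)
    have "Lp_norm 2 (weak_gradient u) \<ge> 0" by (simp add: Lp_norm_def)
    then have n1: "Lp_norm 2 (weak_gradient u) \<le> L" and n2: "coulomb_norm \<gamma> \<mu> u < L"
      using coulomb_norm_nonneg[OF uc] L(2) by (auto simp: X_norm_def)
    obtain v and g :: "'a \<Rightarrow> real" where v: "radial_profile v g" "AE x in lebesgue. u x / L = v (norm x)"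
      by (rule radial_profile_exists[OF dim uD ur L(1) n1])
    obtain \<beta> where b: "\<beta> \<in> ?S"
      "(\<integral>\<^sup>+x. (nn_convolution (riesz_kernel (\<beta> / 2)) (\<lambda>y. \<bar>u y / L\<bar> powr q_exp \<gamma> \<beta>) x)\<^sup>2 \<partial>lebesgue) \<le> ennreal (2 / m)"
      by (rule coulomb_modular_good_exponent[OF coulomb_norm_less[OF uc n2] Sm m])
    have um: "(\<lambda>x. u x / L) \<in> borel_measurable lebesgue"
      using uD by (auto simp: D12_def Lp_space_def)
    have "mass_bounded v TYPE('a) (q_exp \<gamma> \<beta>) ((real ?n - \<beta>) / 2) CJ"
      unfolding mass_bounded_def
    proof (intro allI impI)
      fix S :: real assume S: "0 < S"
      have "radial_mass TYPE('a) v (q_exp \<gamma> \<beta>) (shell S (2 * S))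
         = (\<integral>\<^sup>+x. ennreal (\<bar>u x / L\<bar> powr q_exp \<gamma> \<beta>) * indicator (shell S (2 * S)) x \<partial>lebesgue)"
        by (rule nn_integral_lebesgue_eq_lborel[symmetric]) (use v(2) in \<open>eventually_elim, simp\<close>)
      also have "\<dots> \<le> ennreal (CJ * S powr ((real ?n - \<beta>) / 2))"
        unfolding CJ_def
        by (rule coulomb_shell_bound[OF um _ _ A(1) A(2) _ S b(2)]) (use b(1) sub m(2) in auto)
      finally show "radial_mass TYPE('a) v (q_exp \<gamma> \<beta>) (shell S (2 * S)) \<le> ennreal (CJ * S powr ((real ?n - \<beta>) / 2))" .
    qed
    moreover have "\<bar>\<beta> - \<alpha>\<bar> < \<delta>" using b(1) d(2) by auto
    ultimately show "\<exists>v (g :: 'a \<Rightarrow> real) \<beta>. radial_profile v g \<and> (AE x in lebesgue. u x / L = v (norm x)) \<and> \<bar>\<beta> - \<alpha>\<bar> < \<delta> \<and>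
      mass_bounded v TYPE('a) (q_exp \<gamma> \<beta>) ((real ?n - \<beta>) / 2) CJ"
      using v by blast
  qed
qed

lemma X_norm_nonneg:
  fixes u :: "'a::euclidean_space \<Rightarrow> real"
  assumes "\<gamma> > 0" "space \<mu> = {0<..<real DIM('a)}" "u \<in> X_space \<gamma> \<mu>"
  shows "X_norm \<gamma> \<mu> u \<ge> 0"
proof -
  interpret coulomb_setting \<gamma> \<mu> "TYPE('a)" by standard (use assms in auto)
  have "Lp_norm 2 (weak_gradient u) \<ge> 0" by (simp add: Lp_norm_def)
  then show ?thesis using coulomb_norm_nonneg[of u] assms(3) by (simp add: X_norm_def X_space_def)
qed

lemma X_rad_continuously_embedded:
  fixes \<gamma> r K :: real and \<mu> :: "real measure"
  assumes \<gamma>: "\<gamma> > 0" and space: "space \<mu> = {0<..<real DIM('a::euclidean_space)}" and r: "r > 0" and K: "K \<ge> 0"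
    and bound: "\<And>(u :: 'a \<Rightarrow> real) L. u \<in> X_rad \<gamma> \<mu> \<Longrightarrow> L > 0 \<Longrightarrow> X_norm \<gamma> \<mu> u < L \<Longrightarrow>
      (\<integral>\<^sup>+x. ennreal (\<bar>u x / L\<bar> powr r) \<partial>lebesgue) \<le> ennreal K"
  shows "continuously_embedded (X_rad \<gamma> \<mu> :: ('a \<Rightarrow> real) set) (X_norm \<gamma> \<mu>) (Lp_space r) (Lp_norm r)"
proof -
  have "u \<in> Lp_space r \<and> Lp_norm r u \<le> K powr (1 / r) * X_norm \<gamma> \<mu> u" if u: "u \<in> X_rad \<gamma> \<mu>" for u :: "'a \<Rightarrow> real"
  proof -
    have um: "u \<in> borel_measurable lebesgue" using u by (auto simp: X_rad_def X_space_def D12_def Lp_space_def)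
    have nn: "X_norm \<gamma> \<mu> u \<ge> 0" using X_norm_nonneg[OF \<gamma> space] u by (simp add: X_rad_def)
    have *: "u \<in> Lp_space r" "Lp_norm r u \<le> L * K powr (1 / r)" if "X_norm \<gamma> \<mu> u < L" for L
      using Lp_norm_le_scaled[OF um _ r K bound[OF u _ that]] that nn by auto
    \<comment> \<open>The bound is available only for L strictly above the norm; letting L decrease
      to the norm also covers functions of norm 0.\<close>
    have "Lp_norm r u \<le> X_norm \<gamma> \<mu> u * K powr (1 / r)"
    proof (rule tendsto_lowerbound)
      show "((\<lambda>L. L * K powr (1 / r)) \<longlongrightarrow> X_norm \<gamma> \<mu> u * K powr (1 / r)) (at_right (X_norm \<gamma> \<mu> u))"
        by (intro tendsto_intros)
      show "\<forall>\<^sub>F L in at_right (X_norm \<gamma> \<mu> u). Lp_norm r u \<le> L * K powr (1 / r)"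
        using *(2) by (auto simp: eventually_at_filter)
    qed simp
    then show ?thesis using *(1)[of "X_norm \<gamma> \<mu> u + 1"] by (simp add: mult.commute)
  qed
  then show ?thesis unfolding continuously_embedded_def by blast
qed

lemma X_rad_compactly_embedded:
  fixes \<gamma> r K \<tau> :: real and \<mu> :: "real measure"
  assumes dim: "DIM('a::euclidean_space) \<ge> 3" and \<gamma>: "\<gamma> > 0" and space: "space \<mu> = {0<..<real DIM('a)}"
    and K: "K \<ge> 0" "\<tau> > 0" "r > 0"
    and bound: "\<And>(u :: 'a \<Rightarrow> real) L. u \<in> X_rad \<gamma> \<mu> \<Longrightarrow> L > 0 \<Longrightarrow> X_norm \<gamma> \<mu> u < L \<Longrightarrow>
      \<exists>v (g :: 'a \<Rightarrow> real). radial_profile v g \<and> (AE x in lebesgue. u x / L = v (norm x)) \<and> tails_bounded v TYPE('a) r K \<tau>"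
  shows "compactly_embedded (X_rad \<gamma> \<mu> :: ('a \<Rightarrow> real) set) (X_norm \<gamma> \<mu>) (Lp_space r) (Lp_norm r)"
  unfolding compactly_embedded_def
proof (intro conjI allI impI)
  show "continuously_embedded (X_rad \<gamma> \<mu> :: ('a \<Rightarrow> real) set) (X_norm \<gamma> \<mu>) (Lp_space r) (Lp_norm r)"
  proof (rule X_rad_continuously_embedded[OF \<gamma> space K(3)])
    show "2 * K \<ge> 0" using K by simp
    fix u :: "'a \<Rightarrow> real" and L :: real assume u: "u \<in> X_rad \<gamma> \<mu>" "L > 0" "X_norm \<gamma> \<mu> u < L"
    obtain v and g :: "'a \<Rightarrow> real" where v: "radial_profile v g" "AE x in lebesgue. u x / L = v (norm x)" "tails_bounded v TYPE('a) r K \<tau>"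
      using bound[OF u] by blast
    have "(\<integral>\<^sup>+x. ennreal (\<bar>u x / L\<bar> powr r) \<partial>lebesgue) = (\<integral>\<^sup>+x. ennreal (\<bar>v (norm x)\<bar> powr r) \<partial>(lborel :: 'a measure))"
      by (rule nn_integral_lebesgue_eq_lborel) (use v(2) in \<open>eventually_elim, simp\<close>)
    also have "\<dots> \<le> ennreal (2 * K)" by (rule nn_integral_le_tails[OF radial_profile.v_meas[OF v(1)] K(1) v(3)])
    finally show "(\<integral>\<^sup>+x. ennreal (\<bar>u x / L\<bar> powr r) \<partial>lebesgue) \<le> ennreal (2 * K)" .
  qed
  fix u :: "nat \<Rightarrow> 'a \<Rightarrow> real" assume u: "\<forall>k. u k \<in> X_rad \<gamma> \<mu>" and C: "\<exists>C. \<forall>k. X_norm \<gamma> \<mu> (u k) \<le> C"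
  from C obtain C where C: "\<And>k. X_norm \<gamma> \<mu> (u k) \<le> C" by blast
  \<comment> \<open>One scaling factor for the whole sequence: L times the limit of the profiles is
    then the limit of the functions.\<close>
  define L where "L = \<bar>C\<bar> + 1"
  have L: "L > 0" "\<And>k. X_norm \<gamma> \<mu> (u k) < L"
  proof -
    show "X_norm \<gamma> \<mu> (u k) < L" for k using C[of k] unfolding L_def by linarith
  qed (simp add: L_def)
  have "\<forall>k. \<exists>v (g :: 'a \<Rightarrow> real). radial_profile v g \<and> (AE x in lebesgue. u k x / L = v (norm x)) \<and> tails_bounded v TYPE('a) r K \<tau>"
    using bound u L by blast
  then obtain v and g :: "nat \<Rightarrow> 'a \<Rightarrow> real" where v: "\<And>k. radial_profile (v k) (g k)"
    "\<And>k. AE x in lebesgue. u k x / L = v k (norm x)" "\<And>k. tails_bounded (v k) TYPE('a) r K \<tau>"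
    by metis
  obtain s V where s: "strict_mono s" and V: "\<And>t. (\<lambda>k. v (s k) t) \<longlonglongrightarrow> V t"
    by (rule radial_profiles_convergent_subsequence[of v g]) (use v(1) in auto)
  note tc = tails_compactness[of "\<lambda>k. v (s k)" "\<lambda>k. g (s k)" V K \<tau> r, OF v(1) V K v(3)]
  define w where "w x = L * V (norm x)" for x :: 'a
  have wm: "w \<in> borel_measurable lebesgue"
  proof -
    note tc(1)[measurable]
    show ?thesis unfolding w_def[abs_def] by (intro borel_imp_lebesgue) measurable
  qed
  have wL: "w \<in> Lp_space r"
  proof (rule Lp_norm_le_scaled(1)[OF wm L(1) K(3)])
    show "2 * K \<ge> 0" using K by simp
    show "(\<integral>\<^sup>+x. ennreal (\<bar>w x / L\<bar> powr r) \<partial>lebesgue) \<le> ennreal (2 * K)"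
      using nn_integral_le_tails[OF tc(1) K(1) tc(2)] L(1) by (simp add: w_def nn_integral_completion)
  qed
  let ?d = "\<lambda>k. \<integral>\<^sup>+x. ennreal (\<bar>v (s k) (norm x) - V (norm x)\<bar> powr r) \<partial>(lborel :: 'a measure)"
  have bnd: "Lp_norm r (\<lambda>x. u (s k) x - w x) \<le> L * enn2real (?d k) powr (1 / r)" if fin: "?d k < \<infinity>" for k
  proof (rule Lp_norm_le_scaled(2)[OF _ L(1) K(3)])
    have "u (s k) \<in> borel_measurable lebesgue" using u by (auto simp: X_rad_def X_space_def D12_def Lp_space_def)
    then show "(\<lambda>x. u (s k) x - w x) \<in> borel_measurable lebesgue" using wm by measurable
    have "(\<integral>\<^sup>+x. ennreal (\<bar>(u (s k) x - w x) / L\<bar> powr r) \<partial>lebesgue) = ?d k"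
    proof (rule nn_integral_lebesgue_eq_lborel)
      show "AE x in lebesgue. ennreal (\<bar>(u (s k) x - w x) / L\<bar> powr r) = ennreal (\<bar>v (s k) (norm x) - V (norm x)\<bar> powr r)"
        using v(2)[of "s k"] by eventually_elim (use L(1) in \<open>simp add: w_def diff_divide_distrib\<close>)
    qed
    then show "(\<integral>\<^sup>+x. ennreal (\<bar>(u (s k) x - w x) / L\<bar> powr r) \<partial>lebesgue) \<le> ennreal (enn2real (?d k))"
      using fin by (simp add: less_top)
  qed simp
  have "(\<lambda>k. Lp_norm r (\<lambda>x. u (s k) x - w x)) \<longlonglongrightarrow> 0"
  proof (rule tendsto_sandwich)
    show "\<forall>\<^sub>F k in sequentially. 0 \<le> Lp_norm r (\<lambda>x. u (s k) x - w x)" by (simp add: Lp_norm_def)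
    \<comment> \<open>\<open>enn2real\<close> sends infinity to 0, so the bound \<open>bnd\<close>
      is meaningful only for finite distances, which convergence guarantees eventually.\<close>
    have "\<forall>\<^sub>F k in sequentially. ?d k < \<infinity>" using tc(3) by (rule order_tendstoD) simp
    then show "\<forall>\<^sub>F k in sequentially. Lp_norm r (\<lambda>x. u (s k) x - w x) \<le> L * enn2real (?d k) powr (1 / r)"
      by eventually_elim (rule bnd)
    have "(\<lambda>k. enn2real (?d k)) \<longlonglongrightarrow> 0"
      by (rule tendsto_enn2real) (use tc(3) in auto)
    then have "(\<lambda>k. enn2real (?d k) powr (1 / r)) \<longlonglongrightarrow> 0 powr (1 / r)"
      by (intro tendsto_powr' tendsto_const) (use K(3) in auto)
    then show "(\<lambda>k. L * enn2real (?d k) powr (1 / r)) \<longlonglongrightarrow> 0"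
      using tendsto_mult_right_zero by fastforce
  qed simp
  then show "\<exists>v\<in>Lp_space r. \<exists>s. strict_mono s \<and> (\<lambda>k. Lp_norm r (\<lambda>x. u (s k) x - v x)) \<longlonglongrightarrow> 0"
    using wL s by blast
qed

theorem theorem1p1:
  fixes N :: nat and \<gamma> a b \<alpha> r :: real and \<mu> :: "real measure"
  assumes "N = DIM('a::euclidean_space)" and "N \<ge> 3"
    and "\<gamma> > 0"
    and "0 < a" and "a < b" and "b < real N"
    and "sets \<mu> = sets (restrict_space borel {0<..<real N})"
    and "finite_measure \<mu>"
    and "emeasure \<mu> ({0<..<real N} - {a..b}) = 0"
    and "\<alpha> \<in> P_set N \<mu> \<inter> {1<..<real N}"
    and "(q_exp \<gamma> \<alpha> < (real N + \<alpha>) / (real N - 2) \<and> q_rad N \<gamma> \<alpha> < r \<and> r \<le> sobolev_exp N) \<or>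
         (q_exp \<gamma> \<alpha> > (real N + \<alpha>) / (real N - 2) \<and> sobolev_exp N \<le> r \<and> r < q_rad N \<gamma> \<alpha>)"
  shows "continuously_embedded (X_rad \<gamma> \<mu> :: ('a \<Rightarrow> real) set) (X_norm \<gamma> \<mu>)
             (Lp_space r) (Lp_norm r) \<and>
         ((q_exp \<gamma> \<alpha> < (real N + \<alpha>) / (real N - 2) \<and> q_rad N \<gamma> \<alpha> < r \<and> r < sobolev_exp N) \<or>
          (q_exp \<gamma> \<alpha> > (real N + \<alpha>) / (real N - 2) \<and> sobolev_exp N < r \<and> r < q_rad N \<gamma> \<alpha>)
          \<longrightarrow> compactly_embedded (X_rad \<gamma> \<mu> :: ('a \<Rightarrow> real) set) (X_norm \<gamma> \<mu>)
                (Lp_space r) (Lp_norm r))"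
proof -
  let ?n = "DIM('a)"
  note N = assms(1)
  have dim: "?n \<ge> 3" using assms(1,2) by simp
  have \<mu>: "sets \<mu> = sets (restrict_space borel {0<..<real ?n})" using assms(7) N by simp
  have space: "space \<mu> = {0<..<real ?n}"
    using sets_eq_imp_space_eq[OF \<mu>] by (simp add: space_restrict_space)
  have P: "\<alpha> \<in> P_set ?n \<mu>" and \<alpha>: "0 < \<alpha>" "\<alpha> < real ?n" using assms(10) N by auto
  have sob: "sobolev_exp ?n > 0" using dim by (simp add: sobolev_exp_def)
  have strict: "compactly_embedded (X_rad \<gamma> \<mu> :: ('a \<Rightarrow> real) set) (X_norm \<gamma> \<mu>) (Lp_space r) (Lp_norm r)"
    if r: "(q_rad ?n \<gamma> \<alpha> < r \<and> r < sobolev_exp ?n) \<or> (sobolev_exp ?n < r \<and> r < q_rad ?n \<gamma> \<alpha>)"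
  proof -
    have r0: "r > 0"
      using r sob q_rad_greater[OF assms(3) \<alpha> dim] q_exp_gt_1[OF assms(3) \<alpha>(1)] by auto
    have "\<forall>\<^sub>F \<delta> in at_right 0. uniform_tails TYPE('a) \<gamma> \<alpha> r \<delta>"
      using r uniform_tails_subcritical[OF dim assms(3) \<alpha>] uniform_tails_supercritical[OF dim assms(3) \<alpha>] by blast
    from eventually_happens'[OF trivial_limit_at_right_real eventually_conj[OF eventually_at_right_less this]]
    obtain \<delta> where \<delta>: "\<delta> > 0" "uniform_tails TYPE('a) \<gamma> \<alpha> r \<delta>"
      by (elim exE conjE) (rule that)
    obtain CJ where CJ: "CJ \<ge> 0" "\<And>(u :: 'a \<Rightarrow> real) L. u \<in> X_rad \<gamma> \<mu> \<Longrightarrow> L > 0 \<Longrightarrow> X_norm \<gamma> \<mu> u < L \<Longrightarrow> \<exists>v (g :: 'a \<Rightarrow> real) \<beta>. radial_profile v g \<and>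
      (AE x in lebesgue. u x / L = v (norm x)) \<and> \<bar>\<beta> - \<alpha>\<bar> < \<delta> \<and> mass_bounded v TYPE('a) (q_exp \<gamma> \<beta>) ((real ?n - \<beta>) / 2) CJ"
      using X_rad_profile[OF dim assms(3) \<mu> assms(8) P \<delta>(1)] by blast
    obtain K \<tau> where K: "K \<ge> 0" "\<tau> > 0" "\<And>v (g :: 'a \<Rightarrow> real) \<beta>. radial_profile v g \<Longrightarrow> \<bar>\<beta> - \<alpha>\<bar> < \<delta> \<Longrightarrow>
      mass_bounded v TYPE('a) (q_exp \<gamma> \<beta>) ((real ?n - \<beta>) / 2) CJ \<Longrightarrow> tails_bounded v TYPE('a) r K \<tau>"
      using \<delta>(2)[unfolded uniform_tails_def, rule_format, OF CJ(1)] by blast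
    show ?thesis
    proof (rule X_rad_compactly_embedded[OF dim assms(3) space K(1,2) r0])
      fix u :: "'a \<Rightarrow> real" and L :: real assume u: "u \<in> X_rad \<gamma> \<mu>" "L > 0" "X_norm \<gamma> \<mu> u < L"
      show "\<exists>v (g :: 'a \<Rightarrow> real). radial_profile v g \<and> (AE x in lebesgue. u x / L = v (norm x)) \<and> tails_bounded v TYPE('a) r K \<tau>"
        using CJ(2)[OF u] K(3) by blast
    qed
  qed
  \<comment> \<open>At the critical exponent the decay bounds |v|^r only by a multiple of |x|^(-n),
    whose integral diverges logarithmically at both ends; \<open>radial_Sobolev\<close> takes the
    place of the tail estimates and gives boundedness only.\<close>
  have crit: "continuously_embedded (X_rad \<gamma> \<mu> :: ('a \<Rightarrow> real) set) (X_norm \<gamma> \<mu>) (Lp_space r) (Lp_norm r)" if r: "r = sobolev_exp ?n"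
  proof (rule X_rad_continuously_embedded[OF assms(3) space])
    show "r > 0" using r sob by simp
    show "max 0 (sobolev_const ?n) \<ge> 0" by simp
    fix u :: "'a \<Rightarrow> real" and L :: real assume u: "u \<in> X_rad \<gamma> \<mu>" "L > 0" "X_norm \<gamma> \<mu> u < L"
    obtain v and g :: "'a \<Rightarrow> real" where v: "radial_profile v g" "AE x in lebesgue. u x / L = v (norm x)"
      using X_rad_profile[OF dim assms(3) \<mu> assms(8) P zero_less_one] u by metis
    have "(\<integral>\<^sup>+x. ennreal (\<bar>u x / L\<bar> powr r) \<partial>lebesgue) = (\<integral>\<^sup>+x. ennreal (\<bar>v (norm x)\<bar> powr r) \<partial>(lborel :: 'a measure))"
      by (rule nn_integral_lebesgue_eq_lborel) (use v(2) in \<open>eventually_elim, simp\<close>)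
    also have "\<dots> \<le> ennreal (sobolev_const ?n)" unfolding r by (rule radial_profile.radial_Sobolev[OF v(1)])
    also have "\<dots> \<le> ennreal (max 0 (sobolev_const ?n))" by (rule ennreal_leI) simp
    finally show "(\<integral>\<^sup>+x. ennreal (\<bar>u x / L\<bar> powr r) \<partial>lebesgue) \<le> ennreal (max 0 (sobolev_const ?n))" .
  qed
  have "continuously_embedded (X_rad \<gamma> \<mu> :: ('a \<Rightarrow> real) set) (X_norm \<gamma> \<mu>) (Lp_space r) (Lp_norm r)"
  proof (cases "r = sobolev_exp ?n")
    case True
    then show ?thesis by (rule crit)
  next
    case False
    then show ?thesis using strict assms(11) N by (auto simp: compactly_embedded_def)
  qed
  then show ?thesis using strict N by blast
qed

end
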